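(* Fix an integer $k\ge 1$. For all integers $m,n\ge k$ the symplectic quotients $M_{0,k,n}$ and $M_{0,k,m}$ are $\mathbb{Z}^+$-graded regularly symplectomorphic. The symplectic quotients $M_{0,k,n}$ for $1\le n\le k$ are not homeomorphic, i.e. $M_{0,k,m}$ and $M_{0,k,n}$ are not homeomorphic whenever $1\le m<n\le k$.
   Context: Let $V=V_{k,n}=(\mathbb{R}^n)^{2k}$ with points $y=(y_1,\dots,y_{2k})$, $y_i=(y_{i,1},\dots,y_{i,n})\in\mathbb{R}^n$; write $q_{\ell,\alpha}=y_{2\ell-1,\alpha}$ and $p_{\ell,\alpha}=y_{2\ell,\alpha}$ for $\ell=1,\dots,k$. $\mathbb{R}[V]$ is $\mathbb{Z}^+$-graded ($\mathbb{Z}^+$ = nonnegative integers) with all coordinates in degree 1 and carries the Poisson bracket with $\{q_{\ell_1,\alpha},p_{\ell_2,\beta}\}=\delta_{\ell_1,\ell_2}\delta_{\alpha,\beta}$, all other brackets of coordinates being zero. The real orthogonal group $O_n$ acts diagonally on $V$. For $1\le\alpha<\beta\le n$ set $J_{\alpha,\beta}=\sum_{\ell=1}^k (q_{\ell,\alpha}p_{\ell,\beta}-q_{\ell,\beta}p_{\ell,\alpha})$ (components of the moment map), and let $Z=Z_{k,n}\subset V$ be their common zero set. The symplectic quotient is $M_{0,k,n}=Z/O_n$ with the quotient topology. Its algebra of regular functions is $\mathbb{R}[M_{0,k,n}]=\mathbb{R}[V]^{O_n}/\mathcal{I}_Z^{O_n}$, where $\mathcal{I}_Z^{O_n}$ is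 the ideal of invariant polynomials vanishing on $Z$; it is a graded algebra of functions on $M_{0,k,n}$ and inherits a Poisson bracket from $\mathbb{R}[V]$. Two such spaces $M,M'$ are $\mathbb{Z}^+$-graded regularly symplectomorphic if there is an isomorphism $\mathbb{R}[M']\to\mathbb{R}[M]$ of $\mathbb{Z}^+$-graded Poisson algebras whose induced homeomorphism of Zariski closures (the spaces being embedded as semialgebraic sets by homogeneous generators of their algebras of regular functions) restricts to a homeomorphism $M\to M'$; equivalently, there is a homeomorphism $\chi\colon M\to M'$ such that $f\mapsto f\circ\chi$ is an isomorphism $\mathbb{R}[M']\to\mathbb{R}[M]$ of graded Poisson algebras. *)

theory Defs
  imports "HOL-Analysis.Analysis"
begin

section \<open>The phase space and its Poisson algebra of polynomials\<close>

text \<open>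
  A point \<open>y\<close> of \<open>V = (\<real>\<^sup>n)\<^sup>2\<^sup>k\<close> is a function with \<open>y i \<alpha>\<close> the \<open>\<alpha>\<close>-th coordinate of the
  \<open>i\<close>-th vector, \<open>1 \<le> i \<le> 2k\<close>, \<open>1 \<le> \<alpha> \<le> n\<close>, extended by zero outside this range (the
  convention of \<^const>\<open>Euclidean_space\<close>). The subspace topology of the product topology on
  \<^typ>\<open>nat \<Rightarrow> nat \<Rightarrow> real\<close> is then the Euclidean topology of \<open>V\<close>.
\<close>

type_synonym point = "nat \<Rightarrow> nat \<Rightarrow> real"

definition phase_space :: "nat \<Rightarrow> nat \<Rightarrow> point set" where
  "phase_space k n = {y. \<forall>i \<alpha>. i \<notin> {1..2*k} \<or> \<alpha> \<notin> {1..n} \<longrightarrow> y i \<alpha> = 0}"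

definition q_coord :: "nat \<Rightarrow> nat \<Rightarrow> point \<Rightarrow> real" where
  "q_coord l \<alpha> y = y (2*l - 1) \<alpha>"

definition p_coord :: "nat \<Rightarrow> nat \<Rightarrow> point \<Rightarrow> real" where
  "p_coord l \<alpha> y = y (2*l) \<alpha>"

text \<open>
  \<open>\<real>[V]\<close> is the algebra of polynomial functions in the coordinates of \<open>V\<close>, which is the
  polynomial ring because \<open>\<real>\<close> is infinite. Its elements are functions on the ambient type, but
  they only depend on the coordinates \<open>y i \<alpha>\<close> with \<open>(i, \<alpha>)\<close> in the range above.
\<close>

inductive_set polys :: "nat \<Rightarrow> nat \<Rightarrow> (point \<Rightarrow> real) set" for k n :: nat where
  const: "(\<lambda>y. c) \<in> polys k n"
| coord: "i \<in> {1..2*k} \<Longrightarrow> \<alpha> \<in> {1..n} \<Longrightarrow> (\<lambda>y. y i \<alpha>) \<in> polys k n"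
| add: "F \<in> polys k n \<Longrightarrow> G \<in> polys k n \<Longrightarrow> (\<lambda>y. F y + G y) \<in> polys k n"
| mult: "F \<in> polys k n \<Longrightarrow> G \<in> polys k n \<Longrightarrow> (\<lambda>y. F y * G y) \<in> polys k n"

text \<open>The grading with all coordinates in degree one; \<open>homogeneous k n d F\<close> says that \<open>F\<close> lies in
  the component of degree \<open>d\<close>.\<close>

inductive homogeneous :: "nat \<Rightarrow> nat \<Rightarrow> nat \<Rightarrow> (point \<Rightarrow> real) \<Rightarrow> bool" for k n :: nat where
  zero: "homogeneous k n d (\<lambda>y. 0)"
| const: "homogeneous k n 0 (\<lambda>y. c)"
| coord: "i \<in> {1..2*k} \<Longrightarrow> \<alpha> \<in> {1..n} \<Longrightarrow> homogeneous k n 1 (\<lambda>y. y i \<alpha>)"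
| add: "homogeneous k n d F \<Longrightarrow> homogeneous k n d G \<Longrightarrow> homogeneous k n d (\<lambda>y. F y + G y)"
| mult: "homogeneous k n d F \<Longrightarrow> homogeneous k n e G \<Longrightarrow> homogeneous k n (d + e) (\<lambda>y. F y * G y)"

definition partial :: "nat \<Rightarrow> nat \<Rightarrow> (point \<Rightarrow> real) \<Rightarrow> point \<Rightarrow> real" where
  "partial i \<alpha> F y = deriv (\<lambda>t. F (y(i := (y i)(\<alpha> := t)))) (y i \<alpha>)"

text \<open>The biderivation with \<open>{q\<^sub>l\<^sub>\<alpha>, p\<^sub>l\<^sub>\<alpha>} = 1\<close> and all other brackets of coordinates zero, where
  \<open>q\<^sub>l = y\<^sub>2\<^sub>l\<^sub>-\<^sub>1\<close> and \<open>p\<^sub>l = y\<^sub>2\<^sub>l\<close>.\<close>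

definition poisson :: "nat \<Rightarrow> nat \<Rightarrow> (point \<Rightarrow> real) \<Rightarrow> (point \<Rightarrow> real) \<Rightarrow> point \<Rightarrow> real" where
  "poisson k n F G y = (\<Sum>l=1..k. \<Sum>\<alpha>=1..n.
     partial (2*l - 1) \<alpha> F y * partial (2*l) \<alpha> G y - partial (2*l) \<alpha> F y * partial (2*l - 1) \<alpha> G y)"


section \<open>The orthogonal group, the moment map and the symplectic quotient\<close>

definition orthogonal_group :: "nat \<Rightarrow> (nat \<Rightarrow> nat \<Rightarrow> real) set" where
  "orthogonal_group n = {A. \<forall>\<alpha>\<in>{1..n}. \<forall>\<beta>\<in>{1..n}.
     (\<Sum>\<gamma>=1..n. A \<gamma> \<alpha> * A \<gamma> \<beta>) = (if \<alpha> = \<beta> then 1 else 0)}"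

definition act :: "nat \<Rightarrow> (nat \<Rightarrow> nat \<Rightarrow> real) \<Rightarrow> point \<Rightarrow> point" where
  "act n A y = (\<lambda>i \<alpha>. if \<alpha> \<in> {1..n} then \<Sum>\<beta>=1..n. A \<alpha> \<beta> * y i \<beta> else 0)"

definition orbit :: "nat \<Rightarrow> point \<Rightarrow> point set" where
  "orbit n y = (\<lambda>A. act n A y) ` orthogonal_group n"

definition moment :: "nat \<Rightarrow> nat \<Rightarrow> nat \<Rightarrow> point \<Rightarrow> real" where
  "moment k \<alpha> \<beta> y = (\<Sum>l=1..k. q_coord l \<alpha> y * p_coord l \<beta> y - q_coord l \<beta> y * p_coord l \<alpha> y)"

definition zero_fibre :: "nat \<Rightarrow> nat \<Rightarrow> point set" where
  "zero_fibre k n = {y \<in> phase_space k n. \<forall>\<alpha> \<beta>. 1 \<le> \<alpha> \<and> \<alpha> < \<beta> \<and> \<beta> \<le> n \<longrightarrow> moment k \<alpha> \<beta> y = 0}"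

text \<open>The orbit space of the zero fibre with the quotient topology; see \<open>quotient_map_orbit\<close>
  below.\<close>

definition symplectic_quotient :: "nat \<Rightarrow> nat \<Rightarrow> point set topology" where
  "symplectic_quotient k n = topology (\<lambda>U. U \<subseteq> orbit n ` zero_fibre k n \<and>
     openin (top_of_set (zero_fibre k n)) {z \<in> zero_fibre k n. orbit n z \<in> U})"

lemma openin_symplectic_quotient:
  "openin (symplectic_quotient k n) U \<longleftrightarrow> U \<subseteq> orbit n ` zero_fibre k n \<and>
     openin (top_of_set (zero_fibre k n)) {z \<in> zero_fibre k n. orbit n z \<in> U}"
proof -
  let ?Z = "zero_fibre k n"
  let ?P = "\<lambda>U. U \<subseteq> orbit n ` ?Z \<and> openin (top_of_set ?Z) {z \<in> ?Z. orbit n z \<in> U}"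
  have Int: "?P (S \<inter> T)" if "?P S" "?P T" for S T
  proof -
    have "{z \<in> ?Z. orbit n z \<in> S \<inter> T} = {z \<in> ?Z. orbit n z \<in> S} \<inter> {z \<in> ?Z. orbit n z \<in> T}"
      by blast
    with that show ?thesis by (auto intro: openin_Int)
  qed
  have Un: "?P (\<Union>\<K>)" if "\<And>K. K \<in> \<K> \<Longrightarrow> ?P K" for \<K>
  proof -
    have "{z \<in> ?Z. orbit n z \<in> \<Union>\<K>} = (\<Union>K\<in>\<K>. {z \<in> ?Z. orbit n z \<in> K})"
      by blast
    moreover have "openin (top_of_set ?Z) (\<Union>K\<in>\<K>. {z \<in> ?Z. orbit n z \<in> K})"
      using that by (intro openin_Union) blast
    ultimately show ?thesis using that by (simp add: Union_least)
  qed
  have "istopology ?P"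
    unfolding istopology_def
  proof (intro conjI allI impI)
    fix S T assume "?P S" "?P T"
    from Int[OF this] show "S \<inter> T \<subseteq> orbit n ` ?Z"
      and "openin (top_of_set ?Z) {z \<in> ?Z. orbit n z \<in> S \<inter> T}" by simp_all
  next
    fix \<K> assume "\<forall>K\<in>\<K>. ?P K"
    then have "?P (\<Union>\<K>)" by (intro Un) simp
    then show "\<Union>\<K> \<subseteq> orbit n ` ?Z"
      and "openin (top_of_set ?Z) {z \<in> ?Z. orbit n z \<in> \<Union>\<K>}" by simp_all
  qed
  then show ?thesis
    by (simp add: symplectic_quotient_def topology_inverse')
qed

lemma topspace_symplectic_quotient [simp]:
  "topspace (symplectic_quotient k n) = orbit n ` zero_fibre k n"
proof -
  have "{z \<in> zero_fibre k n. orbit n z \<in> orbit n ` zero_fibre k n} = zero_fibre k n"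
    by blast
  then have "openin (symplectic_quotient k n) (orbit n ` zero_fibre k n)"
    by (simp add: openin_symplectic_quotient)
  moreover have "topspace (symplectic_quotient k n) \<subseteq> orbit n ` zero_fibre k n"
    by (metis openin_symplectic_quotient openin_topspace)
  ultimately show ?thesis
    by (meson openin_subset subset_antisym)
qed

lemma quotient_map_orbit:
  "quotient_map (top_of_set (zero_fibre k n)) (symplectic_quotient k n) (orbit n)"
  by (auto simp: quotient_map_def openin_symplectic_quotient)


section \<open>Regular functions on the symplectic quotient\<close>

definition invariant_polys :: "nat \<Rightarrow> nat \<Rightarrow> (point \<Rightarrow> real) set" where
  "invariant_polys k n =
     {F \<in> polys k n. \<forall>A\<in>orthogonal_group n. \<forall>y\<in>phase_space k n. F (act n A y) = F y}"

definition vanishing_invariants :: "nat \<Rightarrow> nat \<Rightarrow> (point \<Rightarrow> real) set" where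
  "vanishing_invariants k n = {F \<in> invariant_polys k n. \<forall>z\<in>zero_fibre k n. F z = 0}"

text \<open>
  The function on the orbit space induced by an invariant polynomial. Two invariant polynomials
  induce the same function iff they differ by an element of \<open>I\<^sub>Z\<^sup>O\<close>
  (lemma \<open>induced_eq_iff\<close> below), so the induced functions form the quotient
  \<open>\<real>[V]\<^sup>O / I\<^sub>Z\<^sup>O\<close>. Functions are extensional on the orbit space.
\<close>

definition induced :: "nat \<Rightarrow> nat \<Rightarrow> (point \<Rightarrow> real) \<Rightarrow> point set \<Rightarrow> real" where
  "induced k n F = (\<lambda>c \<in> topspace (symplectic_quotient k n). the_elem (F ` c))"

definition regular_functions :: "nat \<Rightarrow> nat \<Rightarrow> (point set \<Rightarrow> real) set" where
  "regular_functions k n = induced k n ` invariant_polys k n"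

definition regular_of_degree :: "nat \<Rightarrow> nat \<Rightarrow> nat \<Rightarrow> (point set \<Rightarrow> real) set" where
  "regular_of_degree k n d = induced k n ` {F \<in> invariant_polys k n. homogeneous k n d F}"

text \<open>The bracket inherited from \<open>\<real>[V]\<close>: independent of the chosen representatives, because
  Hamiltonian flows of invariant polynomials preserve \<open>Z\<close>.\<close>

definition quotient_poisson ::
  "nat \<Rightarrow> nat \<Rightarrow> (point set \<Rightarrow> real) \<Rightarrow> (point set \<Rightarrow> real) \<Rightarrow> point set \<Rightarrow> real" where
  "quotient_poisson k n f g = (THE h. \<exists>F\<in>invariant_polys k n. \<exists>G\<in>invariant_polys k n.
     f = induced k n F \<and> g = induced k n G \<and> h = induced k n (poisson k n F G))"

lemma act_in_phase_space:
  "y \<in> phase_space k n \<Longrightarrow> act n A y \<in> phase_space k n"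
  by (auto simp: phase_space_def act_def)

lemma self_in_orbit:
  assumes "y \<in> phase_space k n"
  shows "y \<in> orbit n y"
proof -
  let ?I = "\<lambda>\<alpha> \<beta>. if \<alpha> = \<beta> then 1 else (0::real)"
  have delta: "(\<Sum>\<gamma>=1..n. ?I \<alpha> \<gamma> * f \<gamma>) = (if \<alpha> \<in> {1..n} then f \<alpha> else 0)" for \<alpha> f
  proof -
    have "(\<Sum>\<gamma>=1..n. ?I \<alpha> \<gamma> * f \<gamma>) = (\<Sum>\<gamma>=1..n. if \<alpha> = \<gamma> then f \<gamma> else 0)"
      by (rule sum.cong) auto
    then show ?thesis by (simp add: sum.delta')
  qed
  have "(\<Sum>\<gamma>=1..n. ?I \<gamma> \<alpha> * ?I \<gamma> \<beta>) = (if \<alpha> = \<beta> then 1 else 0)" if "\<alpha> \<in> {1..n}" for \<alpha> \<beta>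
  proof -
    have "(\<Sum>\<gamma>=1..n. ?I \<gamma> \<alpha> * ?I \<gamma> \<beta>) = (\<Sum>\<gamma>=1..n. ?I \<alpha> \<gamma> * ?I \<gamma> \<beta>)"
      by (rule sum.cong) auto
    with that show ?thesis by (simp only: delta if_True)
  qed
  then have "?I \<in> orthogonal_group n"
    by (simp add: orthogonal_group_def)
  moreover have "act n ?I y = y"
    using assms unfolding act_def delta by (force simp: phase_space_def fun_eq_iff)
  ultimately show ?thesis
    unfolding orbit_def by (metis image_eqI)
qed

lemma induced_apply:
  assumes "F \<in> invariant_polys k n" "z \<in> zero_fibre k n"
  shows "induced k n F (orbit n z) = F z"
proof -
  have z: "z \<in> phase_space k n"
    using assms(2) by (simp add: zero_fibre_def)
  have "F w = F z" if "w \<in> orbit n z" for w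
    using that assms(1) z by (auto simp: orbit_def invariant_polys_def)
  then have "F ` orbit n z = {F z}"
    using self_in_orbit[OF z] by blast
  with assms(2) show ?thesis by (simp add: induced_def)
qed

lemma induced_eq_iff:
  assumes "F \<in> invariant_polys k n" "G \<in> invariant_polys k n"
  shows "induced k n F = induced k n G \<longleftrightarrow> (\<lambda>y. F y - G y) \<in> vanishing_invariants k n"
proof -
  have "(\<lambda>y. F y + (-1) * G y) \<in> polys k n"
    using assms by (intro polys.intros) (auto simp: invariant_polys_def)
  then have "(\<lambda>y. F y - G y) \<in> invariant_polys k n"
    using assms by (simp add: invariant_polys_def)
  then have "(\<lambda>y. F y - G y) \<in> vanishing_invariants k n \<longleftrightarrow> (\<forall>z\<in>zero_fibre k n. F z = G z)"
    by (simp add: vanishing_invariants_def)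
  also have "\<dots> \<longleftrightarrow> (\<forall>z\<in>zero_fibre k n. induced k n F (orbit n z) = induced k n G (orbit n z))"
    using assms by (simp add: induced_apply)
  also have "\<dots> \<longleftrightarrow> induced k n F = induced k n G"
  proof
    assume "\<forall>z\<in>zero_fibre k n. induced k n F (orbit n z) = induced k n G (orbit n z)"
    then show "induced k n F = induced k n G"
      by (intro extensionalityI[where A = "topspace (symplectic_quotient k n)"])
         (auto simp: induced_def)
  qed simp
  finally show ?thesis by blast
qed


section \<open>Graded regular symplectomorphisms\<close>

text \<open>Isomorphisms of graded Poisson algebras from the regular functions on the space with
  parameters \<open>(k', n')\<close> to those on the space with parameters \<open>(k, n)\<close>. The algebra operations
  are pointwise.\<close>

definition graded_poisson_iso ::
  "nat \<Rightarrow> nat \<Rightarrow> nat \<Rightarrow> nat \<Rightarrow> ((point set \<Rightarrow> real) \<Rightarrow> point set \<Rightarrow> real) \<Rightarrow> bool" where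
  "graded_poisson_iso k' n' k n \<phi> \<longleftrightarrow>
     (let M' = topspace (symplectic_quotient k' n');
          M = topspace (symplectic_quotient k n);
          R' = regular_functions k' n';
          R = regular_functions k n
      in bij_betw \<phi> R' R
       \<and> (\<forall>f\<in>R'. \<forall>g\<in>R'. \<phi> (\<lambda>c\<in>M'. f c + g c) = (\<lambda>c\<in>M. \<phi> f c + \<phi> g c))
       \<and> (\<forall>f\<in>R'. \<forall>g\<in>R'. \<phi> (\<lambda>c\<in>M'. f c * g c) = (\<lambda>c\<in>M. \<phi> f c * \<phi> g c))
       \<and> (\<forall>a. \<phi> (\<lambda>c\<in>M'. a) = (\<lambda>c\<in>M. a))
       \<and> (\<forall>d. \<phi> ` regular_of_degree k' n' d = regular_of_degree k n d)
       \<and> (\<forall>f\<in>R'. \<forall>g\<in>R'.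
            \<phi> (quotient_poisson k' n' f g) = quotient_poisson k n (\<phi> f) (\<phi> g)))"

definition graded_regularly_symplectomorphic :: "nat \<Rightarrow> nat \<Rightarrow> nat \<Rightarrow> nat \<Rightarrow> bool" where
  "graded_regularly_symplectomorphic k n k' n' \<longleftrightarrow>
     (\<exists>h. homeomorphic_map (symplectic_quotient k n) (symplectic_quotient k' n') h \<and>
          graded_poisson_iso k' n' k n (\<lambda>f. compose (topspace (symplectic_quotient k n)) f h))"

end

theory Submission
  imports Defs "HOL-Homology.Invariance_of_Domain"
begin

text \<open>
  A point of \<open>V\<close> is an \<open>n \<times> 2k\<close> matrix with columns \<open>y\<^sub>i\<close>, on which \<open>O\<^sub>n\<close> acts from the left. Two
  points lie in the same orbit iff they have the same Gram matrix \<open>(\<langle>y\<^sub>i, y\<^sub>j\<rangle>)\<close>, and the Gram map is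
  proper, so the symplectic quotient is homeomorphic to the space of Gram matrices of points of \<open>Z\<close>
  (\<open>homeomorphic_map_orbit_gram\<close>). The equations defining \<open>Z\<close> say that the rows of the matrix span
  an isotropic subspace of \<open>\<real>\<^sup>2\<^sup>k\<close>.

  Isotropic subspaces have dimension at most \<open>k\<close>. For \<open>n \<ge> k\<close>, an orthogonal transformation
  therefore moves every point of \<open>Z\<close> into the subspace of matrices whose rows after the first \<open>k\<close>
  vanish, and the space of Gram matrices does not depend on \<open>n\<close> (\<open>gram_image_zero_fibre\<close>). The regular functions are the same, too: by the first
  fundamental theorem for \<open>O\<^sub>n\<close> (\<open>fft\<close>), invariants are polynomials in the Gram matrix, and their
  brackets are given by formulas in the Gram matrix without reference to \<open>n\<close>. That the bracket
  descends to the quotient rests on explicit Hamiltonian flows that preserve \<open>Z\<close>, namely symplectic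
  transvections (\<open>poisson_vanishing\<close>).

  The first fundamental theorem is proved through a positivity argument for the Fischer inner product on
  polynomials. On invariants of degree \<open>d\<close>, the operator \<open>L = \<Sum> \<langle>y\<^sub>i, y\<^sub>j\<rangle> \<langle>\<partial>\<^sub>i, \<partial>\<^sub>j\<rangle>\<close> satisfies
  \<open>L + d = \<Sum> E\<^sub>\<alpha>\<^sub>\<beta> E\<^sub>\<alpha>\<^sub>\<beta>\<^sup>*\<close> with the polarization operators \<open>E\<^sub>\<alpha>\<^sub>\<beta>\<close> of the rows, and the
  diagonal terms alone contribute at least \<open>2 d\<close>, because invariants have even degree in every row.
  So \<open>L \<ge> d\<close> (\<open>gram_contraction_bound\<close>). By induction on the degree \<open>d > 0\<close>, \<open>L\<close> maps invariants to
  polynomials in the inner products. An invariant orthogonal to these is orthogonal to its image under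
  the positive operator \<open>L\<close>, hence zero.

  For \<open>n \<le> k\<close> the dimension of the quotient is \<open>n (2k + 1 - n)\<close>, which is strictly increasing in
  \<open>n\<close>. Near any Gram matrix of locally maximal rank \<open>r\<close>, the space of Gram matrices embeds into
  \<open>\<real>\<close> to the power \<open>r (2k + 1 - r)\<close>. The coordinates come from \<open>r\<close> independent vectors \<open>y\<^sub>a\<close>, at most
  one from each conjugate pair, that span the others (\<open>maximal_polarized_spanning\<close>,
  \<open>chart_injective\<close>). Conversely, matrices \<open>A (1 | C | R)\<close> with triangular \<open>A\<close> give an injective
  continuous map from \<open>\<real>\<close> to the power \<open>n (2k + 1 - n)\<close> to the quotient (\<open>param_injective\<close>). By
  invariance of domain, a homeomorphism between the quotients for \<open>m < n\<close> cannot exist.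
\<close>

section \<open>Calculus of polynomial functions\<close>

lemma polys_uminus: "F \<in> polys k n \<Longrightarrow> (\<lambda>y. - F y) \<in> polys k n"
  using polys.mult[OF polys.const[of "-1"]] by fastforce

lemma polys_diff: "F \<in> polys k n \<Longrightarrow> G \<in> polys k n \<Longrightarrow> (\<lambda>y. F y - G y) \<in> polys k n"
  using polys.add[OF _ polys_uminus] by fastforce

lemma polys_sum: "(\<And>s. s \<in> S \<Longrightarrow> F s \<in> polys k n) \<Longrightarrow> (\<lambda>y. \<Sum>s\<in>S. F s y) \<in> polys k n"
  by (induction S rule: infinite_finite_induct) (auto intro: polys.const polys.add)

lemmas polys_intros = polys.intros polys_uminus polys_diff polys_sum

lemma homogeneous_imp_polys: "homogeneous k n d F \<Longrightarrow> F \<in> polys k n"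
  by (induction rule: homogeneous.induct) (auto intro: polys.intros)

lemma homogeneous_cmult: "homogeneous k n d F \<Longrightarrow> homogeneous k n d (\<lambda>y. c * F y)"
  using homogeneous.mult[OF homogeneous.const[of k n c]] by fastforce

lemma homogeneous_diff:
  "homogeneous k n d F \<Longrightarrow> homogeneous k n d G \<Longrightarrow> homogeneous k n d (\<lambda>y. F y - G y)"
  using homogeneous.add[OF _ homogeneous_cmult[of k n d G "-1"]] by fastforce

lemma homogeneous_sum:
  "(\<And>s. s \<in> S \<Longrightarrow> homogeneous k n d (F s)) \<Longrightarrow> homogeneous k n d (\<lambda>y. \<Sum>s\<in>S. F s y)"
  by (induction S rule: infinite_finite_induct) (auto intro: homogeneous.zero homogeneous.add)

lemma homogeneous_0_const:
  assumes "homogeneous k n d F" "d = 0"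
  shows "\<exists>c. F = (\<lambda>y. c)"
  using assms by (induction rule: homogeneous.induct) (auto simp: fun_eq_iff)

lemma homogeneous_scale: "homogeneous k n d F \<Longrightarrow> F (\<lambda>i \<alpha>. t * y i \<alpha>) = t ^ d * F y"
  by (induction rule: homogeneous.induct) (auto simp: algebra_simps power_add)

lemma polys_cong:
  "F \<in> polys k n \<Longrightarrow> (\<And>i \<alpha>. i \<in> {1..2*k} \<Longrightarrow> \<alpha> \<in> {1..n} \<Longrightarrow> y i \<alpha> = z i \<alpha>) \<Longrightarrow> F y = F z"
  by (induction rule: polys.induct) auto

lemma polys_line_differentiable:
  "F \<in> polys k n \<Longrightarrow> (\<lambda>t. F (y(i := (y i)(\<alpha> := t)))) field_differentiable (at t)"
proof (induction rule: polys.induct)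
  case (coord j \<beta>)
  have "(\<lambda>t. (y(i := (y i)(\<alpha> := t))) j \<beta>) = (if j = i \<and> \<beta> = \<alpha> then (\<lambda>t. t) else (\<lambda>t. y j \<beta>))"
    by auto
  then show ?case by (simp only:) (auto intro: field_differentiable_ident)
qed (auto intro: field_differentiable_add field_differentiable_mult)

lemma polys_has_partial:
  assumes "F \<in> polys k n"
  shows "((\<lambda>t. F (y(i := (y i)(\<alpha> := t)))) has_field_derivative partial i \<alpha> F y) (at (y i \<alpha>))"
  using polys_line_differentiable[OF assms, of y i \<alpha> "y i \<alpha>"]
  by (simp add: partial_def DERIV_deriv_iff_field_differentiable)

lemma partial_eqI:
  "((\<lambda>t. F (y(i := (y i)(\<alpha> := t)))) has_field_derivative D) (at (y i \<alpha>)) \<Longrightarrow> partial i \<alpha> F y = D"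
  by (simp add: partial_def DERIV_imp_deriv)

lemma partial_const [simp]: "partial i \<alpha> (\<lambda>y. c) = (\<lambda>y. 0)"
  by (rule ext, rule partial_eqI) auto

lemma partial_coord:
  "partial i \<alpha> (\<lambda>y. y j \<beta>) = (\<lambda>y. if j = i \<and> \<beta> = \<alpha> then 1 else 0)"
proof (rule ext, rule partial_eqI)
  fix y :: point
  have "(\<lambda>t. (y(i := (y i)(\<alpha> := t))) j \<beta>) = (if j = i \<and> \<beta> = \<alpha> then (\<lambda>t. t) else (\<lambda>t. y j \<beta>))"
    by auto
  then show "((\<lambda>t. (y(i := (y i)(\<alpha> := t))) j \<beta>) has_field_derivative
      (if j = i \<and> \<beta> = \<alpha> then 1 else 0)) (at (y i \<alpha>))"
    by (simp only:) auto
qed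

lemma partial_add:
  assumes "F \<in> polys k n" "G \<in> polys k n"
  shows "partial i \<alpha> (\<lambda>y. F y + G y) = (\<lambda>y. partial i \<alpha> F y + partial i \<alpha> G y)"
  by (rule ext, rule partial_eqI) (auto intro!: DERIV_add polys_has_partial assms)

lemma partial_mult:
  assumes "F \<in> polys k n" "G \<in> polys k n"
  shows "partial i \<alpha> (\<lambda>y. F y * G y) = (\<lambda>y. partial i \<alpha> F y * G y + F y * partial i \<alpha> G y)"
proof (rule ext, rule partial_eqI)
  fix y
  show "((\<lambda>t. F (y(i := (y i)(\<alpha> := t))) * G (y(i := (y i)(\<alpha> := t)))) has_field_derivative
     partial i \<alpha> F y * G y + F y * partial i \<alpha> G y) (at (y i \<alpha>))"
    using DERIV_mult[OF polys_has_partial[OF assms(1), of y i \<alpha>] polys_has_partial[OF assms(2), of y i \<alpha>]]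
    by (simp add: algebra_simps)
qed

lemma partial_cmult:
  "F \<in> polys k n \<Longrightarrow> partial i \<alpha> (\<lambda>y. c * F y) = (\<lambda>y. c * partial i \<alpha> F y)"
  using partial_mult[OF polys.const[of c]] by fastforce

lemma partial_diff:
  assumes "F \<in> polys k n" "G \<in> polys k n"
  shows "partial i \<alpha> (\<lambda>y. F y - G y) = (\<lambda>y. partial i \<alpha> F y - partial i \<alpha> G y)"
  using partial_add[OF assms(1) polys.mult[OF polys.const assms(2)], of i \<alpha> "-1"]
  by (simp only: partial_cmult[OF assms(2)]) simp

lemma partial_sum:
  assumes "\<And>s. s \<in> S \<Longrightarrow> F s \<in> polys k n"
  shows "partial i \<alpha> (\<lambda>y. \<Sum>s\<in>S. F s y) = (\<lambda>y. \<Sum>s\<in>S. partial i \<alpha> (F s) y)"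
  using assms
proof (induction S rule: infinite_finite_induct)
  case (insert x S)
  then have "(\<lambda>y. \<Sum>s\<in>S. F s y) \<in> polys k n" by (auto intro: polys_sum)
  then show ?case using insert by (simp add: partial_add[of "F x" k n])
qed auto

lemma partial_polys: "F \<in> polys k n \<Longrightarrow> partial i \<alpha> F \<in> polys k n"
proof (induction rule: polys.induct)
  case (coord j \<beta>)
  then show ?case by (simp add: partial_coord polys.const)
next
  case (mult F G)
  then show ?case by (simp add: partial_mult[of F k n G] polys_intros)
qed (auto simp: partial_add intro: polys_intros)

text \<open>The case distinction records that in degree zero, where truncated subtraction would leave the
  degree unchanged, the derivative vanishes.\<close>

lemma partial_homogeneous:
  "homogeneous k n d F \<Longrightarrow>
     (case d of 0 \<Rightarrow> partial i \<alpha> F = (\<lambda>y. 0) | Suc e \<Rightarrow> homogeneous k n e (partial i \<alpha> F))"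
proof (induction rule: homogeneous.induct)
  case (zero d)
  then show ?case by (simp add: homogeneous.zero split: nat.split)
next
  case (coord j \<beta>)
  then show ?case by (simp add: partial_coord homogeneous.const)
next
  case (add d F G)
  then have "F \<in> polys k n" "G \<in> polys k n" by (auto intro: homogeneous_imp_polys)
  with add show ?case by (auto simp: partial_add homogeneous.add split: nat.splits)
next
  case (mult d F e G)
  have P: "F \<in> polys k n" "G \<in> polys k n"
    using mult.hyps by (auto intro: homogeneous_imp_polys)
  show ?case
  proof (cases d)
    case 0
    then obtain c where "F = (\<lambda>y. c)" using homogeneous_0_const mult.hyps(1) by blast
    with mult 0 P show ?thesis
      by (auto simp: partial_cmult[OF P(2)] homogeneous_cmult split: nat.splits)
  next
    case d: (Suc d')
    then have F': "homogeneous k n d' (partial i \<alpha> F)" using mult by simp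
    show ?thesis
    proof (cases e)
      case 0
      then obtain c where "G = (\<lambda>y. c)" using homogeneous_0_const mult.hyps(2) by blast
      with F' d 0 show ?thesis
        using homogeneous_cmult[OF F', of c]
        by (simp add: partial_cmult[OF P(1)] mult.commute[of _ c])
    next
      case e: (Suc e')
      then have G': "homogeneous k n e' (partial i \<alpha> G)" using mult by simp
      have "homogeneous k n (d' + e) (\<lambda>y. partial i \<alpha> F y * G y)"
        "homogeneous k n (d + e') (\<lambda>y. F y * partial i \<alpha> G y)"
        using F' G' mult.hyps by (auto intro: homogeneous.mult)
      with d e show ?thesis by (simp add: partial_mult[OF P] homogeneous.add)
    qed
  qed
qed (auto)

lemma partial_commute:
  "F \<in> polys k n \<Longrightarrow> partial i \<alpha> (partial j \<beta> F) = partial j \<beta> (partial i \<alpha> F)"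
proof (induction rule: polys.induct)
  case (coord j \<beta>)
  then show ?case by (simp add: partial_coord)
next
  case (add F G)
  then show ?case by (simp add: partial_add[of _ k n] partial_polys)
next
  case (mult F G)
  then show ?case
    by (simp add: partial_mult[of _ k n] partial_add[of _ k n] partial_polys polys_intros algebra_simps)
qed auto

text \<open>Euler's identity, the equivariance of derivatives, infinitesimal invariance and the vanishing of
  brackets on the zero fibre all come from this rule, applied to explicit curves.\<close>

lemma polys_chain_rule:
  assumes "F \<in> polys k n"
    and "\<And>i \<alpha>. i \<in> {1..2*k} \<Longrightarrow> \<alpha> \<in> {1..n} \<Longrightarrow>
           ((\<lambda>t. c t i \<alpha>) has_field_derivative c' i \<alpha>) (at t0)"
  shows "((\<lambda>t. F (c t)) has_field_derivative
           (\<Sum>i=1..2*k. \<Sum>\<alpha>=1..n. partial i \<alpha> F (c t0) * c' i \<alpha>)) (at t0)"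
  using assms(1)
proof (induction rule: polys.induct)
  case (coord j \<beta>)
  have "(\<Sum>\<alpha>=1..n. (if j = i \<and> \<beta> = \<alpha> then 1 else 0) * c' i \<alpha>) = (if j = i then c' i \<beta> else 0)" for i
  proof -
    have "(\<Sum>\<alpha>=1..n. (if j = i \<and> \<beta> = \<alpha> then 1 else 0) * c' i \<alpha>)
        = (\<Sum>\<alpha>=1..n. if \<beta> = \<alpha> then (if j = i then c' i \<alpha> else 0) else 0)"
      by (rule sum.cong) auto
    then show ?thesis using coord by simp
  qed
  then have "(\<Sum>i=1..2*k. \<Sum>\<alpha>=1..n. (if j = i \<and> \<beta> = \<alpha> then 1 else 0) * c' i \<alpha>)
      = (\<Sum>i=1..2*k. if j = i then c' i \<beta> else 0)"
    by (simp only:)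
  also have "\<dots> = c' j \<beta>" using coord by simp
  finally show ?case using coord assms(2) by (simp only: partial_coord)
next
  case (add F G)
  have "(\<Sum>i=1..2*k. \<Sum>\<alpha>=1..n. partial i \<alpha> (\<lambda>y. F y + G y) (c t0) * c' i \<alpha>)
     = (\<Sum>i=1..2*k. \<Sum>\<alpha>=1..n. partial i \<alpha> F (c t0) * c' i \<alpha>)
     + (\<Sum>i=1..2*k. \<Sum>\<alpha>=1..n. partial i \<alpha> G (c t0) * c' i \<alpha>)"
    using add.hyps by (simp add: partial_add[of F k n] algebra_simps sum.distrib)
  with DERIV_add[OF add.IH] show ?case by simp
next
  case (mult F G)
  have "(\<Sum>i=1..2*k. \<Sum>\<alpha>=1..n. partial i \<alpha> (\<lambda>y. F y * G y) (c t0) * c' i \<alpha>)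
     = (\<Sum>i=1..2*k. \<Sum>\<alpha>=1..n. partial i \<alpha> F (c t0) * c' i \<alpha>) * G (c t0)
     + (\<Sum>i=1..2*k. \<Sum>\<alpha>=1..n. partial i \<alpha> G (c t0) * c' i \<alpha>) * F (c t0)"
    using mult.hyps
    by (simp add: partial_mult[of F k n] algebra_simps sum.distrib sum_distrib_left sum_distrib_right)
  with DERIV_mult[OF mult.IH] show ?case by simp
qed auto

lemma euler_identity:
  "homogeneous k n d F \<Longrightarrow> (\<Sum>i=1..2*k. \<Sum>\<alpha>=1..n. y i \<alpha> * partial i \<alpha> F y) = real d * F y"
proof -
  assume F: "homogeneous k n d F"
  let ?c = "\<lambda>t i \<alpha>. t * y i \<alpha>"
  have "((\<lambda>t. F (?c t)) has_field_derivative
      (\<Sum>i=1..2*k. \<Sum>\<alpha>=1..n. partial i \<alpha> F (?c 1) * y i \<alpha>)) (at 1)"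
    by (rule polys_chain_rule[OF homogeneous_imp_polys[OF F]]) (auto intro!: derivative_eq_intros)
  moreover have "((\<lambda>t. F (?c t)) has_field_derivative real d * F y) (at 1)"
    unfolding homogeneous_scale[OF F] by (auto intro!: derivative_eq_intros)
  ultimately show ?thesis
    using DERIV_unique by (fastforce simp: mult.commute)
qed


section \<open>The Fischer inner product\<close>

text \<open>On homogeneous polynomials of degree \<open>d\<close> this is \<open>d!\<close> times the Fischer form
  \<open>F(\<partial>) G\<close>. The recursion over first derivatives makes sense for polynomials given as functions,
  and symmetry and positivity are visible from it.\<close>

fun fischer :: "nat \<Rightarrow> nat \<Rightarrow> nat \<Rightarrow> (point \<Rightarrow> real) \<Rightarrow> (point \<Rightarrow> real) \<Rightarrow> real" where
  "fischer k n 0 F G = F (\<lambda>_ _. 0) * G (\<lambda>_ _. 0)"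
| "fischer k n (Suc d) F G =
     (\<Sum>i=1..2*k. \<Sum>\<alpha>=1..n. fischer k n d (partial i \<alpha> F) (partial i \<alpha> G))"

lemma fischer_commute: "fischer k n d F G = fischer k n d G F"
  by (induction d arbitrary: F G) (auto intro!: sum.cong)

lemma fischer_nonneg: "0 \<le> fischer k n d F F"
  by (induction d arbitrary: F) (auto intro!: sum_nonneg)

lemma fischer_add_left:
  "F \<in> polys k n \<Longrightarrow> G \<in> polys k n \<Longrightarrow>
     fischer k n d (\<lambda>y. F y + G y) H = fischer k n d F H + fischer k n d G H"
proof (induction d arbitrary: F G H)
  case (Suc d)
  then show ?case by (simp add: partial_add[of F k n] partial_polys sum.distrib)
qed (simp add: algebra_simps)

lemma fischer_cmult_left:
  "F \<in> polys k n \<Longrightarrow> fischer k n d (\<lambda>y. c * F y) H = c * fischer k n d F H"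
proof (induction d arbitrary: F H)
  case (Suc d)
  then show ?case by (simp add: partial_cmult[of F k n] partial_polys sum_distrib_left)
qed (simp add: algebra_simps)

lemma fischer_zero_left [simp]: "fischer k n d (\<lambda>y. 0) H = 0"
  using fischer_cmult_left[OF polys.const, of k n d 0 0 H] by simp

lemma fischer_sum_left:
  "(\<And>s. s \<in> S \<Longrightarrow> F s \<in> polys k n) \<Longrightarrow>
     fischer k n d (\<lambda>y. \<Sum>s\<in>S. F s y) H = (\<Sum>s\<in>S. fischer k n d (F s) H)"
  by (induction S rule: infinite_finite_induct) (auto simp: fischer_add_left polys_intros)

lemma fischer_diff_left:
  "F \<in> polys k n \<Longrightarrow> G \<in> polys k n \<Longrightarrow>
     fischer k n d (\<lambda>y. F y - G y) H = fischer k n d F H - fischer k n d G H"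
  using fischer_add_left[of F k n "\<lambda>y. (-1) * G y" d H] fischer_cmult_left[of G k n d "-1" H]
  by (simp add: polys_uminus)

text \<open>Euler's identity recovers a homogeneous function from its derivatives, so the form is
  definite on each graded piece.\<close>

lemma fischer_definite:
  "homogeneous k n d F \<Longrightarrow> fischer k n d F F = 0 \<Longrightarrow> F = (\<lambda>y. 0)"
proof (induction d arbitrary: F)
  case 0
  then show ?case using homogeneous_0_const by fastforce
next
  case (Suc d)
  have "partial i \<alpha> F = (\<lambda>y. 0)" if "i \<in> {1..2*k}" "\<alpha> \<in> {1..n}" for i \<alpha>
  proof (rule Suc.IH)
    show "homogeneous k n d (partial i \<alpha> F)" using partial_homogeneous[OF Suc.prems(1)] by simp
    have "\<forall>i\<in>{1..2*k}. (\<Sum>\<alpha>=1..n. fischer k n d (partial i \<alpha> F) (partial i \<alpha> F)) = 0"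
      using Suc.prems(2)
      by (subst (asm) fischer.simps, subst (asm) sum_nonneg_eq_0_iff)
         (auto intro!: sum_nonneg fischer_nonneg)
    with that show "fischer k n d (partial i \<alpha> F) (partial i \<alpha> F) = 0"
      by (subst (asm) sum_nonneg_eq_0_iff) (auto intro!: fischer_nonneg)
  qed
  then have "real (Suc d) * F y = 0" for y
    by (subst euler_identity[OF Suc.prems(1), symmetric]) (auto intro!: sum.neutral)
  then show ?case by (auto simp: fun_eq_iff)
qed

lemma sum_delta_pair:
  fixes f :: "nat \<Rightarrow> nat \<Rightarrow> real"
  assumes "i \<in> {1..M}" "\<alpha> \<in> {1..n}"
  shows "(\<Sum>j=1..M. \<Sum>\<beta>=1..n. (if i = j \<and> \<alpha> = \<beta> then f j \<beta> else 0)) = f i \<alpha>"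
proof -
  have "(\<Sum>\<beta>=1..n. (if i = j \<and> \<alpha> = \<beta> then f j \<beta> else 0)) = (if i = j then f j \<alpha> else 0)" for j
    using assms by (cases "i = j") auto
  then show ?thesis using assms by simp
qed

text \<open>Each of the \<open>d + 1\<close> derivatives taken by the form on the left commutes with the
  multiplication up to the canonical commutator, which accounts for the factor.\<close>

lemma fischer_coord_adjoint:
  assumes "i \<in> {1..2*k}" "\<alpha> \<in> {1..n}"
  shows "F \<in> polys k n \<Longrightarrow> G \<in> polys k n \<Longrightarrow>
    fischer k n (Suc d) (\<lambda>y. y i \<alpha> * F y) G = real (Suc d) * fischer k n d F (partial i \<alpha> G)"
proof (induction d arbitrary: F G)
  case (0 F G)
  have c: "(\<lambda>y. y i \<alpha>) \<in> polys k n" using assms by (rule polys.coord)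
  let ?o = "\<lambda>_ _. 0 :: real"
  have "fischer k n 0 (partial j \<beta> (\<lambda>y. y i \<alpha> * F y)) (partial j \<beta> G)
      = (if i = j \<and> \<alpha> = \<beta> then F ?o * partial j \<beta> G ?o else 0)" for j \<beta>
    by (simp add: partial_mult[OF c 0(1)] partial_coord)
  then show ?case
    using sum_delta_pair[OF assms, of "\<lambda>j \<beta>. F ?o * partial j \<beta> G ?o"] by simp
next
  case (Suc d F G)
  have c: "(\<lambda>y. y i \<alpha>) \<in> polys k n" using assms by (rule polys.coord)
  have "fischer k n (Suc d) (partial j \<beta> (\<lambda>y. y i \<alpha> * F y)) (partial j \<beta> G)
      = (if i = j \<and> \<alpha> = \<beta> then fischer k n (Suc d) F (partial j \<beta> G) else 0)
        + real (Suc d) * fischer k n d (partial j \<beta> F) (partial j \<beta> (partial i \<alpha> G))" for j \<beta>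
  proof -
    have "fischer k n (Suc d) (partial j \<beta> (\<lambda>y. y i \<alpha> * F y)) (partial j \<beta> G)
      = fischer k n (Suc d) (\<lambda>y. (if i = j \<and> \<alpha> = \<beta> then 1 else 0) * F y) (partial j \<beta> G)
        + fischer k n (Suc d) (\<lambda>y. y i \<alpha> * partial j \<beta> F y) (partial j \<beta> G)"
      unfolding partial_mult[OF c Suc.prems(1)] partial_coord
      by (rule fischer_add_left) (auto intro!: polys_intros Suc.prems partial_polys c)
    also have "fischer k n (Suc d) (\<lambda>y. y i \<alpha> * partial j \<beta> F y) (partial j \<beta> G)
      = real (Suc d) * fischer k n d (partial j \<beta> F) (partial j \<beta> (partial i \<alpha> G))"
      by (subst Suc.IH)
        (auto intro!: partial_polys Suc.prems simp: partial_commute[OF Suc.prems(2), of i \<alpha>])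
    also have "fischer k n (Suc d) (\<lambda>y. (if i = j \<and> \<alpha> = \<beta> then 1 else 0) * F y) (partial j \<beta> G)
      = (if i = j \<and> \<alpha> = \<beta> then fischer k n (Suc d) F (partial j \<beta> G) else 0)"
      by (subst fischer_cmult_left[OF Suc.prems(1)]) (simp del: fischer.simps)
    finally show ?thesis .
  qed
  then have "fischer k n (Suc (Suc d)) (\<lambda>y. y i \<alpha> * F y) G
      = (\<Sum>j=1..2*k. \<Sum>\<beta>=1..n. (if i = j \<and> \<alpha> = \<beta> then fischer k n (Suc d) F (partial j \<beta> G) else 0))
        + real (Suc d) * fischer k n (Suc d) F (partial i \<alpha> G)"
    by (subst fischer.simps) (simp only: sum.distrib sum_distrib_left fischer.simps(2)[of k n d F])
  also have "\<dots> = real (Suc (Suc d)) * fischer k n (Suc d) F (partial i \<alpha> G)"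
    by (subst sum_delta_pair[OF assms]) (simp add: algebra_simps)
  finally show ?case .
qed


section \<open>Polarization of the rows\<close>

text \<open>The polarization operator \<open>E\<^sub>\<alpha>\<^sub>\<beta>\<close>: the matrix units of \<open>gl\<^sub>n\<close>, acting on
  functions of the matrix with columns \<open>y\<^sub>i\<close>.\<close>

definition row_op :: "nat \<Rightarrow> nat \<Rightarrow> nat \<Rightarrow> (point \<Rightarrow> real) \<Rightarrow> point \<Rightarrow> real" where
  "row_op k \<alpha> \<beta> F y = (\<Sum>i=1..2*k. y i \<alpha> * partial i \<beta> F y)"

lemma row_op_polys: "\<alpha> \<in> {1..n} \<Longrightarrow> F \<in> polys k n \<Longrightarrow> row_op k \<alpha> \<beta> F \<in> polys k n"
  unfolding row_op_def[abs_def] by (intro polys_intros partial_polys) auto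

lemma partial_row_op:
  assumes "j \<in> {1..2*k}" "\<alpha> \<in> {1..n}" "F \<in> polys k n"
  shows "partial j \<gamma> (row_op k \<alpha> \<beta> F) =
    (\<lambda>y. row_op k \<alpha> \<beta> (partial j \<gamma> F) y + (if \<gamma> = \<alpha> then partial j \<beta> F y else 0))"
proof -
  have c: "(\<lambda>y. y i \<alpha>) \<in> polys k n" "partial i \<beta> F \<in> polys k n" if "i \<in> {1..2*k}" for i
    using assms that by (auto intro!: polys.coord partial_polys)
  have "partial j \<gamma> (row_op k \<alpha> \<beta> F)
      = (\<lambda>y. \<Sum>i=1..2*k. partial j \<gamma> (\<lambda>y. y i \<alpha> * partial i \<beta> F y) y)"
    unfolding row_op_def[abs_def] by (rule partial_sum[of _ _ k n]) (auto intro!: polys.mult c)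
  also have "\<dots> = (\<lambda>y. \<Sum>i=1..2*k. (if i = j \<and> \<alpha> = \<gamma> then partial i \<beta> F y else 0)
        + y i \<alpha> * partial i \<beta> (partial j \<gamma> F) y)"
    by (intro ext sum.cong refl)
      (simp add: partial_mult[OF c] partial_coord partial_commute[OF assms(3), of j])
  also have "\<dots> = (\<lambda>y. row_op k \<alpha> \<beta> (partial j \<gamma> F) y + (if \<gamma> = \<alpha> then partial j \<beta> F y else 0))"
    using assms(1) by (cases "\<alpha> = \<gamma>") (auto simp: row_op_def sum.distrib)
  finally show ?thesis .
qed

lemma fischer_row_op:
  assumes "\<alpha> \<in> {1..n}" "F \<in> polys k n" "G \<in> polys k n"
  shows "fischer k n (Suc d) (row_op k \<alpha> \<beta> F) G
    = real (Suc d) * (\<Sum>i=1..2*k. fischer k n d (partial i \<beta> F) (partial i \<alpha> G))"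
proof -
  have "fischer k n (Suc d) (row_op k \<alpha> \<beta> F) G
      = (\<Sum>i=1..2*k. fischer k n (Suc d) (\<lambda>y. y i \<alpha> * partial i \<beta> F y) G)"
    unfolding row_op_def[abs_def] using assms
    by (intro fischer_sum_left polys_intros partial_polys) auto
  also have "\<dots> = (\<Sum>i=1..2*k. real (Suc d) * fischer k n d (partial i \<beta> F) (partial i \<alpha> G))"
    using assms by (intro sum.cong refl fischer_coord_adjoint partial_polys) auto
  finally show ?thesis by (simp add: sum_distrib_left)
qed

lemma fischer_row_op_adjoint:
  assumes "\<alpha> \<in> {1..n}" "\<beta> \<in> {1..n}" "F \<in> polys k n" "G \<in> polys k n"
  shows "fischer k n d (row_op k \<alpha> \<beta> F) G = fischer k n d F (row_op k \<beta> \<alpha> G)"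
proof (cases d)
  case (Suc e)
  then show ?thesis
    using assms fischer_row_op[of \<alpha> n F k G e \<beta>] fischer_row_op[of \<beta> n G k F e \<alpha>]
    by (simp only: fischer_commute[of k n _ F "row_op k \<beta> \<alpha> G"])
      (simp add: fischer_commute[of k n e "partial _ \<alpha> G"])
qed (simp add: row_op_def)

lemma row_op_euler:
  "homogeneous k n d F \<Longrightarrow> (\<Sum>\<alpha>=1..n. row_op k \<alpha> \<alpha> F y) = real d * F y"
  unfolding row_op_def by (subst sum.swap) (rule euler_identity)


section \<open>Functions even in each row\<close>

definition flip_row :: "nat \<Rightarrow> point \<Rightarrow> point" where
  "flip_row \<alpha> y = (\<lambda>i \<gamma>. if \<gamma> = \<alpha> then - y i \<gamma> else y i \<gamma>)"

lemma partial_flip_row: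
  assumes F: "F \<in> polys k n" and s: "\<And>y. F (flip_row \<alpha> y) = s * F y"
  shows "partial i \<gamma> F (flip_row \<alpha> y) = (if \<gamma> = \<alpha> then - s else s) * partial i \<gamma> F y"
proof -
  define e :: real where "e = (if \<gamma> = \<alpha> then -1 else 1)"
  have e: "e * e = 1" by (simp add: e_def)
  let ?u = "\<lambda>y t. y(i := (y i)(\<gamma> := t))"
  have u: "flip_row \<alpha> (?u y t) = ?u (flip_row \<alpha> y) (e * t)" for t
    by (auto simp: flip_row_def e_def fun_eq_iff)
  have "flip_row \<alpha> y i \<gamma> = e * y i \<gamma>" by (auto simp: flip_row_def e_def)
  with polys_has_partial[OF F, of "flip_row \<alpha> y" i \<gamma>]
  have "((\<lambda>t. F (?u (flip_row \<alpha> y) t)) has_field_derivative partial i \<gamma> F (flip_row \<alpha> y))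
      (at (e * y i \<gamma>))" by simp
  moreover have "((\<lambda>t. e * t) has_field_derivative e) (at (y i \<gamma>))"
    by (auto intro!: derivative_eq_intros)
  ultimately have "((\<lambda>t. F (?u (flip_row \<alpha> y) (e * t))) has_field_derivative
      partial i \<gamma> F (flip_row \<alpha> y) * e) (at (y i \<gamma>))"
    by (rule DERIV_chain2)
  moreover have "((\<lambda>t. F (?u (flip_row \<alpha> y) (e * t))) has_field_derivative s * partial i \<gamma> F y)
      (at (y i \<gamma>))"
    unfolding u[symmetric] s by (intro DERIV_cmult polys_has_partial[OF F])
  ultimately have "partial i \<gamma> F (flip_row \<alpha> y) * e = s * partial i \<gamma> F y"
    by (rule DERIV_unique)
  then have "partial i \<gamma> F (flip_row \<alpha> y) * (e * e) = s * e * partial i \<gamma> F y"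
    by (simp add: algebra_simps)
  then show ?thesis by (simp add: e) (simp add: e_def)
qed

text \<open>An odd function has degree at least one in the row, and \<open>row_op k \<alpha> \<alpha>\<close> multiplies by that
  degree. The induction avoids splitting into components.\<close>

lemma odd_row_bound:
  assumes "\<alpha> \<in> {1..n}"
  shows "F \<in> polys k n \<Longrightarrow> (\<And>y. F (flip_row \<alpha> y) = - F y) \<Longrightarrow>
    fischer k n d F F \<le> fischer k n d (row_op k \<alpha> \<alpha> F) F"
proof (induction d arbitrary: F)
  case 0
  have "flip_row \<alpha> (\<lambda>_ _. 0) = (\<lambda>_ _. 0)" by (auto simp: flip_row_def fun_eq_iff)
  with 0(2)[of "\<lambda>_ _. 0"] show ?case by simp
next
  case (Suc d)
  show ?case unfolding fischer.simps
  proof (intro sum_mono)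
    fix i \<beta> assume i: "i \<in> {1..2*k}" and b: "\<beta> \<in> {1..n}"
    let ?D = "partial i \<beta> F"
    have D: "?D \<in> polys k n" by (rule partial_polys[OF Suc.prems(1)])
    have R: "row_op k \<alpha> \<alpha> ?D \<in> polys k n" using assms D by (rule row_op_polys)
    show "fischer k n d ?D ?D \<le> fischer k n d (partial i \<beta> (row_op k \<alpha> \<alpha> F)) ?D"
    proof (cases "\<beta> = \<alpha>")
      case True
      have "0 \<le> fischer k n d (row_op k \<alpha> \<alpha> ?D) ?D"
      proof (cases d)
        case (Suc e)
        show ?thesis unfolding Suc fischer_row_op[OF assms D D]
          by (intro mult_nonneg_nonneg sum_nonneg fischer_nonneg) auto
      qed (simp add: row_op_def)
      then show ?thesis
        using True D R by (simp add: partial_row_op[OF i assms Suc.prems(1)] fischer_add_left)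
    next
      case False
      have "?D (flip_row \<alpha> y) = - ?D y" for y
        using partial_flip_row[OF Suc.prems(1), of \<alpha> "-1" i \<beta> y] Suc.prems(2) False by simp
      from Suc.IH[OF D this] show ?thesis
        using False by (simp add: partial_row_op[OF i assms Suc.prems(1)])
    qed
  qed
qed

text \<open>The derivatives of \<open>F\<close> along the row are odd in the row, so \<open>odd_row_bound\<close> applies
  to them. In terms of the degree in the row: an even nonzero degree is at least two.\<close>

lemma even_row_bound:
  assumes a: "\<alpha> \<in> {1..n}" and F: "F \<in> polys k n" and ev: "\<And>y. F (flip_row \<alpha> y) = F y"
  shows "2 * fischer k n d (row_op k \<alpha> \<alpha> F) F
    \<le> fischer k n d (row_op k \<alpha> \<alpha> F) (row_op k \<alpha> \<alpha> F)"
proof (cases d)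
  case (Suc e)
  have *: "2 * fischer k n e (partial i \<alpha> F) (partial i \<alpha> F)
      \<le> fischer k n e (partial i \<alpha> F) (partial i \<alpha> (row_op k \<alpha> \<alpha> F))" if i: "i \<in> {1..2*k}" for i
  proof -
    let ?D = "partial i \<alpha> F"
    have D: "?D \<in> polys k n" by (rule partial_polys[OF F])
    have R: "row_op k \<alpha> \<alpha> ?D \<in> polys k n" using a D by (rule row_op_polys)
    have "?D (flip_row \<alpha> y) = - ?D y" for y
      using partial_flip_row[OF F, of \<alpha> 1 i \<alpha> y] ev by simp
    from odd_row_bound[OF a D this, of e]
    have "2 * fischer k n e ?D ?D \<le> fischer k n e (partial i \<alpha> (row_op k \<alpha> \<alpha> F)) ?D"
      by (simp add: partial_row_op[OF i a F] fischer_add_left[OF R D])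
    then show ?thesis by (simp only: fischer_commute)
  qed
  have "real (Suc e) * (\<Sum>i=1..2*k. 2 * fischer k n e (partial i \<alpha> F) (partial i \<alpha> F))
     \<le> real (Suc e) * (\<Sum>i=1..2*k. fischer k n e (partial i \<alpha> F) (partial i \<alpha> (row_op k \<alpha> \<alpha> F)))"
    by (intro mult_left_mono sum_mono *) auto
  then show ?thesis
    unfolding Suc fischer_row_op[OF a F F] fischer_row_op[OF a F row_op_polys[OF a F]]
    by (simp add: sum_distrib_left algebra_simps)
qed (simp add: row_op_def)


section \<open>Orthogonal matrices and reflections\<close>

text \<open>This keeps the bounds of sums in the form in which lemmas about them are stated.\<close>

declare One_nat_def [simp del]

lemma sum_rotate3:
  "(\<Sum>a\<in>A. \<Sum>b\<in>B. \<Sum>c\<in>C. f a b c) = (\<Sum>b\<in>B. \<Sum>c\<in>C. \<Sum>a\<in>A. f a b c)"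
  by (subst sum.swap) (intro sum.cong refl sum.swap)

lemma sum_swap_pairs:
  "(\<Sum>a\<in>A. \<Sum>b\<in>B. \<Sum>c\<in>C. \<Sum>d\<in>D. f a b c d) = (\<Sum>c\<in>C. \<Sum>d\<in>D. \<Sum>a\<in>A. \<Sum>b\<in>B. f a b c d)"
  by (simp only: sum_rotate3[of _ B] sum_rotate3[of _ A])

definition gram :: "nat \<Rightarrow> point \<Rightarrow> nat \<Rightarrow> nat \<Rightarrow> real" where
  "gram n y i j = (\<Sum>\<alpha>=1..n. y i \<alpha> * y j \<alpha>)"

lemma gram_commute: "gram n y i j = gram n y j i"
  by (simp add: gram_def mult.commute)

lemma orthogonal_cols:
  "A \<in> orthogonal_group n \<Longrightarrow> \<alpha> \<in> {1..n} \<Longrightarrow> \<beta> \<in> {1..n} \<Longrightarrow>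
     (\<Sum>\<gamma>=1..n. A \<gamma> \<alpha> * A \<gamma> \<beta>) = (if \<alpha> = \<beta> then 1 else 0)"
  by (simp add: orthogonal_group_def)

text \<open>The squared Frobenius norm of \<open>A A\<^sup>T - 1\<close> is \<open>n - 2 n + n\<close>, since cyclic invariance of
  the trace reduces it to \<open>A\<^sup>T A = 1\<close>.\<close>

lemma orthogonal_rows:
  assumes A: "A \<in> orthogonal_group n" and ab: "\<alpha> \<in> {1..n}" "\<beta> \<in> {1..n}"
  shows "(\<Sum>\<gamma>=1..n. A \<alpha> \<gamma> * A \<beta> \<gamma>) = (if \<alpha> = \<beta> then 1 else 0)"
proof -
  define B where "B \<alpha> \<beta> = (\<Sum>\<gamma>=1..n. A \<alpha> \<gamma> * A \<beta> \<gamma>)" for \<alpha> \<beta>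
  define I where "I \<alpha> \<beta> = (if \<alpha> = \<beta> then 1 else 0 :: real)" for \<alpha> \<beta> :: nat
  have tr: "(\<Sum>\<alpha>=1..n. B \<alpha> \<alpha>) = real n"
  proof -
    have "(\<Sum>\<alpha>=1..n. B \<alpha> \<alpha>) = (\<Sum>\<gamma>=1..n. \<Sum>\<alpha>=1..n. A \<alpha> \<gamma> * A \<alpha> \<gamma>)"
      unfolding B_def by (rule sum.swap)
    also have "\<dots> = (\<Sum>\<gamma>=1..n. 1)"
      by (rule sum.cong) (auto simp: orthogonal_cols[OF A])
    finally show ?thesis by simp
  qed
  have sq: "(\<Sum>\<alpha>=1..n. \<Sum>\<beta>=1..n. B \<alpha> \<beta> * B \<alpha> \<beta>) = real n"
  proof -
    have "(\<Sum>\<alpha>=1..n. \<Sum>\<beta>=1..n. B \<alpha> \<beta> * B \<alpha> \<beta>)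
      = (\<Sum>\<alpha>=1..n. \<Sum>\<beta>=1..n. \<Sum>\<gamma>=1..n. \<Sum>\<delta>=1..n. (A \<alpha> \<gamma> * A \<alpha> \<delta>) * (A \<beta> \<gamma> * A \<beta> \<delta>))"
      unfolding B_def by (simp add: sum_product algebra_simps)
    also have "\<dots> = (\<Sum>\<gamma>=1..n. \<Sum>\<delta>=1..n. \<Sum>\<alpha>=1..n. \<Sum>\<beta>=1..n. (A \<alpha> \<gamma> * A \<alpha> \<delta>) * (A \<beta> \<gamma> * A \<beta> \<delta>))"
      by (rule sum_swap_pairs)
    also have "\<dots> = (\<Sum>\<gamma>=1..n. \<Sum>\<delta>=1..n. (\<Sum>\<alpha>=1..n. A \<alpha> \<gamma> * A \<alpha> \<delta>) * (\<Sum>\<beta>=1..n. A \<beta> \<gamma> * A \<beta> \<delta>))"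
      by (simp only: sum_product)
    also have "\<dots> = (\<Sum>\<gamma>=1..n. \<Sum>\<delta>=1..n. if \<gamma> = \<delta> then 1 else 0)"
      by (intro sum.cong refl) (simp add: orthogonal_cols[OF A])
    finally show ?thesis by simp
  qed
  have "(\<Sum>\<alpha>=1..n. \<Sum>\<beta>=1..n. (B \<alpha> \<beta> - I \<alpha> \<beta>)\<^sup>2)
      = (\<Sum>\<alpha>=1..n. \<Sum>\<beta>=1..n. B \<alpha> \<beta> * B \<alpha> \<beta> - (if \<alpha> = \<beta> then 2 * B \<alpha> \<beta> - 1 else 0))"
    by (intro sum.cong refl) (auto simp: I_def power2_eq_square algebra_simps)
  also have "\<dots> = 0"
    by (simp add: sum_subtractf sq tr sum_distrib_left[symmetric])
  finally have "(\<Sum>\<beta>=1..n. (B \<alpha> \<beta> - I \<alpha> \<beta>)\<^sup>2) = 0"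
    using ab(1) by (subst (asm) sum_nonneg_eq_0_iff) (auto intro: sum_nonneg)
  then have "B \<alpha> \<beta> = I \<alpha> \<beta>"
    using ab(2) by (subst (asm) sum_nonneg_eq_0_iff) auto
  then show ?thesis by (simp add: B_def I_def)
qed

lemma act_apply: "\<alpha> \<in> {1..n} \<Longrightarrow> act n A y i \<alpha> = (\<Sum>\<beta>=1..n. A \<alpha> \<beta> * y i \<beta>)"
  by (simp add: act_def)

lemma gram_act:
  assumes A: "A \<in> orthogonal_group n"
  shows "gram n (act n A y) i j = gram n y i j"
proof -
  have "gram n (act n A y) i j
      = (\<Sum>\<alpha>=1..n. \<Sum>\<beta>=1..n. \<Sum>\<gamma>=1..n. (A \<alpha> \<beta> * A \<alpha> \<gamma>) * (y i \<beta> * y j \<gamma>))"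
    unfolding gram_def by (intro sum.cong refl) (simp add: act_apply sum_product algebra_simps)
  also have "\<dots> = (\<Sum>\<beta>=1..n. \<Sum>\<gamma>=1..n. \<Sum>\<alpha>=1..n. (A \<alpha> \<beta> * A \<alpha> \<gamma>) * (y i \<beta> * y j \<gamma>))"
    by (rule sum_rotate3)
  also have "\<dots> = (\<Sum>\<beta>=1..n. \<Sum>\<gamma>=1..n. if \<beta> = \<gamma> then y i \<beta> * y j \<gamma> else 0)"
    by (intro sum.cong refl) (simp add: sum_distrib_right[symmetric] orthogonal_cols[OF A])
  finally show ?thesis by (simp add: gram_def)
qed

text \<open>The Householder reflection in the hyperplane orthogonal to \<open>c\<close>. Since \<open>2 / 0 = 0\<close>, it is
  the identity for \<open>c = 0\<close>.\<close>

definition reflection :: "nat \<Rightarrow> (nat \<Rightarrow> real) \<Rightarrow> nat \<Rightarrow> nat \<Rightarrow> real" where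
  "reflection n c \<alpha> \<beta> = (if \<alpha> = \<beta> then 1 else 0) - 2 / (\<Sum>\<gamma>=1..n. c \<gamma> * c \<gamma>) * c \<alpha> * c \<beta>"

lemma reflection_orthogonal: "reflection n c \<in> orthogonal_group n"
  unfolding orthogonal_group_def
proof (intro CollectI ballI)
  fix \<alpha> \<beta> assume ab: "\<alpha> \<in> {1..n}" "\<beta> \<in> {1..n}"
  define q where "q = (\<Sum>\<gamma>=1..n. c \<gamma> * c \<gamma>)"
  define s where "s = 2 / q"
  have R: "reflection n c \<gamma> \<delta> = (if \<gamma> = \<delta> then 1 else 0) - s * c \<gamma> * c \<delta>" for \<gamma> \<delta>
    by (simp add: reflection_def s_def q_def)
  have "(\<Sum>\<gamma>=1..n. reflection n c \<gamma> \<alpha> * reflection n c \<gamma> \<beta>)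
      = (\<Sum>\<gamma>=1..n. (if \<gamma> = \<alpha> then if \<alpha> = \<beta> then 1 else 0 else 0)
          - s * c \<alpha> * (if \<gamma> = \<beta> then c \<gamma> else 0) - s * c \<beta> * (if \<gamma> = \<alpha> then c \<gamma> else 0)
          + s * s * c \<alpha> * c \<beta> * (c \<gamma> * c \<gamma>))"
    by (rule sum.cong) (auto simp: R algebra_simps)
  also have "\<dots> = (if \<alpha> = \<beta> then 1 else 0) - 2 * s * c \<alpha> * c \<beta> + s * s * c \<alpha> * c \<beta> * q"
    using ab by (simp add: sum.distrib sum_subtractf sum_distrib_left[symmetric] q_def)
  also have "s * s * c \<alpha> * c \<beta> * q = (s * q) * s * c \<alpha> * c \<beta>" by simp
  also have "\<dots> = 2 * s * c \<alpha> * c \<beta>" by (cases "q = 0") (simp_all add: s_def)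
  finally show "(\<Sum>\<gamma>=1..n. reflection n c \<gamma> \<alpha> * reflection n c \<gamma> \<beta>) = (if \<alpha> = \<beta> then 1 else 0)"
    by simp
qed

lemma act_reflection:
  assumes "\<alpha> \<in> {1..n}"
  shows "act n (reflection n c) y i \<alpha>
    = y i \<alpha> - 2 * (\<Sum>\<beta>=1..n. c \<beta> * y i \<beta>) / (\<Sum>\<gamma>=1..n. c \<gamma> * c \<gamma>) * c \<alpha>"
proof -
  define s where "s = 2 / (\<Sum>\<gamma>=1..n. c \<gamma> * c \<gamma>)"
  have R: "reflection n c \<gamma> \<delta> = (if \<gamma> = \<delta> then 1 else 0) - s * c \<gamma> * c \<delta>" for \<gamma> \<delta>
    by (simp add: reflection_def s_def)
  have "act n (reflection n c) y i \<alpha>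
      = (\<Sum>\<beta>=1..n. (if \<beta> = \<alpha> then y i \<beta> else 0) - s * c \<alpha> * (c \<beta> * y i \<beta>))"
    unfolding act_apply[OF assms]
    by (rule sum.cong) (auto simp: R algebra_simps)
  also have "\<dots> = y i \<alpha> - s * c \<alpha> * (\<Sum>\<beta>=1..n. c \<beta> * y i \<beta>)"
    using assms by (simp add: sum_subtractf sum_distrib_left[symmetric])
  finally show ?thesis by (simp add: s_def)
qed


section \<open>Derivatives of invariant polynomials\<close>

lemma invariant_imp_polys: "F \<in> invariant_polys k n \<Longrightarrow> F \<in> polys k n"
  by (simp add: invariant_polys_def)

lemma invariantI:
  "F \<in> polys k n \<Longrightarrow> (\<And>A y. A \<in> orthogonal_group n \<Longrightarrow> F (act n A y) = F y) \<Longrightarrow>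
    F \<in> invariant_polys k n"
  by (simp add: invariant_polys_def)

text \<open>A polynomial only sees the coordinates of the phase space, so invariance there extends to all
  points of the ambient type.\<close>

lemma invariant_act:
  assumes F: "F \<in> invariant_polys k n" and A: "A \<in> orthogonal_group n"
  shows "F (act n A y) = F y"
proof -
  have P: "F \<in> polys k n" using F by (rule invariant_imp_polys)
  define z where "z i \<alpha> = (if i \<in> {1..2*k} \<and> \<alpha> \<in> {1..n} then y i \<alpha> else 0)" for i \<alpha>
  have "z \<in> phase_space k n" by (auto simp: z_def phase_space_def)
  then have "F (act n A z) = F z" using F A by (simp add: invariant_polys_def)
  moreover have "F z = F y" by (rule polys_cong[OF P]) (simp add: z_def)
  moreover have "F (act n A z) = F (act n A y)"
    by (rule polys_cong[OF P]) (simp add: act_def z_def)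
  ultimately show ?thesis by simp
qed

lemma invariant_flip_row:
  assumes F: "F \<in> invariant_polys k n" and a: "\<alpha> \<in> {1..n}"
  shows "F (flip_row \<alpha> y) = F y"
proof -
  let ?c = "\<lambda>\<gamma>. if \<gamma> = \<alpha> then 1 else 0 :: real"
  have s: "(\<Sum>\<beta>=1..n. ?c \<beta> * x \<beta>) = x \<alpha>" for x :: "nat \<Rightarrow> real"
  proof -
    have "(\<Sum>\<beta>=1..n. ?c \<beta> * x \<beta>) = (\<Sum>\<beta>=1..n. if \<beta> = \<alpha> then x \<beta> else 0)"
      by (rule sum.cong) auto
    then show ?thesis using a by simp
  qed
  have "F (flip_row \<alpha> y) = F (act n (reflection n ?c) y)"
    by (rule polys_cong[OF invariant_imp_polys[OF F]])
      (simp only: act_reflection s, simp add: flip_row_def)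
  then show ?thesis using invariant_act[OF F reflection_orthogonal] by simp
qed

text \<open>Invariance under rotations, infinitesimally. Differentiating along reflections whose axis
  turns from \<open>e\<^sub>\<alpha>\<close> towards \<open>e\<^sub>\<beta>\<close> gives the same identity and keeps reflections as the only
  explicit group elements.\<close>

lemma invariant_row_op_symmetric:
  assumes F: "F \<in> invariant_polys k n" and a: "\<alpha> \<in> {1..n}" and b: "\<beta> \<in> {1..n}"
  shows "row_op k \<alpha> \<beta> F = row_op k \<beta> \<alpha> F"
proof (cases "\<alpha> = \<beta>")
  case ne: False
  show ?thesis
  proof
    fix y
    have P: "F \<in> polys k n" using F by (rule invariant_imp_polys)
    define c where "c t \<gamma> = (if \<gamma> = \<alpha> then 1 else if \<gamma> = \<beta> then t else 0 :: real)" for t \<gamma>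
    have s: "(\<Sum>\<gamma>=1..n. c t \<gamma> * x \<gamma>) = x \<alpha> + t * x \<beta>" for t and x :: "nat \<Rightarrow> real"
    proof -
      have "(\<Sum>\<gamma>=1..n. c t \<gamma> * x \<gamma>)
        = (\<Sum>\<gamma>=1..n. (if \<gamma> = \<alpha> then x \<gamma> else 0) + t * (if \<gamma> = \<beta> then x \<gamma> else 0))"
        using ne by (intro sum.cong) (auto simp: c_def)
      then show ?thesis using a b by (simp add: sum.distrib sum_distrib_left[symmetric])
    qed
    define w where "w t = act n (reflection n (c t)) y" for t
    define w' where "w' i \<gamma> = (if \<gamma> = \<alpha> then - 2 * y i \<beta> else if \<gamma> = \<beta> then - 2 * y i \<alpha> else 0)"
      for i \<gamma>
    have w: "w t i \<gamma> = y i \<gamma> - 2 * (y i \<alpha> + t * y i \<beta>) / (1 + t * t) * c t \<gamma>" if "\<gamma> \<in> {1..n}" for t i \<gamma>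
      unfolding w_def act_reflection[OF that] s using ne by (simp add: c_def)
    have "w 0 i \<gamma> = flip_row \<alpha> y i \<gamma>" if "\<gamma> \<in> {1..n}" for i \<gamma>
      unfolding w[OF that] using ne by (auto simp: c_def flip_row_def)
    then have w0: "partial i \<gamma> F (w 0) = partial i \<gamma> F (flip_row \<alpha> y)" for i \<gamma>
      by (intro polys_cong[OF partial_polys[OF P]])
    have "((\<lambda>t. F (w t)) has_field_derivative
        (\<Sum>i=1..2*k. \<Sum>\<gamma>=1..n. partial i \<gamma> F (w 0) * w' i \<gamma>)) (at 0)"
    proof (rule polys_chain_rule[OF P])
      fix i \<gamma> assume "i \<in> {1..2*k}" and g: "\<gamma> \<in> {1..n}"
      show "((\<lambda>t. w t i \<gamma>) has_field_derivative w' i \<gamma>) (at 0)"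
        unfolding w[OF g] c_def w'_def using ne
        by (cases "\<gamma> = \<alpha>"; cases "\<gamma> = \<beta>") (auto intro!: derivative_eq_intros)
    qed
    moreover have "(\<lambda>t. F (w t)) = (\<lambda>t. F y)"
      unfolding w_def using invariant_act[OF F reflection_orthogonal] by blast
    ultimately have "(\<Sum>i=1..2*k. \<Sum>\<gamma>=1..n. partial i \<gamma> F (w 0) * w' i \<gamma>) = 0"
      using DERIV_unique[OF _ DERIV_const] by simp
    moreover have "(\<Sum>\<gamma>=1..n. partial i \<gamma> F (w 0) * w' i \<gamma>)
        = 2 * (y i \<beta> * partial i \<alpha> F y) - 2 * (y i \<alpha> * partial i \<beta> F y)" for i
    proof -
      have "partial i \<gamma> F (w 0) * w' i \<gamma> = (if \<gamma> = \<alpha> then 2 * (y i \<beta> * partial i \<gamma> F y) else 0)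
          - (if \<gamma> = \<beta> then 2 * (y i \<alpha> * partial i \<gamma> F y) else 0)" for \<gamma>
        using partial_flip_row[OF P, of \<alpha> 1 i \<gamma> y] invariant_flip_row[OF F a] ne
        by (auto simp: w0 w'_def)
      then show ?thesis using a b by (simp add: sum_subtractf)
    qed
    ultimately show "row_op k \<alpha> \<beta> F y = row_op k \<beta> \<alpha> F y"
      by (simp add: row_op_def sum_subtractf sum_distrib_left[symmetric])
  qed
qed simp

text \<open>The constant coefficient operator \<open>\<langle>\<partial>\<^sub>i, \<partial>\<^sub>j\<rangle>\<close>, dual to multiplication by the
  inner product \<open>\<langle>y\<^sub>i, y\<^sub>j\<rangle>\<close>.\<close>

definition contraction :: "nat \<Rightarrow> nat \<Rightarrow> nat \<Rightarrow> (point \<Rightarrow> real) \<Rightarrow> point \<Rightarrow> real" where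
  "contraction n i j F y = (\<Sum>\<alpha>=1..n. partial i \<alpha> (partial j \<alpha> F) y)"

lemma polys_act: "F \<in> polys k n \<Longrightarrow> (\<lambda>y. F (act n A y)) \<in> polys k n"
proof (induction rule: polys.induct)
  case (coord i \<alpha>)
  then show ?case by (simp add: act_apply) (auto intro!: polys_intros)
qed (auto intro: polys.intros)

lemma partial_act:
  assumes F: "F \<in> polys k n" and i: "i \<in> {1..2*k}" and a: "\<alpha> \<in> {1..n}"
  shows "partial i \<alpha> (\<lambda>y. F (act n A y)) = (\<lambda>y. \<Sum>\<beta>=1..n. A \<beta> \<alpha> * partial i \<beta> F (act n A y))"
proof (rule ext, rule partial_eqI)
  fix y
  let ?c = "\<lambda>t. act n A (y(i := (y i)(\<alpha> := t)))"
  have "((\<lambda>t. F (?c t)) has_field_derivative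
      (\<Sum>j=1..2*k. \<Sum>\<beta>=1..n. partial j \<beta> F (?c (y i \<alpha>)) * (if j = i then A \<beta> \<alpha> else 0))) (at (y i \<alpha>))"
  proof (rule polys_chain_rule[OF F])
    fix j \<beta> assume b: "\<beta> \<in> {1..n}"
    have "?c t j \<beta> = (\<Sum>\<gamma>=1..n. A \<beta> \<gamma> * y j \<gamma>) + (if j = i then A \<beta> \<alpha> * (t - y i \<alpha>) else 0)" for t
    proof -
      have "?c t j \<beta> = (\<Sum>\<gamma>=1..n. A \<beta> \<gamma> * y j \<gamma>
          + (if \<gamma> = \<alpha> then if j = i then A \<beta> \<gamma> * (t - y i \<alpha>) else 0 else 0))"
        unfolding act_apply[OF b] by (rule sum.cong) (auto simp: algebra_simps)
      then show ?thesis using a by (simp add: sum.distrib)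
    qed
    then show "((\<lambda>t. ?c t j \<beta>) has_field_derivative (if j = i then A \<beta> \<alpha> else 0)) (at (y i \<alpha>))"
      by (auto intro!: derivative_eq_intros)
  qed
  moreover have "(\<Sum>j=1..2*k. \<Sum>\<beta>=1..n. partial j \<beta> F (?c (y i \<alpha>)) * (if j = i then A \<beta> \<alpha> else 0))
      = (\<Sum>j=1..2*k. if j = i then \<Sum>\<beta>=1..n. A \<beta> \<alpha> * partial i \<beta> F (act n A y) else 0)"
    by (rule sum.cong) (auto simp: mult.commute)
  ultimately show "((\<lambda>t. F (?c t)) has_field_derivative
      (\<Sum>\<beta>=1..n. A \<beta> \<alpha> * partial i \<beta> F (act n A y))) (at (y i \<alpha>))"
    using i by simp
qed

lemma contraction_polys: "F \<in> polys k n \<Longrightarrow> contraction n i j F \<in> polys k n"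
  unfolding contraction_def[abs_def] by (intro polys_sum partial_polys)

text \<open>Gradients of an invariant are rotated by \<open>A\<close>, and the two copies of \<open>A\<close> cancel because its
  rows are orthonormal.\<close>

lemma contraction_invariant:
  assumes F: "F \<in> invariant_polys k n" and ij: "i \<in> {1..2*k}" "j \<in> {1..2*k}"
  shows "contraction n i j F \<in> invariant_polys k n"
proof (rule invariantI)
  have P: "F \<in> polys k n" using F by (rule invariant_imp_polys)
  show "contraction n i j F \<in> polys k n" using P by (rule contraction_polys)
  fix A y assume A: "A \<in> orthogonal_group n"
  have P': "(\<lambda>y. partial j \<beta> F (act n A y)) \<in> polys k n" for \<beta>
    by (intro polys_act partial_polys P)
  have FA: "(\<lambda>y. F (act n A y)) = F" using invariant_act[OF F A] by blast
  have "partial i \<alpha> (partial j \<alpha> F) y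
      = (\<Sum>\<beta>=1..n. \<Sum>\<gamma>=1..n. (A \<beta> \<alpha> * A \<gamma> \<alpha>) * partial i \<gamma> (partial j \<beta> F) (act n A y))"
    if a: "\<alpha> \<in> {1..n}" for \<alpha>
  proof -
    have "partial i \<alpha> (partial j \<alpha> F)
        = partial i \<alpha> (\<lambda>y. \<Sum>\<beta>=1..n. A \<beta> \<alpha> * partial j \<beta> F (act n A y))"
      using partial_act[OF P ij(2) a, of A] by (simp only: FA)
    also have "\<dots> = (\<lambda>y. \<Sum>\<beta>=1..n. A \<beta> \<alpha> * partial i \<alpha> (\<lambda>y. partial j \<beta> F (act n A y)) y)"
      by (subst partial_sum[of _ _ k n]) (auto intro!: polys_intros P' simp: partial_cmult[OF P'])
    finally show ?thesis
      by (simp add: partial_act[OF partial_polys[OF P] ij(1) a] sum_distrib_left algebra_simps)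
  qed
  then have "contraction n i j F y = (\<Sum>\<alpha>=1..n. \<Sum>\<beta>=1..n. \<Sum>\<gamma>=1..n.
      (A \<beta> \<alpha> * A \<gamma> \<alpha>) * partial i \<gamma> (partial j \<beta> F) (act n A y))"
    by (simp add: contraction_def)
  also have "\<dots> = (\<Sum>\<beta>=1..n. \<Sum>\<gamma>=1..n. \<Sum>\<alpha>=1..n.
      (A \<beta> \<alpha> * A \<gamma> \<alpha>) * partial i \<gamma> (partial j \<beta> F) (act n A y))"
    by (rule sum_rotate3)
  also have "\<dots> = (\<Sum>\<beta>=1..n. \<Sum>\<gamma>=1..n. if \<beta> = \<gamma> then partial i \<gamma> (partial j \<beta> F) (act n A y) else 0)"
    by (intro sum.cong refl) (simp add: sum_distrib_right[symmetric] orthogonal_rows[OF A])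
  also have "\<dots> = contraction n i j F (act n A y)"
    by (simp add: contraction_def)
  finally show "contraction n i j F (act n A y) = contraction n i j F y" by simp
qed


section \<open>The first fundamental theorem for the orthogonal group\<close>

lemma fischer_add_right:
  "F \<in> polys k n \<Longrightarrow> G \<in> polys k n \<Longrightarrow>
     fischer k n d H (\<lambda>y. F y + G y) = fischer k n d H F + fischer k n d H G"
  by (simp add: fischer_commute[of k n d H] fischer_add_left)

lemma fischer_diff_right:
  "F \<in> polys k n \<Longrightarrow> G \<in> polys k n \<Longrightarrow>
     fischer k n d H (\<lambda>y. F y - G y) = fischer k n d H F - fischer k n d H G"
  by (simp add: fischer_commute[of k n d H] fischer_diff_left)

lemma fischer_cmult_right:
  "F \<in> polys k n \<Longrightarrow> fischer k n d H (\<lambda>y. c * F y) = c * fischer k n d H F"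
  by (simp add: fischer_commute[of k n d H] fischer_cmult_left)

lemma fischer_sum_right:
  "(\<And>s. s \<in> S \<Longrightarrow> F s \<in> polys k n) \<Longrightarrow>
     fischer k n d H (\<lambda>y. \<Sum>s\<in>S. F s y) = (\<Sum>s\<in>S. fischer k n d H (F s))"
  by (simp add: fischer_commute[of k n d H] fischer_sum_left)

text \<open>Invariance replaces \<open>E\<^sub>\<beta>\<^sub>\<alpha> F\<close> by \<open>E\<^sub>\<alpha>\<^sub>\<beta> F\<close>. Moving all derivatives in
  \<open>E\<^sub>\<alpha>\<^sub>\<beta> E\<^sub>\<alpha>\<^sub>\<beta>\<close> to the right gives the products of inner products and contractions;
  the commutators survive for \<open>\<alpha> = \<beta>\<close> only and add up to the Euler operator.\<close>

lemma invariant_gram_contraction: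
  assumes F: "F \<in> invariant_polys k n" and d: "homogeneous k n d F"
  shows "(\<Sum>i=1..2*k. \<Sum>j=1..2*k. gram n y i j * contraction n i j F y)
    = (\<Sum>\<alpha>=1..n. \<Sum>\<beta>=1..n. row_op k \<alpha> \<beta> (row_op k \<beta> \<alpha> F) y) - real d * F y"
proof -
  have P: "F \<in> polys k n" using F by (rule invariant_imp_polys)
  have "row_op k \<alpha> \<beta> (row_op k \<beta> \<alpha> F) y
      = (\<Sum>i=1..2*k. \<Sum>j=1..2*k. y i \<alpha> * y j \<alpha> * partial i \<beta> (partial j \<beta> F) y)
        + (if \<beta> = \<alpha> then row_op k \<alpha> \<alpha> F y else 0)"
    if a: "\<alpha> \<in> {1..n}" and b: "\<beta> \<in> {1..n}" for \<alpha> \<beta>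
  proof -
    have "row_op k \<alpha> \<beta> (row_op k \<beta> \<alpha> F) y = row_op k \<alpha> \<beta> (row_op k \<alpha> \<beta> F) y"
      by (simp only: invariant_row_op_symmetric[OF F a b])
    also have "\<dots> = (\<Sum>i=1..2*k. y i \<alpha> * (row_op k \<alpha> \<beta> (partial i \<beta> F) y
        + (if \<beta> = \<alpha> then partial i \<beta> F y else 0)))"
      unfolding row_op_def[of k \<alpha> \<beta> "row_op k \<alpha> \<beta> F"]
      by (intro sum.cong refl) (simp only: partial_row_op[OF _ a P])
    also have "\<dots> = (\<Sum>i=1..2*k. \<Sum>j=1..2*k. y i \<alpha> * y j \<alpha> * partial i \<beta> (partial j \<beta> F) y)
        + (if \<beta> = \<alpha> then row_op k \<alpha> \<alpha> F y else 0)"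
      by (auto simp: row_op_def distrib_left sum.distrib sum_distrib_left mult.assoc
          partial_commute[OF P] intro!: sum.cong)
    finally show ?thesis .
  qed
  then have "(\<Sum>\<alpha>=1..n. \<Sum>\<beta>=1..n. row_op k \<alpha> \<beta> (row_op k \<beta> \<alpha> F) y)
      = (\<Sum>\<alpha>=1..n. \<Sum>\<beta>=1..n. \<Sum>i=1..2*k. \<Sum>j=1..2*k.
           y i \<alpha> * y j \<alpha> * partial i \<beta> (partial j \<beta> F) y) + real d * F y"
    using row_op_euler[OF d, of y] by (simp add: sum.distrib)
  also have "(\<Sum>\<alpha>=1..n. \<Sum>\<beta>=1..n. \<Sum>i=1..2*k. \<Sum>j=1..2*k.
           y i \<alpha> * y j \<alpha> * partial i \<beta> (partial j \<beta> F) y)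
      = (\<Sum>i=1..2*k. \<Sum>j=1..2*k. \<Sum>\<alpha>=1..n. \<Sum>\<beta>=1..n.
           y i \<alpha> * y j \<alpha> * partial i \<beta> (partial j \<beta> F) y)"
    by (rule sum_swap_pairs)
  also have "\<dots> = (\<Sum>i=1..2*k. \<Sum>j=1..2*k. gram n y i j * contraction n i j F y)"
    by (simp add: gram_def contraction_def sum_product)
  finally show ?thesis by simp
qed

lemma gram_entry_polys: "i \<in> {1..2*k} \<Longrightarrow> j \<in> {1..2*k} \<Longrightarrow> (\<lambda>y. gram n y i j) \<in> polys k n"
  unfolding gram_def by (intro polys_intros) auto

text \<open>The operators \<open>E\<^sub>\<alpha>\<^sub>\<beta>\<close> and \<open>E\<^sub>\<beta>\<^sub>\<alpha>\<close> are adjoint, so the sum in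
  \<open>invariant_gram_contraction\<close> is a sum of squares. Its diagonal terms dominate twice the
  degree, as \<open>F\<close> is even in each row, and the degree is subtracted once.\<close>

lemma gram_contraction_bound:
  assumes F: "F \<in> invariant_polys k n" and d: "homogeneous k n d F"
  shows "real d * fischer k n d F F
    \<le> fischer k n d (\<lambda>y. \<Sum>i=1..2*k. \<Sum>j=1..2*k. gram n y i j * contraction n i j F y) F"
proof -
  have P: "F \<in> polys k n" using F by (rule invariant_imp_polys)
  have R: "row_op k \<alpha> \<beta> F \<in> polys k n" "row_op k \<beta> \<alpha> (row_op k \<alpha> \<beta> F) \<in> polys k n"
    if "\<alpha> \<in> {1..n}" "\<beta> \<in> {1..n}" for \<alpha> \<beta>
    using that P by (auto intro!: row_op_polys)
  have "fischer k n d (\<lambda>y. \<Sum>\<alpha>=1..n. \<Sum>\<beta>=1..n. row_op k \<alpha> \<beta> (row_op k \<beta> \<alpha> F) y) F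
      = (\<Sum>\<alpha>=1..n. \<Sum>\<beta>=1..n. fischer k n d (row_op k \<alpha> \<beta> (row_op k \<beta> \<alpha> F)) F)"
    by (subst fischer_sum_left)
      (auto intro!: sum.cong fischer_sum_left polys_sum simp del: atLeastAtMost_iff intro: R)
  also have "\<dots> = (\<Sum>\<alpha>=1..n. \<Sum>\<beta>=1..n. fischer k n d (row_op k \<beta> \<alpha> F) (row_op k \<beta> \<alpha> F))"
    by (intro sum.cong refl fischer_row_op_adjoint R P)
  also have "\<dots> \<ge> (\<Sum>\<alpha>=1..n. fischer k n d (row_op k \<alpha> \<alpha> F) (row_op k \<alpha> \<alpha> F))"
    by (intro sum_mono member_le_sum[where f = "\<lambda>\<beta>. fischer k n d (row_op k \<beta> _ F) (row_op k \<beta> _ F)"])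
      (auto intro: fischer_nonneg)
  also have "(\<Sum>\<alpha>=1..n. fischer k n d (row_op k \<alpha> \<alpha> F) (row_op k \<alpha> \<alpha> F))
      \<ge> (\<Sum>\<alpha>=1..n. 2 * fischer k n d (row_op k \<alpha> \<alpha> F) F)"
    by (intro sum_mono even_row_bound P invariant_flip_row[OF F])
  also have "(\<Sum>\<alpha>=1..n. 2 * fischer k n d (row_op k \<alpha> \<alpha> F) F)
      = 2 * fischer k n d (\<lambda>y. \<Sum>\<alpha>=1..n. row_op k \<alpha> \<alpha> F y) F"
    by (subst fischer_sum_left) (auto simp: sum_distrib_left simp del: atLeastAtMost_iff intro: R)
  also have "\<dots> = 2 * real d * fischer k n d F F"
    by (simp add: row_op_euler[OF d] fischer_cmult_left[OF P])
  finally have "2 * real d * fischer k n d F F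
      \<le> fischer k n d (\<lambda>y. \<Sum>\<alpha>=1..n. \<Sum>\<beta>=1..n. row_op k \<alpha> \<beta> (row_op k \<beta> \<alpha> F) y) F" .
  moreover have "fischer k n d
        (\<lambda>y. (\<Sum>\<alpha>=1..n. \<Sum>\<beta>=1..n. row_op k \<alpha> \<beta> (row_op k \<beta> \<alpha> F) y) - real d * F y) F
      = fischer k n d (\<lambda>y. \<Sum>\<alpha>=1..n. \<Sum>\<beta>=1..n. row_op k \<alpha> \<beta> (row_op k \<beta> \<alpha> F) y) F
        - real d * fischer k n d F F"
    by (subst fischer_diff_left)
      (auto intro!: polys_intros P R simp: fischer_cmult_left[OF P] simp del: atLeastAtMost_iff)
  ultimately show ?thesis
    by (simp add: invariant_gram_contraction[OF F d])
qed

text \<open>The degenerate case of the Cauchy-Schwarz inequality.\<close>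

lemma fischer_null:
  assumes F: "F \<in> polys k n" and G: "G \<in> polys k n" and 0: "fischer k n d G G = 0"
  shows "fischer k n d F G = 0"
proof (rule ccontr)
  assume ne: "fischer k n d F G \<noteq> 0"
  \<comment> \<open>chosen such that \<open>F - s G\<close> has square \<open>-1\<close>\<close>
  define s where "s = (fischer k n d F F + 1) / (2 * fischer k n d F G)"
  have sG: "(\<lambda>y. s * G y) \<in> polys k n" using G by (intro polys_intros)
  have "0 \<le> fischer k n d (\<lambda>y. F y - s * G y) (\<lambda>y. F y - s * G y)" by (rule fischer_nonneg)
  also have "\<dots> = fischer k n d F F - 2 * s * fischer k n d F G"
    using F G sG 0 fischer_commute[of k n d G F]
    by (simp add: fischer_diff_left fischer_diff_right fischer_cmult_left fischer_cmult_right polys_diff)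
  also have "\<dots> = -1" using ne by (simp add: s_def field_simps)
  finally show False by simp
qed

text \<open>Orthogonal projection to the span of a finite family by the Gram-Schmidt process. If the new
  direction \<open>X\<close> is null, the quotient \<open>t\<close> is zero and \<open>fischer_null\<close> gives orthogonality.\<close>

lemma fischer_projection:
  assumes "finite S"
  shows "(\<And>s. s \<in> S \<Longrightarrow> m s \<in> polys k n) \<Longrightarrow> F \<in> polys k n \<Longrightarrow>
    \<exists>c. \<forall>s\<in>S. fischer k n d (\<lambda>y. F y - (\<Sum>s\<in>S. c s * m s y)) (m s) = 0"
  using assms
proof (induction S arbitrary: F rule: finite_induct)
  case (insert x S)
  have mx: "m x \<in> polys k n" and mS: "\<And>s. s \<in> S \<Longrightarrow> m s \<in> polys k n" using insert.prems by auto
  obtain a where a: "\<forall>s\<in>S. fischer k n d (\<lambda>y. F y - (\<Sum>s\<in>S. a s * m s y)) (m s) = 0"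
    using insert.IH[OF mS insert.prems(2)] by auto
  obtain b where b: "\<forall>s\<in>S. fischer k n d (\<lambda>y. m x y - (\<Sum>s\<in>S. b s * m s y)) (m s) = 0"
    using insert.IH[OF mS mx] by auto
  define F1 where "F1 y = F y - (\<Sum>s\<in>S. a s * m s y)" for y
  define B where "B y = (\<Sum>s\<in>S. b s * m s y)" for y
  define X where "X y = m x y - B y" for y
  have P: "F1 \<in> polys k n" "X \<in> polys k n" "B \<in> polys k n"
    using insert.prems mx mS by (auto simp: F1_def[abs_def] X_def[abs_def] B_def[abs_def] intro!: polys_intros)
  define t where "t = fischer k n d F1 X / fischer k n d X X"
  have t: "fischer k n d F1 X = t * fischer k n d X X"
    using fischer_null[OF P(1,2), of d] by (auto simp: t_def)
  define c where "c s = (if s = x then t else a s - t * b s)" for s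
  have "(\<Sum>s\<in>insert x S. c s * m s y) = t * m x y + (\<Sum>s\<in>S. (a s - t * b s) * m s y)" for y
    using insert.hyps by (auto simp: c_def intro!: sum.cong)
  then have eq: "(\<lambda>y. F y - (\<Sum>s\<in>insert x S. c s * m s y)) = (\<lambda>y. F1 y - t * X y)"
    by (simp only: F1_def X_def B_def) (simp add: algebra_simps sum_subtractf sum_distrib_left)
  have tX: "(\<lambda>y. t * X y) \<in> polys k n" using P by (intro polys_intros)
  have S: "fischer k n d (\<lambda>y. F1 y - t * X y) (m s) = 0" if "s \<in> S" for s
  proof -
    have "fischer k n d F1 (m s) = 0" "fischer k n d X (m s) = 0"
      using a b that by (simp_all add: F1_def[abs_def] X_def[abs_def] B_def)
    then show ?thesis by (simp add: fischer_diff_left[OF P(1) tX] fischer_cmult_left[OF P(2)])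
  qed
  have "fischer k n d (\<lambda>y. F1 y - t * X y) B = 0"
    unfolding B_def[abs_def] using mS
    by (subst fischer_sum_right) (auto intro!: polys_intros sum.neutral simp: fischer_cmult_right S)
  moreover have "fischer k n d (\<lambda>y. F1 y - t * X y) X = 0"
    by (simp add: fischer_diff_left[OF P(1) tX] fischer_cmult_left[OF P(2)] t)
  ultimately have "fischer k n d (\<lambda>y. F1 y - t * X y) (m x) = 0"
    using fischer_add_right[OF P(2,3), of d "\<lambda>y. F1 y - t * X y"] by (simp add: X_def)
  with S show ?case by (auto simp: eq intro!: exI[of _ c])
qed simp

definition gram_monomial :: "(nat \<times> nat) list \<Rightarrow> (nat \<Rightarrow> nat \<Rightarrow> real) \<Rightarrow> real" where
  "gram_monomial ps g = (\<Prod>(i, j)\<leftarrow>ps. g i j)"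

definition pair_lists :: "nat \<Rightarrow> nat \<Rightarrow> (nat \<times> nat) list set" where
  "pair_lists k d = {ps. set ps \<subseteq> {1..2*k} \<times> {1..2*k} \<and> 2 * length ps = d}"

lemma gram_monomial_Cons [simp]: "gram_monomial ((i, j) # ps) g = g i j * gram_monomial ps g"
  by (simp add: gram_monomial_def)

lemma gram_monomial_Nil [simp]: "gram_monomial [] g = 1"
  by (simp add: gram_monomial_def)

lemma finite_pair_lists: "finite (pair_lists k d)"
  by (rule finite_subset[OF _ finite_lists_length_le[of "{1..2*k} \<times> {1..2*k}" d]])
    (auto simp: pair_lists_def)

lemma gram_homogeneous:
  "i \<in> {1..2*k} \<Longrightarrow> j \<in> {1..2*k} \<Longrightarrow> homogeneous k n 2 (\<lambda>y. gram n y i j)"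
  unfolding gram_def
  using homogeneous.mult[OF homogeneous.coord homogeneous.coord, of i k _ n j]
  by (intro homogeneous_sum) simp

lemma gram_monomial_homogeneous:
  "ps \<in> pair_lists k d \<Longrightarrow> homogeneous k n d (\<lambda>y. gram_monomial ps (gram n y))"
proof (induction ps arbitrary: d)
  case Nil
  then show ?case by (simp add: pair_lists_def homogeneous.const)
next
  case (Cons p ps)
  obtain i j where p: "p = (i, j)" by fastforce
  have "homogeneous k n (d - 2) (\<lambda>y. gram_monomial ps (gram n y))"
    using Cons by (auto simp: pair_lists_def)
  from homogeneous.mult[OF gram_homogeneous this, of i j] show ?case
    using Cons.prems by (auto simp: pair_lists_def p)
qed

lemma gram_monomial_invariant:
  assumes "ps \<in> pair_lists k d"
  shows "(\<lambda>y. gram_monomial ps (gram n y)) \<in> invariant_polys k n"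
proof (rule invariantI)
  show "(\<lambda>y. gram_monomial ps (gram n y)) \<in> polys k n"
    using gram_monomial_homogeneous[OF assms] by (rule homogeneous_imp_polys)
  fix A y assume "A \<in> orthogonal_group n"
  then have "gram n (act n A y) = gram n y" by (simp add: gram_act fun_eq_iff)
  then show "gram_monomial ps (gram n (act n A y)) = gram_monomial ps (gram n y)" by simp
qed

lemma invariant_diff:
  "F \<in> invariant_polys k n \<Longrightarrow> G \<in> invariant_polys k n \<Longrightarrow> (\<lambda>y. F y - G y) \<in> invariant_polys k n"
  by (auto simp: invariant_polys_def polys_diff)

lemma invariant_cmult: "F \<in> invariant_polys k n \<Longrightarrow> (\<lambda>y. c * F y) \<in> invariant_polys k n"
  by (auto simp: invariant_polys_def intro: polys.intros)

lemma invariant_sum: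
  "(\<And>s. s \<in> S \<Longrightarrow> F s \<in> invariant_polys k n) \<Longrightarrow> (\<lambda>y. \<Sum>s\<in>S. F s y) \<in> invariant_polys k n"
  by (auto simp: invariant_polys_def polys_sum intro!: sum.cong)

text \<open>Induction on the degree \<open>d\<close>: the remainder \<open>H\<close> of \<open>F\<close> after projecting it to the span of
  the Gram monomials is invariant. The induction hypothesis for the contractions of \<open>H\<close> shows that
  \<open>\<Sum> \<langle>y\<^sub>i, y\<^sub>j\<rangle> \<langle>\<partial>\<^sub>i, \<partial>\<^sub>j\<rangle> H\<close> lies in that span. Hence \<open>H\<close> is orthogonal to it, and the
  lower bound forces \<open>H = 0\<close>. For odd \<open>d\<close> the span is zero.\<close>

theorem fft_homogeneous:
  "homogeneous k n d F \<Longrightarrow> F \<in> invariant_polys k n \<Longrightarrow>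
    \<exists>c. \<forall>y. F y = (\<Sum>ps\<in>pair_lists k d. c ps * gram_monomial ps (gram n y))"
proof (induction d arbitrary: F rule: less_induct)
  case (less d)
  note hF = less.prems(1) and iF = less.prems(2)
  show ?case
  proof (cases "d = 0")
    case True
    with hF obtain c where "F = (\<lambda>y. c)" using homogeneous_0_const by blast
    moreover have "pair_lists k d = {[]}" using True by (auto simp: pair_lists_def)
    ultimately show ?thesis by (auto intro!: exI[of _ "\<lambda>_. c"])
  next
    case False
    let ?m = "\<lambda>ps y. gram_monomial ps (gram n y)"
    have P: "F \<in> polys k n" "\<And>ps. ps \<in> pair_lists k d \<Longrightarrow> ?m ps \<in> polys k n"
      by (rule homogeneous_imp_polys[OF hF] homogeneous_imp_polys[OF gram_monomial_homogeneous], assumption?)+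
    obtain c where c: "\<forall>ps\<in>pair_lists k d.
        fischer k n d (\<lambda>y. F y - (\<Sum>ps\<in>pair_lists k d. c ps * ?m ps y)) (?m ps) = 0"
      using fischer_projection[where m = ?m, OF finite_pair_lists P(2,1)] by blast
    define H where "H = (\<lambda>y. F y - (\<Sum>ps\<in>pair_lists k d. c ps * ?m ps y))"
    have iH: "H \<in> invariant_polys k n"
      unfolding H_def by (intro invariant_diff invariant_sum invariant_cmult iF gram_monomial_invariant)
    have hH: "homogeneous k n d H"
      unfolding H_def by (intro homogeneous_diff homogeneous_sum homogeneous_cmult hF gram_monomial_homogeneous)
    have PH: "H \<in> polys k n" using hH by (rule homogeneous_imp_polys)
    have orth: "fischer k n d (?m ps) H = 0" if "ps \<in> pair_lists k d" for ps
      using c that unfolding H_def[symmetric] by (simp add: fischer_commute[of k n d _ H])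
    have "fischer k n d (\<lambda>y. gram n y i j * contraction n i j H y) H = 0"
      if ij: "i \<in> {1..2*k}" "j \<in> {1..2*k}" for i j
    proof (cases "d = 1")
      case True
      have "partial i \<alpha> (partial j \<alpha> H) = (\<lambda>y. 0)" for \<alpha>
      proof -
        have "homogeneous k n 0 (partial j \<alpha> H)"
          using partial_homogeneous[OF hH, of j \<alpha>] by (simp add: True One_nat_def)
        then obtain c where "partial j \<alpha> H = (\<lambda>y. c)" using homogeneous_0_const by blast
        then show ?thesis by simp
      qed
      then have "contraction n i j H = (\<lambda>y. 0)" by (simp add: contraction_def[abs_def])
      then show ?thesis by simp
    next
      case d1: False
      define e where "e = d - 2"
      have d: "d = Suc (Suc e)" using False d1 by (simp add: e_def)
      have "homogeneous k n (Suc e) (partial j \<alpha> H)" for \<alpha>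
        using partial_homogeneous[OF hH, of j \<alpha>] by (simp add: d)
      then have "homogeneous k n e (partial i \<alpha> (partial j \<alpha> H))" for \<alpha>
        using partial_homogeneous[of k n "Suc e" "partial j \<alpha> H" i \<alpha>] by simp
      then have "homogeneous k n e (contraction n i j H)"
        unfolding contraction_def[abs_def] by (intro homogeneous_sum)
      moreover have "contraction n i j H \<in> invariant_polys k n"
        using iH ij by (rule contraction_invariant)
      ultimately obtain b where b: "\<And>y. contraction n i j H y = (\<Sum>ps\<in>pair_lists k e. b ps * ?m ps y)"
        using less.IH[of e] d by auto
      have up: "(i, j) # ps \<in> pair_lists k d" if "ps \<in> pair_lists k e" for ps
        using that ij by (auto simp: pair_lists_def d)
      have "(\<lambda>y. gram n y i j * contraction n i j H y)
          = (\<lambda>y. \<Sum>ps\<in>pair_lists k e. b ps * ?m ((i, j) # ps) y)"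
        by (simp add: b sum_distrib_left algebra_simps)
      then have "fischer k n d (\<lambda>y. gram n y i j * contraction n i j H y) H
          = fischer k n d (\<lambda>y. \<Sum>ps\<in>pair_lists k e. b ps * ?m ((i, j) # ps) y) H"
        by (rule arg_cong)
      also have "\<dots> = (\<Sum>ps\<in>pair_lists k e. b ps * fischer k n d (?m ((i, j) # ps)) H)"
        by (subst fischer_sum_left)
          (auto intro!: polys_intros P(2) up sum.cong fischer_cmult_left simp del: gram_monomial_Cons)
      also have "\<dots> = 0" by (intro sum.neutral ballI) (simp only: orth up mult_zero_right)
      finally show ?thesis .
    qed
    moreover have "(\<lambda>y. gram n y i j * contraction n i j H y) \<in> polys k n"
      if "i \<in> {1..2*k}" "j \<in> {1..2*k}" for i j
      using that by (intro polys.mult gram_entry_polys contraction_polys PH)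
    ultimately have "fischer k n d
        (\<lambda>y. \<Sum>i=1..2*k. \<Sum>j=1..2*k. gram n y i j * contraction n i j H y) H = 0"
      by (subst fischer_sum_left)
        (auto intro!: polys_sum sum.neutral simp: fischer_sum_left simp del: atLeastAtMost_iff)
    with gram_contraction_bound[OF iH hH] False fischer_nonneg[of k n d H]
    have "fischer k n d H H = 0" by (simp add: mult_le_0_iff)
    with hH have "H = (\<lambda>y. 0)" by (rule fischer_definite)
    then show ?thesis by (intro exI[of _ c]) (simp add: H_def fun_eq_iff)
  qed
qed


section \<open>Invariant polynomials as polynomials in the Gram matrix\<close>

lemma homogeneous_decomposition:
  "F \<in> polys k n \<Longrightarrow> \<exists>D C. (\<forall>d. homogeneous k n d (C d)) \<and> (\<forall>d>D. C d = (\<lambda>y. 0)) \<and>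
     F = (\<lambda>y. \<Sum>d\<le>D. C d y)"
proof (induction rule: polys.induct)
  case (const c)
  have "homogeneous k n d (\<lambda>y. if d = 0 then c else 0)" for d
    by (cases "d = 0") (auto intro: homogeneous.const homogeneous.zero)
  then show ?case
    by (intro exI[of _ 0] exI[of _ "\<lambda>d y. if d = 0 then c else 0"]) auto
next
  case (coord i \<alpha>)
  have "homogeneous k n d (\<lambda>y. if d = 1 then y i \<alpha> else 0)" for d
    using homogeneous.coord[OF coord] by (cases "d = 1") (auto intro: homogeneous.zero)
  then show ?case
    by (intro exI[of _ 1] exI[of _ "\<lambda>d y. if d = 1 then y i \<alpha> else 0"]) (auto simp: fun_eq_iff)
next
  case (add F G)
  then obtain D1 C1 D2 C2 where
    1: "\<And>d. homogeneous k n d (C1 d)" "\<And>d. d > D1 \<Longrightarrow> C1 d = (\<lambda>y. 0)" "F = (\<lambda>y. \<Sum>d\<le>D1. C1 d y)" and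
    2: "\<And>d. homogeneous k n d (C2 d)" "\<And>d. d > D2 \<Longrightarrow> C2 d = (\<lambda>y. 0)" "G = (\<lambda>y. \<Sum>d\<le>D2. C2 d y)"
    by blast
  have "(\<Sum>d\<le>D1. C1 d y) = (\<Sum>d\<le>max D1 D2. C1 d y)" "(\<Sum>d\<le>D2. C2 d y) = (\<Sum>d\<le>max D1 D2. C2 d y)" for y
    by (rule sum.mono_neutral_left; simp add: 1(2) 2(2))+
  then show ?case
    using 1 2 by (intro exI[of _ "max D1 D2"] exI[of _ "\<lambda>d y. C1 d y + C2 d y"])
      (auto simp: sum.distrib intro: homogeneous.add)
next
  case (mult F G)
  then obtain D1 C1 D2 C2 where
    1: "\<And>d. homogeneous k n d (C1 d)" "\<And>d. d > D1 \<Longrightarrow> C1 d = (\<lambda>y. 0)" "F = (\<lambda>y. \<Sum>d\<le>D1. C1 d y)" and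
    2: "\<And>d. homogeneous k n d (C2 d)" "\<And>d. d > D2 \<Longrightarrow> C2 d = (\<lambda>y. 0)" "G = (\<lambda>y. \<Sum>d\<le>D2. C2 d y)"
    by blast
  have "F y * G y = (\<Sum>r\<le>D1 + D2. \<Sum>d\<le>r. C1 d y * C2 (r - d) y)" for y
    using polynomial_product[of D1 "\<lambda>d. C1 d y" D2 "\<lambda>d. C2 d y" 1] 1 2 by simp
  moreover have "homogeneous k n r (\<lambda>y. \<Sum>d\<le>r. C1 d y * C2 (r - d) y)" for r
  proof (rule homogeneous_sum)
    fix d assume "d \<in> {..r}"
    then show "homogeneous k n r (\<lambda>y. C1 d y * C2 (r - d) y)"
      using homogeneous.mult[OF 1(1)[of d] 2(1)[of "r - d"]] by simp
  qed
  moreover have "(\<lambda>y. \<Sum>d\<le>r. C1 d y * C2 (r - d) y) = (\<lambda>y. 0)" if "r > D1 + D2" for r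
  proof
    fix y show "(\<Sum>d\<le>r. C1 d y * C2 (r - d) y) = 0"
    proof (rule sum.neutral, rule ballI)
      fix d
      have "d > D1 \<or> r - d > D2" using that by linarith
      then show "C1 d y * C2 (r - d) y = 0" by (auto simp: 1 2)
    qed
  qed
  ultimately show ?case
    by (intro exI[of _ "D1 + D2"] exI[of _ "\<lambda>r y. \<Sum>d\<le>r. C1 d y * C2 (r - d) y"]) auto
qed

text \<open>The matrix argument carries no reference to \<open>n\<close>, so that one such polynomial gives an invariant
  of every \<open>O\<^sub>n\<close> at once.\<close>

inductive_set gram_polys :: "nat \<Rightarrow> ((nat \<Rightarrow> nat \<Rightarrow> real) \<Rightarrow> real) set" for k :: nat where
  const: "(\<lambda>g. c) \<in> gram_polys k"
| entry: "i \<in> {1..2*k} \<Longrightarrow> j \<in> {1..2*k} \<Longrightarrow> (\<lambda>g. g i j) \<in> gram_polys k"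
| add: "P \<in> gram_polys k \<Longrightarrow> Q \<in> gram_polys k \<Longrightarrow> (\<lambda>g. P g + Q g) \<in> gram_polys k"
| mult: "P \<in> gram_polys k \<Longrightarrow> Q \<in> gram_polys k \<Longrightarrow> (\<lambda>g. P g * Q g) \<in> gram_polys k"

lemma gram_polys_sum:
  "(\<And>s. s \<in> S \<Longrightarrow> P s \<in> gram_polys k) \<Longrightarrow> (\<lambda>g. \<Sum>s\<in>S. P s g) \<in> gram_polys k"
  by (induction S rule: infinite_finite_induct) (auto intro: gram_polys.intros)

lemma gram_monomial_gram_polys:
  "set ps \<subseteq> {1..2*k} \<times> {1..2*k} \<Longrightarrow> gram_monomial ps \<in> gram_polys k"
proof (induction ps)
  case Nil
  then show ?case using gram_polys.const[of 1] by (simp add: gram_monomial_def[abs_def])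
next
  case (Cons p ps)
  obtain i j where p: "p = (i, j)" by fastforce
  then have "(\<lambda>g. g i j * gram_monomial ps g) \<in> gram_polys k"
    using Cons by (intro gram_polys.mult gram_polys.entry) auto
  then show ?case by (simp add: p gram_monomial_def[abs_def])
qed

lemma gram_polys_polys:
  "P \<in> gram_polys k \<Longrightarrow> (\<lambda>y. P (gram n y)) \<in> polys k n"
  by (induction rule: gram_polys.induct) (auto intro: polys.intros gram_entry_polys)

lemma gram_polys_invariant:
  assumes "P \<in> gram_polys k"
  shows "(\<lambda>y. P (gram n y)) \<in> invariant_polys k n"
proof (rule invariantI)
  fix A y assume "A \<in> orthogonal_group n"
  then have "gram n (act n A y) = gram n y" by (simp add: gram_act fun_eq_iff)
  then show "P (gram n (act n A y)) = P (gram n y)" by simp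
qed (rule gram_polys_polys[OF assms])

text \<open>The homogeneity for all \<open>m\<close> lets the grading be carried from one dimension to another.\<close>

lemma fft_graded:
  assumes "F \<in> invariant_polys k n" "homogeneous k n d F"
  shows "\<exists>P\<in>gram_polys k. F = (\<lambda>y. P (gram n y)) \<and> (\<forall>m. homogeneous k m d (\<lambda>y. P (gram m y)))"
proof -
  obtain c where c: "\<And>y. F y = (\<Sum>ps\<in>pair_lists k d. c ps * gram_monomial ps (gram n y))"
    using fft_homogeneous[OF assms(2,1)] by blast
  let ?P = "\<lambda>g. \<Sum>ps\<in>pair_lists k d. c ps * gram_monomial ps g"
  have "?P \<in> gram_polys k"
    by (intro gram_polys_sum gram_polys.mult gram_polys.const gram_monomial_gram_polys)
      (simp add: pair_lists_def)
  moreover have "homogeneous k m d (\<lambda>y. ?P (gram m y))" for m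
    by (intro homogeneous_sum homogeneous_cmult gram_monomial_homogeneous)
  ultimately show ?thesis using c by (intro bexI[of _ ?P]) auto
qed

text \<open>The homogeneous components of an invariant are invariant, by comparing coefficients of the powers
  of \<open>t\<close> in \<open>F(t y)\<close>.\<close>

theorem fft:
  assumes F: "F \<in> invariant_polys k n"
  shows "\<exists>P\<in>gram_polys k. F = (\<lambda>y. P (gram n y))"
proof -
  obtain D C where C: "\<And>d. homogeneous k n d (C d)" "F = (\<lambda>y. \<Sum>d\<le>D. C d y)"
    using homogeneous_decomposition[OF invariant_imp_polys[OF F]] by blast
  have "C d \<in> invariant_polys k n" if d: "d \<le> D" for d
  proof (rule invariantI)
    show "C d \<in> polys k n" using C(1) by (rule homogeneous_imp_polys)
    fix A y assume A: "A \<in> orthogonal_group n"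
    have act: "act n A (\<lambda>i \<alpha>. t * y i \<alpha>) = (\<lambda>i \<alpha>. t * act n A y i \<alpha>)" for t
      by (auto simp: act_def fun_eq_iff sum_distrib_left algebra_simps)
    have "(\<Sum>d\<le>D. C d (act n A y) * t ^ d) = (\<Sum>d\<le>D. C d y * t ^ d)" for t
      using invariant_act[OF F A, of "\<lambda>i \<alpha>. t * y i \<alpha>"]
      by (simp add: C(2) act homogeneous_scale[OF C(1)] mult.commute)
    then have "\<forall>t. (\<Sum>d\<le>D. C d (act n A y) * t ^ d) = (\<Sum>d\<le>D. C d y * t ^ d)" by blast
    then show "C d (act n A y) = C d y" using d by (subst (asm) polyfun_eq_coeffs) blast
  qed
  then have "\<forall>d. \<exists>P. d \<le> D \<longrightarrow> P \<in> gram_polys k \<and> C d = (\<lambda>y. P (gram n y))"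
    using fft_graded[OF _ C(1)] by blast
  from choice[OF this] obtain P
    where "\<forall>d. d \<le> D \<longrightarrow> P d \<in> gram_polys k \<and> C d = (\<lambda>y. P d (gram n y))" by blast
  then show ?thesis
    by (intro bexI[of _ "\<lambda>g. \<Sum>d\<le>D. P d g"] gram_polys_sum) (auto simp: C(2) fun_eq_iff)
qed


section \<open>The Poisson bracket of invariant polynomials\<close>

lemma partial_gram:
  assumes "i \<in> {1..2*k}" "a \<in> {1..2*k}" "b \<in> {1..2*k}" "\<alpha> \<in> {1..n}"
  shows "partial i \<alpha> (\<lambda>y. gram n y a b)
    = (\<lambda>y. (if i = a then y b \<alpha> else 0) + (if i = b then y a \<alpha> else 0))"
proof -
  have c: "(\<lambda>y. y j \<gamma>) \<in> polys k n" if "j \<in> {a, b}" "\<gamma> \<in> {1..n}" for j \<gamma>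
    using that assms by (intro polys.coord) auto
  have "partial i \<alpha> (\<lambda>y. gram n y a b) = (\<lambda>y. \<Sum>\<gamma>=1..n. partial i \<alpha> (\<lambda>y. y a \<gamma> * y b \<gamma>) y)"
    unfolding gram_def by (rule partial_sum[of _ _ k n]) (auto intro!: polys.mult c)
  also have "\<dots> = (\<lambda>y. \<Sum>\<gamma>=1..n. (if \<gamma> = \<alpha> then if i = a then y b \<gamma> else 0 else 0)
      + (if \<gamma> = \<alpha> then if i = b then y a \<gamma> else 0 else 0))"
    by (intro ext sum.cong refl) (auto simp: partial_mult[OF c c] partial_coord)
  finally show ?thesis using assms by (simp add: sum.distrib)
qed

text \<open>The coefficients \<open>e\<close> do not depend on \<open>n\<close>. This is what makes brackets comparable between
  phase spaces of different dimension.\<close>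

lemma partial_gram_polys:
  "P \<in> gram_polys k \<Longrightarrow> \<exists>e. \<forall>n y. \<forall>i\<in>{1..2*k}. \<forall>\<alpha>\<in>{1..n}.
     partial i \<alpha> (\<lambda>y. P (gram n y)) y = (\<Sum>j=1..2*k. e i j (gram n y) * y j \<alpha>)"
proof (induction rule: gram_polys.induct)
  case (const c)
  then show ?case by (intro exI[of _ "\<lambda>i j g. 0"]) simp
next
  case (entry a b)
  have "(\<Sum>j=1..2*k. ((if i = a \<and> j = b then 1 else 0) + (if i = b \<and> j = a then 1 else 0)) * y j \<alpha>)
      = (if i = a then y b \<alpha> else 0) + (if i = b then y a \<alpha> else 0)" for i \<alpha> and y :: point
  proof -
    have "(\<Sum>j=1..2*k. ((if i = a \<and> j = b then 1 else 0) + (if i = b \<and> j = a then 1 else 0)) * y j \<alpha>)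
      = (\<Sum>j=1..2*k. (if j = b then if i = a then y j \<alpha> else 0 else 0)
        + (if j = a then if i = b then y j \<alpha> else 0 else 0))"
      by (rule sum.cong) auto
    then show ?thesis using entry by (simp add: sum.distrib)
  qed
  then show ?case
    by (intro exI[of _ "\<lambda>i j g. (if i = a \<and> j = b then 1 else 0) + (if i = b \<and> j = a then 1 else 0)"])
      (simp add: partial_gram entry del: atLeastAtMost_iff)
next
  case (add P Q)
  then obtain e f where
    e: "\<forall>n y. \<forall>i\<in>{1..2*k}. \<forall>\<alpha>\<in>{1..n}.
      partial i \<alpha> (\<lambda>y. P (gram n y)) y = (\<Sum>j=1..2*k. e i j (gram n y) * y j \<alpha>)" and
    f: "\<forall>n y. \<forall>i\<in>{1..2*k}. \<forall>\<alpha>\<in>{1..n}.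
      partial i \<alpha> (\<lambda>y. Q (gram n y)) y = (\<Sum>j=1..2*k. f i j (gram n y) * y j \<alpha>)" by blast
  show ?case
    by (intro exI[of _ "\<lambda>i j g. e i j g + f i j g"])
      (simp add: partial_add[OF gram_polys_polys[OF add.hyps(1)] gram_polys_polys[OF add.hyps(2)]]
        e[rule_format] f[rule_format] algebra_simps sum.distrib del: atLeastAtMost_iff)
next
  case (mult P Q)
  then obtain e f where
    e: "\<forall>n y. \<forall>i\<in>{1..2*k}. \<forall>\<alpha>\<in>{1..n}.
      partial i \<alpha> (\<lambda>y. P (gram n y)) y = (\<Sum>j=1..2*k. e i j (gram n y) * y j \<alpha>)" and
    f: "\<forall>n y. \<forall>i\<in>{1..2*k}. \<forall>\<alpha>\<in>{1..n}.
      partial i \<alpha> (\<lambda>y. Q (gram n y)) y = (\<Sum>j=1..2*k. f i j (gram n y) * y j \<alpha>)" by blast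
  show ?case
    by (intro exI[of _ "\<lambda>i j g. e i j g * Q g + P g * f i j g"])
      (simp add: partial_mult[OF gram_polys_polys[OF mult.hyps(1)] gram_polys_polys[OF mult.hyps(2)]]
        e[rule_format] f[rule_format] algebra_simps sum.distrib sum_distrib_left sum_distrib_right
        del: atLeastAtMost_iff)
qed

text \<open>By \<open>partial_gram_polys\<close> the gradients are combinations of the vectors \<open>y\<^sub>j\<close>, and only inner
  products of the gradients enter the bracket.\<close>

lemma poisson_gram_polys:
  assumes "P \<in> gram_polys k" "Q \<in> gram_polys k"
  shows "\<exists>R. \<forall>n y. poisson k n (\<lambda>y. P (gram n y)) (\<lambda>y. Q (gram n y)) y = R (gram n y)"
proof -
  obtain e where e: "\<forall>n y. \<forall>i\<in>{1..2*k}. \<forall>\<alpha>\<in>{1..n}.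
      partial i \<alpha> (\<lambda>y. P (gram n y)) y = (\<Sum>j=1..2*k. e i j (gram n y) * y j \<alpha>)"
    using partial_gram_polys[OF assms(1)] by blast
  obtain f where f: "\<forall>n y. \<forall>i\<in>{1..2*k}. \<forall>\<alpha>\<in>{1..n}.
      partial i \<alpha> (\<lambda>y. Q (gram n y)) y = (\<Sum>j=1..2*k. f i j (gram n y) * y j \<alpha>)"
    using partial_gram_polys[OF assms(2)] by blast
  define S where "S a b g = (\<Sum>i=1..2*k. \<Sum>j=1..2*k. e a i g * f b j g * g i j)" for a b g
  have S: "(\<Sum>\<alpha>=1..n. partial a \<alpha> (\<lambda>y. P (gram n y)) y * partial b \<alpha> (\<lambda>y. Q (gram n y)) y)
      = S a b (gram n y)" if "a \<in> {1..2*k}" "b \<in> {1..2*k}" for a b n y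
  proof -
    let ?g = "gram n y"
    have "(\<Sum>\<alpha>=1..n. partial a \<alpha> (\<lambda>y. P (gram n y)) y * partial b \<alpha> (\<lambda>y. Q (gram n y)) y)
      = (\<Sum>\<alpha>=1..n. \<Sum>i=1..2*k. \<Sum>j=1..2*k. e a i ?g * f b j ?g * (y i \<alpha> * y j \<alpha>))"
    proof (rule sum.cong[OF refl])
      fix \<alpha> assume \<alpha>: "\<alpha> \<in> {1..n}"
      show "partial a \<alpha> (\<lambda>y. P (gram n y)) y * partial b \<alpha> (\<lambda>y. Q (gram n y)) y
          = (\<Sum>i=1..2*k. \<Sum>j=1..2*k. e a i ?g * f b j ?g * (y i \<alpha> * y j \<alpha>))"
        unfolding e[rule_format, OF that(1) \<alpha>] f[rule_format, OF that(2) \<alpha>] sum_product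
        by (intro sum.cong refl) (simp add: algebra_simps)
    qed
    also have "\<dots> = (\<Sum>i=1..2*k. \<Sum>j=1..2*k. \<Sum>\<alpha>=1..n. e a i ?g * f b j ?g * (y i \<alpha> * y j \<alpha>))"
      by (rule sum_rotate3)
    finally show ?thesis by (simp add: S_def gram_def sum_distrib_left)
  qed
  have "poisson k n (\<lambda>y. P (gram n y)) (\<lambda>y. Q (gram n y)) y
      = (\<Sum>l=1..k. S (2*l - 1) (2*l) (gram n y) - S (2*l) (2*l - 1) (gram n y))" for n y
    unfolding poisson_def sum_subtractf
    by (intro arg_cong2[where f = "(-)"] sum.cong refl S) auto
  then show ?thesis by (intro exI allI)
qed

lemma poisson_polys:
  "F \<in> polys k n \<Longrightarrow> G \<in> polys k n \<Longrightarrow> poisson k n F G \<in> polys k n"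
  unfolding poisson_def[abs_def] by (intro polys_intros partial_polys)

lemma poisson_antisym: "poisson k n F G y = - poisson k n G F y"
  by (simp add: poisson_def sum_negf[symmetric] algebra_simps)

lemma poisson_diff_left:
  "F \<in> polys k n \<Longrightarrow> F' \<in> polys k n \<Longrightarrow>
    poisson k n (\<lambda>y. F y - F' y) G y = poisson k n F G y - poisson k n F' G y"
  by (simp add: poisson_def partial_diff[of F k n] sum_subtractf[symmetric] algebra_simps)

lemma poisson_invariant:
  assumes "F \<in> invariant_polys k n" "G \<in> invariant_polys k n"
  shows "poisson k n F G \<in> invariant_polys k n"
proof -
  obtain P Q where PQ: "P \<in> gram_polys k" "F = (\<lambda>y. P (gram n y))"
      "Q \<in> gram_polys k" "G = (\<lambda>y. Q (gram n y))"
    using fft assms by metis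
  obtain R where "\<forall>n y. poisson k n (\<lambda>y. P (gram n y)) (\<lambda>y. Q (gram n y)) y = R (gram n y)"
    using poisson_gram_polys[OF PQ(1,3)] by blast
  then have R: "poisson k n F G y = R (gram n y)" for y by (simp add: PQ)
  show ?thesis
  proof (rule invariantI)
    show "poisson k n F G \<in> polys k n"
      using assms by (intro poisson_polys) (auto intro: invariant_imp_polys)
    fix A y assume "A \<in> orthogonal_group n"
    then have "gram n (act n A y) = gram n y" by (simp add: gram_act fun_eq_iff)
    then show "poisson k n F G (act n A y) = poisson k n F G y" by (simp add: R)
  qed
qed

lemma sum_conjugate_pairs:
  fixes f :: "nat \<Rightarrow> real"
  shows "(\<Sum>i=1..2*k. f i) = (\<Sum>l=1..k. f (2*l - 1) + f (2*l))"
  by (induction k) (auto simp: One_nat_def)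

text \<open>The Hamiltonian flow of \<open>\<langle>v, v\<rangle> / 2\<close> for a combination \<open>v = \<Sum> s\<^sub>i y\<^sub>i\<close> is a symplectic
  transvection: it moves each \<open>y\<^sub>i\<close> along the constant vector \<open>v\<close>, so it is explicit and preserves
  the moment map. By polarization these flows account for all brackets with inner products.\<close>

lemma transvection_zero_fibre:
  fixes s :: "nat \<Rightarrow> real"
  assumes z: "z \<in> zero_fibre k n"
  defines "v \<equiv> \<lambda>\<alpha>. \<Sum>i=1..2*k. s i * z i \<alpha>"
  defines "c \<equiv> \<lambda>i. if i \<in> {1..2*k} then if odd i then s (i + 1) else - s (i - 1) else 0"
  shows "(\<lambda>i \<alpha>. z i \<alpha> + t * (c i * v \<alpha>)) \<in> zero_fibre k n"
proof -
  let ?w = "\<lambda>i \<alpha>. z i \<alpha> + t * (c i * v \<alpha>)"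
  have ps: "z \<in> phase_space k n" using z by (simp add: zero_fibre_def)
  have "v \<alpha> = 0" if "\<alpha> \<notin> {1..n}" for \<alpha>
    using ps that by (simp add: v_def phase_space_def)
  then have 1: "?w \<in> phase_space k n"
    using ps by (auto simp: phase_space_def c_def)
  have v: "(\<Sum>l=1..k. c (2*l) * z (2*l - 1) \<alpha> - c (2*l - 1) * z (2*l) \<alpha>) = - v \<alpha>" for \<alpha>
  proof -
    have "(\<Sum>l=1..k. c (2*l) * z (2*l - 1) \<alpha> - c (2*l - 1) * z (2*l) \<alpha>)
        = (\<Sum>l=1..k. - (s (2*l - 1) * z (2*l - 1) \<alpha> + s (2*l) * z (2*l) \<alpha>))"
      by (rule sum.cong) (auto simp: c_def)
    then show ?thesis unfolding v_def sum_conjugate_pairs sum_negf[symmetric] .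
  qed
  have "moment k \<alpha> \<beta> ?w = moment k \<alpha> \<beta> z" for \<alpha> \<beta>
  proof -
    have "moment k \<alpha> \<beta> ?w = moment k \<alpha> \<beta> z
        + t * (v \<beta> * (\<Sum>l=1..k. c (2*l) * z (2*l - 1) \<alpha> - c (2*l - 1) * z (2*l) \<alpha>)
             - v \<alpha> * (\<Sum>l=1..k. c (2*l) * z (2*l - 1) \<beta> - c (2*l - 1) * z (2*l) \<beta>))"
      unfolding moment_def q_coord_def p_coord_def sum_distrib_left sum_subtractf[symmetric]
        sum.distrib[symmetric]
      by (rule sum.cong) (simp_all add: algebra_simps)
    then show ?thesis by (simp only: v) simp
  qed
  with z 1 show ?thesis by (simp add: zero_fibre_def)
qed

text \<open>The function \<open>D\<close> is zero along the flows of \<open>transvection_zero_fibre\<close>, so its derivative along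
  them vanishes.\<close>

lemma poisson_vanishing_gram:
  assumes D: "D \<in> polys k n" and van: "\<And>z. z \<in> zero_fibre k n \<Longrightarrow> D z = 0"
    and z: "z \<in> zero_fibre k n" and ab: "a \<in> {1..2*k}" "b \<in> {1..2*k}"
  shows "poisson k n D (\<lambda>y. gram n y a b) z = 0"
proof -
  define Q where "Q s = (\<Sum>l=1..k. \<Sum>\<alpha>=1..n.
      partial (2*l - 1) \<alpha> D z * (s (2*l) * (\<Sum>i=1..2*k. s i * z i \<alpha>))
      - partial (2*l) \<alpha> D z * (s (2*l - 1) * (\<Sum>i=1..2*k. s i * z i \<alpha>)))" for s :: "nat \<Rightarrow> real"
  have Q: "Q s = 0" for s
  proof -
    define v where "v \<alpha> = (\<Sum>i=1..2*k. s i * z i \<alpha>)" for \<alpha>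
    define c where "c i = (if i \<in> {1..2*k} then if odd i then s (i + 1) else - s (i - 1) else 0)" for i
    let ?w = "\<lambda>t i \<alpha>. z i \<alpha> + t * (c i * v \<alpha>)"
    have "((\<lambda>t. D (?w t)) has_field_derivative
        (\<Sum>i=1..2*k. \<Sum>\<alpha>=1..n. partial i \<alpha> D (?w 0) * (c i * v \<alpha>))) (at 0)"
      by (rule polys_chain_rule[OF D]) (auto intro!: derivative_eq_intros)
    moreover have "(\<lambda>t. D (?w t)) = (\<lambda>t. 0)"
      using van[OF transvection_zero_fibre[OF z, of _ s]] by (simp add: v_def c_def)
    ultimately have "(\<Sum>i=1..2*k. \<Sum>\<alpha>=1..n. partial i \<alpha> D z * (c i * v \<alpha>)) = 0"
      using DERIV_unique[OF _ DERIV_const] by simp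
    also have "(\<Sum>i=1..2*k. \<Sum>\<alpha>=1..n. partial i \<alpha> D z * (c i * v \<alpha>)) = Q s"
      unfolding Q_def v_def[symmetric] unfolding sum_conjugate_pairs[of _ k] sum.distrib[symmetric]
      by (intro sum.cong refl) (auto simp: c_def)
    finally show ?thesis .
  qed
  define s where "s p q i = (if i = a then p else 0) + (if i = b then q else 0 :: real)" for p q i
  have v: "(\<Sum>i=1..2*k. s p q i * z i \<alpha>) = p * z a \<alpha> + q * z b \<alpha>" for p q \<alpha>
  proof -
    have "(\<Sum>i=1..2*k. s p q i * z i \<alpha>)
      = (\<Sum>i=1..2*k. (if i = a then p * z i \<alpha> else 0) + (if i = b then q * z i \<alpha> else 0))"
      by (rule sum.cong) (auto simp: s_def algebra_simps)
    then show ?thesis using ab by (simp add: sum.distrib)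
  qed
  \<comment> \<open>\<open>Q s\<close> is the bracket of \<open>D\<close> with \<open>\<langle>v, v\<rangle> / 2\<close>, and polarization yields \<open>\<langle>y\<^sub>a, y\<^sub>b\<rangle>\<close>\<close>
  have "poisson k n D (\<lambda>y. gram n y a b) z = Q (s 1 1) - Q (s 1 0) - Q (s 0 1)"
    unfolding poisson_def Q_def v sum_subtractf[symmetric]
  proof (intro sum.cong refl)
    fix l \<alpha> assume l: "l \<in> {1..k}" and a: "\<alpha> \<in> {1..n}"
    from l have "2*l - 1 \<in> {1..2*k}" "2*l \<in> {1..2*k}" by auto
    then show "partial (2*l - 1) \<alpha> D z * partial (2*l) \<alpha> (\<lambda>y. gram n y a b) z -
        partial (2*l) \<alpha> D z * partial (2*l - 1) \<alpha> (\<lambda>y. gram n y a b) z =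
        partial (2*l - 1) \<alpha> D z * (s 1 1 (2*l) * (1 * z a \<alpha> + 1 * z b \<alpha>)) -
        partial (2*l) \<alpha> D z * (s 1 1 (2*l - 1) * (1 * z a \<alpha> + 1 * z b \<alpha>)) -
        (partial (2*l - 1) \<alpha> D z * (s 1 0 (2*l) * (1 * z a \<alpha> + 0 * z b \<alpha>)) -
         partial (2*l) \<alpha> D z * (s 1 0 (2*l - 1) * (1 * z a \<alpha> + 0 * z b \<alpha>))) -
        (partial (2*l - 1) \<alpha> D z * (s 0 1 (2*l) * (0 * z a \<alpha> + 1 * z b \<alpha>)) -
         partial (2*l) \<alpha> D z * (s 0 1 (2*l - 1) * (0 * z a \<alpha> + 1 * z b \<alpha>)))"
      by (simp only: partial_gram[OF _ ab a]) (simp add: s_def algebra_simps)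
  qed
  then show ?thesis by (simp add: Q)
qed

text \<open>The Leibniz rule reduces the bracket with \<open>G\<close> to brackets with the inner products that generate
  the invariants.\<close>

lemma poisson_vanishing:
  assumes D: "D \<in> polys k n" and van: "\<And>z. z \<in> zero_fibre k n \<Longrightarrow> D z = 0"
    and z: "z \<in> zero_fibre k n" and G: "G \<in> invariant_polys k n"
  shows "poisson k n D G z = 0"
proof -
  obtain P where P: "P \<in> gram_polys k" and G: "G = (\<lambda>y. P (gram n y))" using fft[OF G] by blast
  from P have "poisson k n D (\<lambda>y. P (gram n y)) z = 0"
  proof (induction rule: gram_polys.induct)
    case (const c)
    then show ?case by (simp add: poisson_def)
  next
    case (entry i j)
    then show ?case using poisson_vanishing_gram[OF D van z] by simp
  next
    case (add P Q)
    have "poisson k n D (\<lambda>y. P (gram n y) + Q (gram n y)) z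
        = poisson k n D (\<lambda>y. P (gram n y)) z + poisson k n D (\<lambda>y. Q (gram n y)) z"
      by (simp add: poisson_def partial_add[OF gram_polys_polys[OF add.hyps(1)] gram_polys_polys[OF add.hyps(2)]]
          algebra_simps sum.distrib sum_subtractf)
    with add show ?case by simp
  next
    case (mult P Q)
    have "poisson k n D (\<lambda>y. P (gram n y) * Q (gram n y)) z
        = poisson k n D (\<lambda>y. P (gram n y)) z * Q (gram n z)
          + P (gram n z) * poisson k n D (\<lambda>y. Q (gram n y)) z"
      by (simp add: poisson_def partial_mult[OF gram_polys_polys[OF mult.hyps(1)] gram_polys_polys[OF mult.hyps(2)]]
          algebra_simps sum.distrib sum_subtractf sum_distrib_left sum_distrib_right)
    with mult show ?case by simp
  qed
  then show ?thesis by (simp add: G)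
qed

lemma induced_cong:
  assumes "F \<in> invariant_polys k n" "G \<in> invariant_polys k n"
    and "\<And>z. z \<in> zero_fibre k n \<Longrightarrow> F z = G z"
  shows "induced k n F = induced k n G"
  unfolding induced_eq_iff[OF assms(1,2)]
  using assms invariant_diff[OF assms(1,2)] by (simp add: vanishing_invariants_def)

lemma induced_eqD:
  "induced k n F = induced k n G \<Longrightarrow> F \<in> invariant_polys k n \<Longrightarrow> G \<in> invariant_polys k n \<Longrightarrow>
    z \<in> zero_fibre k n \<Longrightarrow> F z = G z"
  by (metis induced_apply)

text \<open>The bracket on the zero fibre does not change when one representative after the other is
  replaced, since the differences vanish there. So the description by \<open>THE\<close> is unique.\<close>

lemma quotient_poisson_induced:
  assumes F: "F \<in> invariant_polys k n" and G: "G \<in> invariant_polys k n"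
  shows "quotient_poisson k n (induced k n F) (induced k n G) = induced k n (poisson k n F G)"
  unfolding quotient_poisson_def
proof (rule the_equality)
  show "\<exists>F'\<in>invariant_polys k n. \<exists>G'\<in>invariant_polys k n. induced k n F = induced k n F' \<and>
      induced k n G = induced k n G' \<and> induced k n (poisson k n F G) = induced k n (poisson k n F' G')"
    using assms by blast
next
  fix h assume "\<exists>F'\<in>invariant_polys k n. \<exists>G'\<in>invariant_polys k n. induced k n F = induced k n F' \<and>
      induced k n G = induced k n G' \<and> h = induced k n (poisson k n F' G')"
  then obtain F' G' where F': "F' \<in> invariant_polys k n" "induced k n F = induced k n F'"
    and G': "G' \<in> invariant_polys k n" "induced k n G = induced k n G'"
    and h: "h = induced k n (poisson k n F' G')" by blast
  note P = invariant_imp_polys[OF F] invariant_imp_polys[OF F'(1)]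
    invariant_imp_polys[OF G] invariant_imp_polys[OF G'(1)]
  show "h = induced k n (poisson k n F G)"
    unfolding h
  proof (rule induced_cong)
    fix z assume z: "z \<in> zero_fibre k n"
    have "poisson k n (\<lambda>y. F' y - F y) G' z = 0"
      using induced_eqD[OF F'(2) F F'(1)]
      by (intro poisson_vanishing[OF _ _ z G'(1)] polys_diff P) simp
    moreover have "poisson k n (\<lambda>y. G' y - G y) F z = 0"
      using induced_eqD[OF G'(2) G G'(1)]
      by (intro poisson_vanishing[OF _ _ z F] polys_diff P) simp
    ultimately have "poisson k n F' G' z = poisson k n F G' z" "poisson k n G' F z = poisson k n G F z"
      by (simp_all add: poisson_diff_left P)
    then show "poisson k n F' G' z = poisson k n F G z"
      using poisson_antisym[of k n F G' z] poisson_antisym[of k n F G z] by simp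
  qed (intro poisson_invariant F G F' G')+
qed


section \<open>Linear algebra over finite index sets\<close>

text \<open>Gaussian elimination: an equation with a nonzero coefficient eliminates one unknown.\<close>

lemma underdetermined_system:
  fixes a :: "'e \<Rightarrow> 'v \<Rightarrow> real"
  assumes "finite E"
  shows "finite S \<Longrightarrow> card E < card S \<Longrightarrow>
    \<exists>x. (\<exists>j\<in>S. x j \<noteq> 0) \<and> (\<forall>e\<in>E. (\<Sum>j\<in>S. a e j * x j) = 0)"
  using assms
proof (induction E arbitrary: a S rule: finite_induct)
  case empty
  then obtain j where "j \<in> S" by fastforce
  then show ?case by (intro exI[of _ "\<lambda>_. 1"]) auto
next
  case (insert f E)
  show ?case
  proof (cases "\<forall>j\<in>S. a f j = 0")
    case True
    have "card E < card S" using insert by simp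
    from insert.IH[OF insert.prems(1) this, of a] obtain x where
      x: "\<exists>j\<in>S. x j \<noteq> 0" "\<forall>e\<in>E. (\<Sum>j\<in>S. a e j * x j) = 0" by blast
    then show ?thesis using True by (intro exI[of _ x]) auto
  next
    case False
    then obtain p where p: "p \<in> S" "a f p \<noteq> 0" by blast
    let ?S = "S - {p}"
    define b where "b e j = a e j - a e p * a f j / a f p" for e j
    have "card E < card ?S" using insert p by simp
    from insert.IH[OF _ this, of b] insert.prems obtain x where
      x: "\<exists>j\<in>?S. x j \<noteq> 0" "\<forall>e\<in>E. (\<Sum>j\<in>?S. b e j * x j) = 0" by blast
    define x' where "x' = x(p := - (\<Sum>j\<in>?S. a f j * x j) / a f p)"
    have split: "(\<Sum>j\<in>S. a e j * x' j) = a e p * x' p + (\<Sum>j\<in>?S. a e j * x j)" for e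
    proof -
      have "(\<Sum>j\<in>S. a e j * x' j) = a e p * x' p + (\<Sum>j\<in>?S. a e j * x' j)"
        using insert.prems(1) p(1) by (rule sum.remove)
      also have "(\<Sum>j\<in>?S. a e j * x' j) = (\<Sum>j\<in>?S. a e j * x j)"
        by (rule sum.cong) (auto simp: x'_def)
      finally show ?thesis .
    qed
    have "(\<Sum>j\<in>S. a f j * x' j) = 0" using p by (simp add: split) (simp add: x'_def)
    moreover have "(\<Sum>j\<in>S. a e j * x' j) = 0" if "e \<in> E" for e
    proof -
      have "0 = (\<Sum>j\<in>?S. b e j * x j)" using x(2) that by simp
      also have "\<dots> = (\<Sum>j\<in>?S. a e j * x j) - a e p / a f p * (\<Sum>j\<in>?S. a f j * x j)"
        by (simp add: b_def algebra_simps sum_subtractf sum_distrib_left)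
      finally show ?thesis by (simp add: split) (simp add: x'_def)
    qed
    moreover have "\<exists>j\<in>S. x' j \<noteq> 0" using x(1) by (auto simp: x'_def)
    ultimately show ?thesis by (intro exI[of _ x']) auto
  qed
qed

definition mat_mult :: "nat \<Rightarrow> (nat \<Rightarrow> nat \<Rightarrow> real) \<Rightarrow> (nat \<Rightarrow> nat \<Rightarrow> real) \<Rightarrow> nat \<Rightarrow> nat \<Rightarrow> real" where
  "mat_mult n A B \<alpha> \<beta> = (\<Sum>\<gamma>=1..n. A \<alpha> \<gamma> * B \<gamma> \<beta>)"

lemma act_act: "act n A (act n B y) = act n (mat_mult n A B) y"
proof (intro ext)
  fix i \<alpha>
  show "act n A (act n B y) i \<alpha> = act n (mat_mult n A B) y i \<alpha>"
  proof (cases "\<alpha> \<in> {1..n}")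
    case True
    have "act n A (act n B y) i \<alpha> = (\<Sum>\<beta>=1..n. \<Sum>\<gamma>=1..n. A \<alpha> \<beta> * B \<beta> \<gamma> * y i \<gamma>)"
      unfolding act_apply[OF True]
      by (intro sum.cong refl) (simp add: act_apply sum_distrib_left algebra_simps)
    also have "\<dots> = (\<Sum>\<gamma>=1..n. \<Sum>\<beta>=1..n. A \<alpha> \<beta> * B \<beta> \<gamma> * y i \<gamma>)" by (rule sum.swap)
    finally show ?thesis unfolding act_apply[OF True] by (simp add: mat_mult_def sum_distrib_right)
  qed (simp only: act_def if_False)
qed

lemma mat_mult_orthogonal:
  assumes A: "A \<in> orthogonal_group n" and B: "B \<in> orthogonal_group n"
  shows "mat_mult n A B \<in> orthogonal_group n"
  unfolding orthogonal_group_def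
proof (intro CollectI ballI)
  fix \<alpha> \<beta> assume ab: "\<alpha> \<in> {1..n}" "\<beta> \<in> {1..n}"
  let ?y = "\<lambda>(i::nat) \<gamma>. B \<gamma> i"
  have "(\<Sum>\<gamma>=1..n. mat_mult n A B \<gamma> \<alpha> * mat_mult n A B \<gamma> \<beta>) = gram n (act n A ?y) \<alpha> \<beta>"
    unfolding gram_def by (rule sum.cong) (simp_all add: mat_mult_def act_apply)
  also have "\<dots> = (if \<alpha> = \<beta> then 1 else 0)"
    unfolding gram_act[OF A] using ab by (simp add: gram_def orthogonal_cols[OF B])
  finally show "(\<Sum>\<gamma>=1..n. mat_mult n A B \<gamma> \<alpha> * mat_mult n A B \<gamma> \<beta>) = (if \<alpha> = \<beta> then 1 else 0)" .
qed


section \<open>Orbits are the fibres of the Gram map\<close>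

text \<open>If the first vectors already agree and the lengths of the next ones and their products with
  the first vectors agree, then the reflection in the difference of the next ones exchanges them
  and fixes the first vectors.\<close>

lemma gram_eq_imp_act:
  assumes g: "gram n y = gram n y'"
  shows "\<exists>A\<in>orthogonal_group n. \<forall>i\<in>{1..N::nat}. \<forall>\<alpha>\<in>{1..n}. act n A y i \<alpha> = y' i \<alpha>"
proof (induction N)
  case 0
  then show ?case using reflection_orthogonal by (intro bexI[of _ "reflection n (\<lambda>_. 0)"]) auto
next
  case (Suc N)
  then obtain A where A: "A \<in> orthogonal_group n"
    and eq: "\<And>i \<alpha>. i \<in> {1..N} \<Longrightarrow> \<alpha> \<in> {1..n} \<Longrightarrow> act n A y i \<alpha> = y' i \<alpha>" by blast
  define u where "u = act n A y"
  have gu: "gram n u i j = gram n y' i j" for i j by (simp add: u_def gram_act[OF A] g)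
  define c where "c \<alpha> = u (Suc N) \<alpha> - y' (Suc N) \<alpha>" for \<alpha>
  let ?B = "reflection n c"
  have cc: "(\<Sum>\<gamma>=1..n. c \<gamma> * c \<gamma>) = 2 * (\<Sum>\<beta>=1..n. c \<beta> * u (Suc N) \<beta>)"
  proof -
    have "(\<Sum>\<gamma>=1..n. c \<gamma> * c \<gamma>) - 2 * (\<Sum>\<beta>=1..n. c \<beta> * u (Suc N) \<beta>)
        = gram n y' (Suc N) (Suc N) - gram n u (Suc N) (Suc N)"
      unfolding gram_def sum_distrib_left sum_subtractf[symmetric]
      by (rule sum.cong) (auto simp: c_def algebra_simps)
    then show ?thesis by (simp add: gu)
  qed
  have "act n ?B u i \<alpha> = y' i \<alpha>" if i: "i \<in> {1..Suc N}" and a: "\<alpha> \<in> {1..n}" for i \<alpha>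
  proof (cases "i = Suc N")
    case True
    show ?thesis
    proof (cases "(\<Sum>\<gamma>=1..n. c \<gamma> * c \<gamma>) = 0")
      case z: True
      then have "c \<alpha> = 0" using a by (subst (asm) sum_nonneg_eq_0_iff) auto
      then show ?thesis unfolding act_reflection[OF a] by (simp add: True) (simp add: c_def)
    next
      case False
      then show ?thesis unfolding act_reflection[OF a] True by (simp add: cc) (simp add: c_def)
    qed
  next
    case False
    then have i': "i \<in> {1..N}" using i by auto
    have "(\<Sum>\<beta>=1..n. c \<beta> * u i \<beta>) = gram n u (Suc N) i - gram n y' (Suc N) i"
      unfolding gram_def sum_subtractf[symmetric]
      by (rule sum.cong) (auto simp: c_def u_def eq[OF i'] algebra_simps)
    then show ?thesis unfolding act_reflection[OF a] using eq[OF i' a] by (simp add: gu) (simp add: u_def)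
  qed
  then show ?case
    using mat_mult_orthogonal[OF reflection_orthogonal A, of c]
    by (intro bexI[of _ "mat_mult n ?B A"]) (auto simp: act_act u_def)
qed

lemma phase_space_eqI:
  assumes "y \<in> phase_space k n" "z \<in> phase_space k n"
    and "\<And>i \<alpha>. i \<in> {1..2*k} \<Longrightarrow> \<alpha> \<in> {1..n} \<Longrightarrow> y i \<alpha> = z i \<alpha>"
  shows "y = z"
proof (intro ext)
  fix i \<alpha> show "y i \<alpha> = z i \<alpha>"
  proof (cases "i \<in> {1..2*k} \<and> \<alpha> \<in> {1..n}")
    case False
    then have "y i \<alpha> = 0" "z i \<alpha> = 0" using assms(1,2) unfolding phase_space_def by blast+
    then show ?thesis by simp
  qed (use assms(3) in blast)
qed

lemma gram_eq_imp_act_eq: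
  assumes "y \<in> phase_space k n" "y' \<in> phase_space k n" "gram n y = gram n y'"
  obtains A where "A \<in> orthogonal_group n" "act n A y = y'"
proof -
  obtain A where A: "A \<in> orthogonal_group n" "\<forall>i\<in>{1..2*k}. \<forall>\<alpha>\<in>{1..n}. act n A y i \<alpha> = y' i \<alpha>"
    using gram_eq_imp_act[OF assms(3)] by blast
  then have "act n A y = y'"
    by (intro phase_space_eqI[OF act_in_phase_space[OF assms(1)] assms(2)]) blast
  with A that show ?thesis by blast
qed

lemma gram_orbit: "w \<in> orbit n y \<Longrightarrow> gram n w = gram n y"
  by (auto simp: orbit_def gram_act fun_eq_iff)

lemma orbit_eq_iff:
  assumes "y \<in> phase_space k n" "y' \<in> phase_space k n"
  shows "orbit n y = orbit n y' \<longleftrightarrow> gram n y = gram n y'"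
proof
  assume "orbit n y = orbit n y'"
  then show "gram n y = gram n y'" using gram_orbit self_in_orbit[OF assms(1)] by metis
next
  have sub: "orbit n v \<subseteq> orbit n w"
    if vw: "v \<in> phase_space k n" "w \<in> phase_space k n" and eq: "gram n w = gram n v" for v w
  proof -
    obtain A where A: "A \<in> orthogonal_group n" "act n A w = v"
      using gram_eq_imp_act_eq[OF vw(2,1) eq] .
    then show ?thesis
      using mat_mult_orthogonal[OF _ A(1)] by (auto simp: orbit_def act_act)
  qed
  assume "gram n y = gram n y'"
  then show "orbit n y = orbit n y'" using sub assms by (intro equalityI sub) auto
qed


section \<open>The zero fibre\<close>

lemma zero_fibre_phase_space: "z \<in> zero_fibre k n \<Longrightarrow> z \<in> phase_space k n"
  by (simp add: zero_fibre_def)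

lemma moment_antisym: "moment k \<alpha> \<beta> z = - moment k \<beta> \<alpha> z"
  by (simp add: moment_def sum_negf[symmetric] algebra_simps)

lemma zero_fibre_moment:
  assumes z: "z \<in> zero_fibre k n"
  shows "moment k \<alpha> \<beta> z = 0"
proof (cases "\<alpha> \<in> {1..n} \<and> \<beta> \<in> {1..n}")
  case True
  consider "\<alpha> < \<beta>" | "\<beta> < \<alpha>" | "\<alpha> = \<beta>" by linarith
  then show ?thesis
  proof cases
    case 2
    then show ?thesis using z True moment_antisym[of k \<alpha> \<beta> z] by (simp add: zero_fibre_def)
  qed (use z True in \<open>auto simp: zero_fibre_def moment_def\<close>)
next
  case False
  then have "\<forall>i. z i \<alpha> = 0 \<or> z i \<beta> = 0" "(\<forall>i. z i \<alpha> = 0) \<or> (\<forall>i. z i \<beta> = 0)"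
    using zero_fibre_phase_space[OF z] by (auto simp: phase_space_def)
  then show ?thesis by (auto simp: moment_def q_coord_def p_coord_def)
qed

lemma zero_fibre_iff:
  "z \<in> zero_fibre k n \<longleftrightarrow> z \<in> phase_space k n \<and> (\<forall>\<alpha> \<beta>. moment k \<alpha> \<beta> z = 0)"
  using zero_fibre_moment by (auto simp: zero_fibre_def)

lemma phase_space_mono: "m \<le> n \<Longrightarrow> phase_space k m \<subseteq> phase_space k n"
  by (fastforce simp: phase_space_def)

lemma zero_fibre_mono: "m \<le> n \<Longrightarrow> zero_fibre k m \<subseteq> zero_fibre k n"
  using phase_space_mono[of m n k] by (auto simp: zero_fibre_iff)

lemma gram_phase_space:
  assumes "z \<in> phase_space k m" "m \<le> n"
  shows "gram n z = gram m z"
proof (intro ext)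
  fix i j
  show "gram n z i j = gram m z i j"
    unfolding gram_def using assms by (intro sum.mono_neutral_right) (auto simp: phase_space_def)
qed

text \<open>On the right is the symplectic form of \<open>\<real>\<^sup>2\<^sup>k\<close>, evaluated at two combinations of the rows of
  \<open>z\<close>. So the zero fibre consists of the matrices whose rows span an isotropic subspace.\<close>

lemma moment_sum:
  "(\<Sum>\<gamma>\<in>A. \<Sum>\<delta>\<in>B. a \<gamma> * b \<delta> * moment k \<gamma> \<delta> z)
    = (\<Sum>l=1..k. (\<Sum>\<gamma>\<in>A. a \<gamma> * z (2*l - 1) \<gamma>) * (\<Sum>\<delta>\<in>B. b \<delta> * z (2*l) \<delta>)
                - (\<Sum>\<delta>\<in>B. b \<delta> * z (2*l - 1) \<delta>) * (\<Sum>\<gamma>\<in>A. a \<gamma> * z (2*l) \<gamma>))"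
proof -
  have "(\<Sum>\<gamma>\<in>A. \<Sum>\<delta>\<in>B. a \<gamma> * b \<delta> * moment k \<gamma> \<delta> z) = (\<Sum>\<gamma>\<in>A. \<Sum>\<delta>\<in>B. \<Sum>l=1..k.
      (a \<gamma> * z (2*l - 1) \<gamma>) * (b \<delta> * z (2*l) \<delta>) - (a \<gamma> * z (2*l) \<gamma>) * (b \<delta> * z (2*l - 1) \<delta>))"
    by (simp add: moment_def q_coord_def p_coord_def sum_distrib_left algebra_simps)
  also have "\<dots> = (\<Sum>l=1..k. \<Sum>\<gamma>\<in>A. \<Sum>\<delta>\<in>B.
      (a \<gamma> * z (2*l - 1) \<gamma>) * (b \<delta> * z (2*l) \<delta>) - (a \<gamma> * z (2*l) \<gamma>) * (b \<delta> * z (2*l - 1) \<delta>))"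
    by (rule sum_rotate3[symmetric])
  finally show ?thesis
    by (simp only: sum_subtractf sum_product[symmetric]) (simp only: mult.commute)
qed

lemma act_zero_fibre:
  assumes z: "z \<in> zero_fibre k n"
  shows "act n A z \<in> zero_fibre k n"
  unfolding zero_fibre_def
proof (intro CollectI conjI allI impI)
  show "act n A z \<in> phase_space k n"
    using zero_fibre_phase_space[OF z] by (rule act_in_phase_space)
  fix \<alpha> \<beta> assume "1 \<le> \<alpha> \<and> \<alpha> < \<beta> \<and> \<beta> \<le> n"
  then have a: "\<alpha> \<in> {1..n}" "\<beta> \<in> {1..n}" by auto
  have "moment k \<alpha> \<beta> (act n A z) = (\<Sum>\<gamma>=1..n. \<Sum>\<delta>=1..n. A \<alpha> \<gamma> * A \<beta> \<delta> * moment k \<gamma> \<delta> z)"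
    unfolding moment_sum by (simp add: moment_def[of k \<alpha>] q_coord_def p_coord_def act_apply a del: atLeastAtMost_iff)
  then show "moment k \<alpha> \<beta> (act n A z) = 0" by (simp add: zero_fibre_moment[OF z])
qed

text \<open>The rows of a point of the zero fibre are vectors in \<open>\<real>\<^sup>2\<^sup>k\<close> that span an isotropic subspace.
  Applying the complex structure \<open>J\<close> to them gives vectors orthogonal to all of them, so more than
  \<open>k\<close> rows are dependent.\<close>

lemma zero_fibre_rows_dependent:
  assumes z: "z \<in> zero_fibre k n" and kn: "k < n"
  shows "\<exists>c. (\<exists>\<alpha>\<in>{1..n}. c \<alpha> \<noteq> 0) \<and> (\<forall>i\<in>{1..2*k}. (\<Sum>\<alpha>=1..n. c \<alpha> * z i \<alpha>) = 0)"
proof -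
  \<comment> \<open>The unknowns are the coefficients of the rows (\<open>Inl\<close>) and of their images under \<open>J\<close> (\<open>Inr\<close>).\<close>
  define a where "a i j = (case j of Inl \<alpha> \<Rightarrow> z i \<alpha> | Inr \<alpha> \<Rightarrow> if odd i then z (i + 1) \<alpha> else - z (i - 1) \<alpha>)"
    for i and j :: "nat + nat"
  let ?S = "{1..n} <+> {1..n}"
  have "card {1..2*k} < card ?S" using kn by (simp add: card_Plus)
  from underdetermined_system[OF _ _ this, of a] obtain x where
    x: "\<exists>j\<in>?S. x j \<noteq> 0" "\<forall>i\<in>{1..2*k}. (\<Sum>j\<in>?S. a i j * x j) = 0" by auto
  define u where "u i = (\<Sum>\<alpha>=1..n. x (Inl \<alpha>) * z i \<alpha>)" for i
  define w where "w i = (\<Sum>\<alpha>=1..n. x (Inr \<alpha>) * z i \<alpha>)" for i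
  have "(\<Sum>j\<in>?S. a i j * x j) = u i + (if odd i then w (i + 1) else - w (i - 1))" for i
    by (simp add: sum.Plus a_def u_def w_def algebra_simps sum_negf)
  with x(2) have uw: "u i + (if odd i then w (i + 1) else - w (i - 1)) = 0" if "i \<in> {1..2*k}" for i
    using that by metis
  have uw': "w (2*l) = - u (2*l - 1)" "w (2*l - 1) = u (2*l)" if "l \<in> {1..k}" for l
  proof -
    have l: "2*l \<in> {1..2*k}" "2*l - 1 \<in> {1..2*k}" "odd (2*l - 1)" "2*l - 1 + 1 = 2*l"
      using that by auto
    show "w (2*l) = - u (2*l - 1)" using uw[OF l(2)] l(3) by (simp only: l(4)) simp
    show "w (2*l - 1) = u (2*l)" using uw[OF l(1)] by simp
  qed
  have "0 = (\<Sum>\<gamma>=1..n. \<Sum>\<delta>=1..n. x (Inl \<gamma>) * x (Inr \<delta>) * moment k \<gamma> \<delta> z)"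
    by (simp add: zero_fibre_moment[OF z])
  also have "\<dots> = (\<Sum>l=1..k. u (2*l - 1) * w (2*l) - w (2*l - 1) * u (2*l))"
    unfolding moment_sum u_def w_def ..
  also have "\<dots> = (\<Sum>l=1..k. - (u (2*l - 1) * u (2*l - 1) + u (2*l) * u (2*l)))"
    by (rule sum.cong) (auto simp: uw')
  also have "\<dots> = - (\<Sum>i=1..2*k. u i * u i)"
    unfolding sum_conjugate_pairs sum_negf ..
  finally have "(\<Sum>i=1..2*k. u i * u i) = 0" by simp
  then have "\<forall>i\<in>{1..2*k}. u i = 0"
    by (subst (asm) sum_nonneg_eq_0_iff) auto
  moreover from this have "w i = 0" if "i \<in> {1..2*k}" for i
  proof -
    have "\<exists>l\<in>{1..k}. i = 2*l \<or> i = 2*l - 1"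
      using that by (intro bexI[of _ "(i + 1) div 2"]) auto
    with uw' \<open>\<forall>i\<in>{1..2*k}. u i = 0\<close> show ?thesis by fastforce
  qed
  moreover have "(\<exists>\<alpha>\<in>{1..n}. x (Inl \<alpha>) \<noteq> 0) \<or> (\<exists>\<alpha>\<in>{1..n}. x (Inr \<alpha>) \<noteq> 0)" using x(1) by auto
  ultimately show ?thesis
    by (elim disjE)
      (rule exI[of _ "\<lambda>\<alpha>. x (Inl \<alpha>)"] exI[of _ "\<lambda>\<alpha>. x (Inr \<alpha>)"], simp add: u_def w_def)+
qed

text \<open>A reflection turns the dependence between the rows into the vanishing of the last row.\<close>

lemma zero_fibre_reduce:
  assumes z: "z \<in> zero_fibre k (Suc n)" and kn: "k \<le> n"
  shows "\<exists>z'\<in>zero_fibre k n. gram n z' = gram (Suc n) z"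
proof -
  let ?N = "Suc n"
  have N: "?N \<in> {1..?N}" by simp
  obtain c where c: "\<exists>\<alpha>\<in>{1..?N}. c \<alpha> \<noteq> 0" "\<And>i. i \<in> {1..2*k} \<Longrightarrow> (\<Sum>\<alpha>=1..?N. c \<alpha> * z i \<alpha>) = 0"
    using zero_fibre_rows_dependent[OF z] kn by (metis le_imp_less_Suc)
  define r where "r = sqrt (\<Sum>\<alpha>=1..?N. c \<alpha> * c \<alpha>)"
  have "0 < (\<Sum>\<alpha>=1..?N. c \<alpha> * c \<alpha>)"
    using c(1) by (metis (no_types, lifting) finite_atLeastAtMost mult_eq_0_iff order_le_less
        sum_nonneg sum_nonneg_eq_0_iff zero_le_square)
  then have r: "r > 0" "r * r = (\<Sum>\<alpha>=1..?N. c \<alpha> * c \<alpha>)" by (auto simp: r_def)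
  \<comment> \<open>The reflection along \<open>b\<close> exchanges \<open>c\<close> with \<open>r\<close> times the last basis vector.\<close>
  define b where "b \<alpha> = c \<alpha> - (if \<alpha> = ?N then r else 0)" for \<alpha>
  have bs: "(\<Sum>\<alpha>=1..?N. b \<alpha> * x \<alpha>) = (\<Sum>\<alpha>=1..?N. c \<alpha> * x \<alpha>) - r * x ?N" for x :: "nat \<Rightarrow> real"
  proof -
    have "(\<Sum>\<alpha>=1..?N. b \<alpha> * x \<alpha>) = (\<Sum>\<alpha>=1..?N. c \<alpha> * x \<alpha> - (if \<alpha> = ?N then r * x \<alpha> else 0))"
      by (rule sum.cong) (auto simp: b_def algebra_simps)
    then show ?thesis by (simp add: sum_subtractf)
  qed
  have bb: "(\<Sum>\<alpha>=1..?N. b \<alpha> * b \<alpha>) = 2 * r * (r - c ?N)"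
  proof -
    have "(\<Sum>\<alpha>=1..?N. c \<alpha> * b \<alpha>) = (\<Sum>\<alpha>=1..?N. b \<alpha> * c \<alpha>)" by (simp add: mult.commute)
    also have "\<dots> = r * r - r * c ?N" unfolding bs r(2) by simp
    finally show ?thesis unfolding bs by (simp add: b_def algebra_simps)
  qed
  define w where "w = act ?N (reflection ?N b) z"
  have wZ: "w \<in> zero_fibre k ?N" unfolding w_def using z by (rule act_zero_fibre)
  have w0: "w i ?N = 0" for i
  proof (cases "i \<in> {1..2*k}")
    case True
    have "w i ?N = z i ?N + 2 * r * z i ?N / (2 * r * (r - c ?N)) * (c ?N - r)"
      unfolding w_def act_reflection[OF N] bb bs by (simp only: c(2)[OF True]) (simp add: b_def)
    also have "\<dots> = 0"
    proof (cases "c ?N = r")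
      \<comment> \<open>Here \<open>c\<close> already points in the last direction, and the reflection is the identity.\<close>
      case cr: True
      have "(\<Sum>\<alpha>=1..?N. b \<alpha> * b \<alpha>) = 0" unfolding bb cr by simp
      then have "\<forall>\<alpha>\<in>{1..?N}. b \<alpha> = 0" by (subst (asm) sum_nonneg_eq_0_iff) auto
      then have "(\<Sum>\<alpha>=1..?N. b \<alpha> * z i \<alpha>) = 0" by simp
      then have "r * z i ?N = 0" unfolding bs using c(2)[OF True] by simp
      then show ?thesis using r(1) by simp
    next
      case False
      then show ?thesis using r(1) by (simp add: field_simps)
    qed
    finally show ?thesis .
  qed (use zero_fibre_phase_space[OF wZ] in \<open>auto simp: phase_space_def\<close>)
  have "w \<in> phase_space k n"
    using zero_fibre_phase_space[OF wZ] w0 by (auto simp: phase_space_def le_Suc_eq)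
  then have "w \<in> zero_fibre k n" using wZ by (simp add: zero_fibre_iff)
  moreover have "gram n w = gram ?N z"
    using gram_phase_space[OF \<open>w \<in> phase_space k n\<close>, of ?N] gram_act[OF reflection_orthogonal]
    by (simp add: w_def fun_eq_iff)
  ultimately show ?thesis by blast
qed

lemma gram_image_zero_fibre:
  "k \<le> n \<Longrightarrow> gram n ` zero_fibre k n = gram k ` zero_fibre k k"
proof (induction n rule: dec_induct)
  case (step n)
  have "gram (Suc n) ` zero_fibre k (Suc n) = gram n ` zero_fibre k n"
  proof (intro equalityI subsetI)
    fix g assume "g \<in> gram (Suc n) ` zero_fibre k (Suc n)"
    then obtain z where "z \<in> zero_fibre k (Suc n)" "g = gram (Suc n) z" by blast
    then show "g \<in> gram n ` zero_fibre k n"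
      using zero_fibre_reduce[of z k n] step.hyps(1) by (metis image_eqI)
  next
    fix g assume "g \<in> gram n ` zero_fibre k n"
    then obtain z where z: "z \<in> zero_fibre k n" "g = gram n z" by blast
    then have "z \<in> zero_fibre k (Suc n)" "g = gram (Suc n) z"
      using zero_fibre_mono[of n "Suc n" k] gram_phase_space[OF zero_fibre_phase_space, of z k n "Suc n"] by auto
    then show "g \<in> gram (Suc n) ` zero_fibre k (Suc n)" by blast
  qed
  with step show ?case by simp
qed simp


section \<open>The symplectic quotient as a space of Gram matrices\<close>

lemma continuous_on_coordinate: "continuous_on UNIV (\<lambda>y::point. y i \<alpha>)"
  by (rule continuous_on_product_then_coordinatewise[OF continuous_on_product_coordinates])

lemma continuous_on_gram: "continuous_on UNIV (gram n)"
  by (rule continuous_on_coordinatewise_then_product)+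
    (simp add: gram_def, intro continuous_intros continuous_on_coordinate)

lemma closed_zero_fibre: "closed (zero_fibre k n)"
proof -
  have eq: "zero_fibre k n = (\<Inter>i. \<Inter>\<alpha>. {z. i \<notin> {1..2*k} \<or> \<alpha> \<notin> {1..n} \<longrightarrow> z i \<alpha> = 0})
      \<inter> (\<Inter>\<alpha>. \<Inter>\<beta>. {z. moment k \<alpha> \<beta> z = 0})"
    by (auto simp: zero_fibre_iff phase_space_def)
  have "continuous_on UNIV (moment k \<alpha> \<beta>)" for \<alpha> \<beta>
    unfolding moment_def[abs_def] q_coord_def p_coord_def
    by (intro continuous_intros continuous_on_coordinate)
  then show ?thesis
    unfolding eq
    by (intro closed_Int closed_INT ballI closed_Collect_imp closed_Collect_eq continuous_on_coordinate
        continuous_on_const open_Collect_const)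
qed

lemma compact_box: "compact {z::point. \<forall>i \<alpha>. z i \<alpha> \<in> {-s..s}}"
proof -
  let ?A = "PiE UNIV (\<lambda>_::nat. {-s..s})" and ?B = "{z::point. \<forall>i \<alpha>. z i \<alpha> \<in> {-s..s}}"
  have "compactin (product_topology (\<lambda>_::nat. euclideanreal) UNIV) ?A"
    unfolding compactin_PiE by simp
  then have "compactin euclidean ?A" by (simp only: euclidean_product_topology)
  then have "compactin (product_topology (\<lambda>_::nat. euclidean) UNIV) (PiE UNIV (\<lambda>_::nat. ?A))"
    unfolding compactin_PiE by blast
  then have "compact (PiE UNIV (\<lambda>_::nat. ?A))" by (simp add: euclidean_product_topology)
  also have "PiE UNIV (\<lambda>_::nat. ?A) = ?B" by (auto simp: PiE_def Pi_def)
  finally show ?thesis .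
qed

text \<open>The Gram map is proper, because its diagonal entries bound the point.\<close>

lemma closed_gram_image:
  assumes C: "closed C" "C \<subseteq> phase_space k n"
  shows "closed (gram n ` C)"
proof -
  have "x \<in> gram n ` C" if x: "x \<in> closure (gram n ` C)" for x
  proof -
    define r where "r = 1 + Max (insert 0 ((\<lambda>i. x i i) ` {1..2*k}))"
    have r: "x i i < r" if "i \<in> {1..2*k}" for i
    proof -
      have "x i i \<le> Max (insert 0 ((\<lambda>i. x i i) ` {1..2*k}))" using that by (intro Max_ge) auto
      then show ?thesis by (simp add: r_def)
    qed
    have r0: "0 < r"
    proof -
      have "0 \<le> Max (insert 0 ((\<lambda>i. x i i) ` {1..2*k}))" by (intro Max_ge) auto
      then show ?thesis unfolding r_def by linarith
    qed
    let ?U = "\<Inter>i\<in>{1..2*k}. {g. g i i < r}"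
    let ?K = "C \<inter> {z. \<forall>i \<alpha>. z i \<alpha> \<in> {- sqrt r..sqrt r}}"
    have "open ?U"
      by (intro open_INT finite_atLeastAtMost ballI open_Collect_less continuous_on_const
          continuous_on_coordinate)
    have "compact ?K" using C(1) compact_box by (rule closed_Int_compact)
    then have "compact (gram n ` ?K)"
      by (rule compact_continuous_image[OF continuous_on_subset[OF continuous_on_gram subset_UNIV]])
    then have "closed (gram n ` ?K)" by (rule compact_imp_closed)
    have "?U \<inter> gram n ` C \<subseteq> gram n ` ?K"
    proof (intro subsetI)
      fix g assume "g \<in> ?U \<inter> gram n ` C"
      then obtain z where z: "z \<in> C" "g = gram n z" and g: "\<And>i. i \<in> {1..2*k} \<Longrightarrow> gram n z i i < r" by auto
      have "z i \<alpha> \<in> {- sqrt r..sqrt r}" for i \<alpha>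
      proof (cases "i \<in> {1..2*k} \<and> \<alpha> \<in> {1..n}")
        case True
        then have "z i \<alpha> * z i \<alpha> \<le> gram n z i i"
          unfolding gram_def by (intro member_le_sum) auto
        also have "\<dots> < r" using True by (intro g) simp
        finally have "\<bar>z i \<alpha>\<bar> \<le> sqrt r"
          by (intro real_le_rsqrt) (simp add: power2_eq_square)
        then show ?thesis by auto
      next
        case False
        then have "z i \<alpha> = 0" using z C(2) by (auto simp: phase_space_def)
        then show ?thesis using r0 by auto
      qed
      then show "g \<in> gram n ` ?K" using z by blast
    qed
    then have "closure (?U \<inter> gram n ` C) \<subseteq> gram n ` ?K"
      using \<open>closed (gram n ` ?K)\<close> by (rule closure_minimal)
    moreover have "x \<in> closure (?U \<inter> gram n ` C)"
      using open_Int_closure_subset[OF \<open>open ?U\<close>, of "gram n ` C"] x r by auto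
    ultimately show ?thesis by blast
  qed
  then have "closure (gram n ` C) \<subseteq> gram n ` C" by blast
  then show ?thesis by (metis closure_subset closure_closed closed_closure subset_antisym)
qed

text \<open>All points of an orbit have the same Gram matrix, so the choice is immaterial.\<close>

definition orbit_gram :: "nat \<Rightarrow> point set \<Rightarrow> nat \<Rightarrow> nat \<Rightarrow> real" where
  "orbit_gram n c = gram n (SOME y. y \<in> c)"

lemma orbit_gram_orbit:
  assumes "z \<in> zero_fibre k n"
  shows "orbit_gram n (orbit n z) = gram n z"
proof -
  have "(SOME y. y \<in> orbit n z) \<in> orbit n z"
    using self_in_orbit[OF zero_fibre_phase_space[OF assms]] by (rule someI[of "\<lambda>y. y \<in> orbit n z"])
  then show ?thesis unfolding orbit_gram_def by (rule gram_orbit)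
qed

lemma homeomorphic_map_orbit_gram:
  "homeomorphic_map (symplectic_quotient k n) (top_of_set (gram n ` zero_fibre k n)) (orbit_gram n)"
proof -
  let ?Z = "zero_fibre k n"
  have cont: "continuous_map (top_of_set ?Z) (top_of_set (gram n ` ?Z)) (gram n)"
    using continuous_on_subset[OF continuous_on_gram subset_UNIV] by auto
  have "quotient_map (top_of_set ?Z) (top_of_set (gram n ` ?Z)) (gram n)"
  proof (rule continuous_closed_imp_quotient_map[OF cont])
    show "closed_map (top_of_set ?Z) (top_of_set (gram n ` ?Z)) (gram n)"
      unfolding closed_map_def
    proof (intro allI impI)
      fix C assume "closedin (top_of_set ?Z) C"
      then have "closed C" "C \<subseteq> ?Z"
        using closedin_closed_eq[OF closed_zero_fibre] by auto
      then have "closed (gram n ` C)"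
        by (intro closed_gram_image[where k = k]) (auto dest: zero_fibre_phase_space)
      then show "closedin (top_of_set (gram n ` ?Z)) (gram n ` C)"
        using \<open>C \<subseteq> ?Z\<close> by (intro closed_subset image_mono)
    qed
  qed simp
  then have "quotient_map (top_of_set ?Z) (top_of_set (gram n ` ?Z)) (orbit_gram n \<circ> orbit n)"
    by (rule quotient_map_eq) (simp add: orbit_gram_orbit)
  moreover from this have "continuous_map (symplectic_quotient k n) (top_of_set (gram n ` ?Z)) (orbit_gram n)"
    using continuous_compose_quotient_map[OF quotient_map_orbit] quotient_imp_continuous_map by blast
  ultimately have "quotient_map (symplectic_quotient k n) (top_of_set (gram n ` ?Z)) (orbit_gram n)"
    using quotient_map_from_composition[OF quotient_imp_continuous_map[OF quotient_map_orbit]] by blast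
  moreover have "inj_on (orbit_gram n) (topspace (symplectic_quotient k n))"
    by (auto simp: inj_on_def orbit_gram_orbit orbit_eq_iff[OF zero_fibre_phase_space zero_fibre_phase_space])
  ultimately show ?thesis by (simp add: homeomorphic_map_def)
qed


section \<open>Stabilization of the symplectic quotients\<close>

lemma regular_functions_gram:
  "f \<in> regular_functions k n \<longleftrightarrow> (\<exists>P\<in>gram_polys k. f = induced k n (\<lambda>y. P (gram n y)))"
  using fft[of _ k n] gram_polys_invariant[of _ k n] by (fastforce simp: regular_functions_def)

lemma regular_of_degree_gram:
  "f \<in> regular_of_degree k n d \<longleftrightarrow>
    (\<exists>P\<in>gram_polys k. (\<forall>m. homogeneous k m d (\<lambda>y. P (gram m y))) \<and> f = induced k n (\<lambda>y. P (gram n y)))"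
proof
  assume "f \<in> regular_of_degree k n d"
  then obtain F where "F \<in> invariant_polys k n" "homogeneous k n d F" "f = induced k n F"
    by (auto simp: regular_of_degree_def)
  with fft_graded[of F k n d] show "\<exists>P\<in>gram_polys k. (\<forall>m. homogeneous k m d (\<lambda>y. P (gram m y)))
      \<and> f = induced k n (\<lambda>y. P (gram n y))" by blast
next
  assume "\<exists>P\<in>gram_polys k. (\<forall>m. homogeneous k m d (\<lambda>y. P (gram m y)))
      \<and> f = induced k n (\<lambda>y. P (gram n y))"
  then show "f \<in> regular_of_degree k n d"
    using gram_polys_invariant[of _ k n] by (auto simp: regular_of_degree_def)
qed

lemma regular_functions_extensional:
  "f \<in> regular_functions k n \<Longrightarrow> f \<in> extensional (topspace (symplectic_quotient k n))"
  by (auto simp: regular_functions_def induced_def)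

text \<open>Both quotients are homeomorphic to the same set of Gram matrices. Under this identification
  their regular functions are, by \<open>fft\<close>, the restrictions of the same polynomials in the entries,
  and by \<open>poisson_gram_polys\<close> the brackets are given by the same formula.\<close>

theorem gram_equivalence_symplectomorphism:
  assumes eq: "gram n ` zero_fibre k n = gram m ` zero_fibre k m"
  shows "graded_regularly_symplectomorphic k n k m"
proof -
  let ?M = "symplectic_quotient k n" and ?M' = "symplectic_quotient k m"
  let ?X = "top_of_set (gram m ` zero_fibre k m)"
  have hn: "homeomorphic_map ?M ?X (orbit_gram n)"
    using homeomorphic_map_orbit_gram[of k n] by (simp only: eq)
  obtain g where g: "homeomorphic_maps ?M' ?X (orbit_gram m) g"
    using homeomorphic_map_orbit_gram[of k m] by (auto simp: homeomorphic_map_maps)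
  then have "homeomorphic_map ?X ?M' g" using homeomorphic_maps_map by blast
  define h where "h = g \<circ> orbit_gram n"
  have h: "homeomorphic_map ?M ?M' h"
    unfolding h_def using hn \<open>homeomorphic_map ?X ?M' g\<close> by (rule homeomorphic_map_compose)
  have hM: "h ` topspace ?M = topspace ?M'"
    using h by (rule homeomorphic_imp_surjective_map)
  have h_orbit: "\<exists>z'\<in>zero_fibre k m. h (orbit n z) = orbit m z' \<and> gram m z' = gram n z"
    if z: "z \<in> zero_fibre k n" for z
  proof -
    from z eq obtain z' where z': "z' \<in> zero_fibre k m" "gram m z' = gram n z" by (metis imageE image_eqI)
    have "h (orbit n z) = g (orbit_gram m (orbit m z'))"
      using z z' by (simp add: h_def orbit_gram_orbit)
    also have "\<dots> = orbit m z'" using g z' by (simp add: homeomorphic_maps_def)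
    finally show ?thesis using z' by blast
  qed
  define \<phi> where "\<phi> f = compose (topspace ?M) f h" for f :: "point set \<Rightarrow> real"
  have pull: "\<phi> (induced k m F') = induced k n F"
    if F: "F \<in> invariant_polys k n" "F' \<in> invariant_polys k m"
      and FF': "\<And>z z'. gram m z' = gram n z \<Longrightarrow> F' z' = F z" for F F'
  proof (rule extensionalityI[where A = "topspace ?M"])
    show "\<phi> (induced k m F') \<in> extensional (topspace ?M)" by (simp add: \<phi>_def)
    show "induced k n F \<in> extensional (topspace ?M)" by (simp add: induced_def)
    fix c assume c: "c \<in> topspace ?M"
    then obtain z where z: "z \<in> zero_fibre k n" "c = orbit n z" by auto
    obtain z' where z': "z' \<in> zero_fibre k m" "h c = orbit m z'" "gram m z' = gram n z"
      using h_orbit[OF z(1)] z(2) by blast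
    have "\<phi> (induced k m F') c = F' z'"
      using c z' F(2) by (simp add: \<phi>_def compose_def induced_apply)
    also have "\<dots> = induced k n F c" using F(1) FF'[OF z'(3)] z by (simp add: induced_apply)
    finally show "\<phi> (induced k m F') c = induced k n F c" .
  qed
  have gpull: "\<phi> (induced k m (\<lambda>y. P (gram m y))) = induced k n (\<lambda>y. P (gram n y))"
    if "P \<in> gram_polys k" for P
    using that by (intro pull gram_polys_invariant) auto
  have "graded_poisson_iso k m k n \<phi>"
    unfolding graded_poisson_iso_def Let_def
  proof (intro conjI ballI allI)
    show "bij_betw \<phi> (regular_functions k m) (regular_functions k n)"
      unfolding bij_betw_def
    proof
      show "inj_on \<phi> (regular_functions k m)"
      proof (rule inj_onI)
        fix f f' assume f: "f \<in> regular_functions k m" "f' \<in> regular_functions k m" and e: "\<phi> f = \<phi> f'"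
        show "f = f'"
        proof (rule extensionalityI[OF f[THEN regular_functions_extensional]])
          fix c assume "c \<in> topspace ?M'"
          then obtain b where "b \<in> topspace ?M" "c = h b" using hM by blast
          then show "f c = f' c" using fun_cong[OF e, of b] by (simp add: \<phi>_def compose_def)
        qed
      qed
      show "\<phi> ` regular_functions k m = regular_functions k n"
        by (force simp: regular_functions_gram image_iff gpull)
    qed
    show "\<phi> ` regular_of_degree k m d = regular_of_degree k n d" for d
      by (force simp: regular_of_degree_gram image_iff gpull)
    have hM': "h c \<in> orbit m ` zero_fibre k m" if "c \<in> orbit n ` zero_fibre k n" for c
      using hM that by auto
    show "\<phi> (\<lambda>c\<in>topspace ?M'. f c + g c) = (\<lambda>c\<in>topspace ?M. \<phi> f c + \<phi> g c)" for f g
      by (auto simp: \<phi>_def compose_def hM')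
    show "\<phi> (\<lambda>c\<in>topspace ?M'. f c * g c) = (\<lambda>c\<in>topspace ?M. \<phi> f c * \<phi> g c)" for f g
      by (auto simp: \<phi>_def compose_def hM')
    show "\<phi> (\<lambda>c\<in>topspace ?M'. a) = (\<lambda>c\<in>topspace ?M. a)" for a
      by (auto simp: \<phi>_def compose_def hM')
    fix f g assume "f \<in> regular_functions k m" "g \<in> regular_functions k m"
    then obtain P Q where P: "P \<in> gram_polys k" "f = induced k m (\<lambda>y. P (gram m y))"
      and Q: "Q \<in> gram_polys k" "g = induced k m (\<lambda>y. Q (gram m y))"
      by (auto simp: regular_functions_gram)
    obtain R where R: "\<forall>n y. poisson k n (\<lambda>y. P (gram n y)) (\<lambda>y. Q (gram n y)) y = R (gram n y)"
      using poisson_gram_polys[OF P(1) Q(1)] by blast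
    show "\<phi> (quotient_poisson k m f g) = quotient_poisson k n (\<phi> f) (\<phi> g)"
      unfolding P(2) Q(2) gpull[OF P(1)] gpull[OF Q(1)]
        quotient_poisson_induced[OF gram_polys_invariant[OF P(1)] gram_polys_invariant[OF Q(1)]]
      by (intro pull poisson_invariant gram_polys_invariant P Q) (simp add: R)
  qed
  then show ?thesis
    unfolding graded_regularly_symplectomorphic_def using h by (auto simp: \<phi>_def[abs_def])
qed


section \<open>Invariance of dimension\<close>

text \<open>Padded with zeros, such a map would be an injective continuous map of \<open>U\<close> to a proper
  coordinate subspace of \<open>\<real>\<^sup>D\<close>. By invariance of domain its image would be open.\<close>

lemma no_injection_to_fewer_coordinates:
  fixes f :: "(nat \<Rightarrow> real) \<Rightarrow> 'b \<Rightarrow> real"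
  assumes U: "openin (Euclidean_space D) U" "U \<noteq> {}"
    and B: "finite B" "card B < D"
    and cont: "\<And>b. b \<in> B \<Longrightarrow> continuous_on U (\<lambda>u. f u b)"
    and inj: "\<And>u v. u \<in> U \<Longrightarrow> v \<in> U \<Longrightarrow> (\<And>b. b \<in> B \<Longrightarrow> f u b = f v b) \<Longrightarrow> u = v"
  shows False
proof -
  obtain e where e: "bij_betw e {0..<card B} B"
    using ex_bij_betw_nat_finite[OF B(1)] by blast
  define g where "g u i = (if i < card B then f u (e i) else 0)" for u i
  have UE: "U \<subseteq> topspace (Euclidean_space D)" using U(1) by (rule openin_subset)
  have "continuous_on U (\<lambda>u. g u i)" for i
    using cont[of "e i"] bij_betw_apply[OF e, of i] by (cases "i < card B") (auto simp: g_def)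
  then have "continuous_on U g" by (rule continuous_on_coordinatewise_then_product)
  then have "continuous_map (subtopology (Euclidean_space D) U) (Euclidean_space D) g"
    using UE B(2)
    by (auto simp: cm_Euclidean_space_iff_continuous_on Int_absorb1 topspace_Euclidean_space g_def)
  moreover have "inj_on g U"
  proof (rule inj_onI, rule inj)
    fix u v b assume uv: "g u = g v" and "b \<in> B"
    then obtain i where i: "i < card B" "b = e i"
      using bij_betw_imp_surj_on[OF e] by (metis atLeastLessThan_iff imageE)
    from uv have "g u i = g v i" by simp
    then show "f u b = f v b" using i by (simp add: g_def)
  qed
  ultimately have "openin (Euclidean_space D) (g ` U)"
    using U(1) by (intro invariance_of_domain_Euclidean_space)
  then obtain T where T: "open T" "g ` U = T \<inter> {x. \<forall>i\<ge>D. x i = 0}"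
    unfolding Euclidean_space_def openin_subtopology euclidean_product_topology by auto
  obtain u where u: "u \<in> U" using U(2) by blast
  let ?c = "\<lambda>t::real. (g u)(card B := t)"
  have "continuous_on UNIV (\<lambda>t. ?c t i)" for i by (cases "i = card B") (auto intro: continuous_intros)
  then have "continuous_on UNIV ?c" by (rule continuous_on_coordinatewise_then_product)
  then have o: "open (?c -` T)" using T(1) by (simp add: open_vimage)
  have "?c 0 = g u" by (auto simp: g_def)
  moreover have "g u \<in> T" using T(2) u by blast
  ultimately have z: "0 \<in> ?c -` T" by (simp only: vimage_eq)
  from o z obtain \<epsilon> where \<epsilon>: "\<epsilon> > 0" "ball 0 \<epsilon> \<subseteq> ?c -` T" by (rule openE)
  have "\<epsilon> / 2 \<in> ball 0 \<epsilon>" using \<epsilon>(1) by simp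
  then have "?c (\<epsilon> / 2) \<in> T" using \<epsilon>(2) by blast
  moreover have "\<forall>i\<ge>D. ?c (\<epsilon> / 2) i = 0" using B(2) by (auto simp: g_def)
  ultimately have "?c (\<epsilon> / 2) \<in> g ` U" using T(2) by blast
  then obtain w where "?c (\<epsilon> / 2) = g w" by blast
  from fun_cong[OF this, of "card B"] show False using \<epsilon>(1) by (simp add: g_def)
qed


section \<open>Coordinates on the strata\<close>

text \<open>The index of the conjugate coordinate, \<open>p\<^sub>l\<close> for \<open>q\<^sub>l\<close> and \<open>q\<^sub>l\<close> for \<open>p\<^sub>l\<close>.\<close>

definition conj_ix :: "nat \<Rightarrow> nat" where
  "conj_ix i = (if odd i then i + 1 else i - 1)"

definition conj_sign :: "nat \<Rightarrow> real" where
  "conj_sign i = (if odd i then 1 else - 1)"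

lemma conj_ix_conj_ix: "i \<in> {1..2*k} \<Longrightarrow> conj_ix (conj_ix i) = i"
  by (auto simp: conj_ix_def)

lemma conj_ix_range: "i \<in> {1..2*k} \<Longrightarrow> conj_ix i \<in> {1..2*k}"
proof -
  assume i: "i \<in> {1..2*k}"
  show ?thesis
  proof (cases "odd i")
    case True
    then have "i \<noteq> 2 * k" by auto
    with i True show ?thesis by (auto simp: conj_ix_def)
  next
    case False
    then have "i \<noteq> 1" by auto
    with i False show ?thesis by (auto simp: conj_ix_def)
  qed
qed

lemma conj_sign_conj_ix: "i \<in> {1..2*k} \<Longrightarrow> conj_sign (conj_ix i) = - conj_sign i"
  by (auto simp: conj_ix_def conj_sign_def)

lemma inj_on_conj_ix: "inj_on conj_ix {1..2*k}"
  by (metis conj_ix_conj_ix inj_onI)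

lemma sum_conj_sign:
  "(\<Sum>i=1..2*k. conj_sign i * a i * b (conj_ix i))
    = (\<Sum>l=1..k. a (2*l - 1) * b (2*l) - a (2*l) * b (2*l - 1))"
  unfolding sum_conjugate_pairs by (rule sum.cong) (auto simp: conj_sign_def conj_ix_def)

definition nonsing :: "nat set \<Rightarrow> (nat \<Rightarrow> nat \<Rightarrow> real) \<Rightarrow> bool" where
  "nonsing I g \<longleftrightarrow> (\<forall>d. (\<forall>b\<in>I. (\<Sum>a\<in>I. d a * g a b) = 0) \<longrightarrow> (\<forall>a\<in>I. d a = 0))"

text \<open>The index sets of isotropic coordinate subspaces of \<open>\<real>\<^sup>2\<^sup>k\<close>.\<close>

definition polarized :: "nat \<Rightarrow> nat set \<Rightarrow> bool" where
  "polarized k I \<longleftrightarrow> I \<subseteq> {1..2*k} \<and> (\<forall>a\<in>I. conj_ix a \<notin> I)"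

lemma polarized_finite: "polarized k I \<Longrightarrow> finite I"
  unfolding polarized_def using finite_subset by blast

lemma polarized_card: "polarized k I \<Longrightarrow> card I \<le> k"
proof -
  assume I: "polarized k I"
  have inj: "inj_on conj_ix I" using I inj_on_conj_ix inj_on_subset unfolding polarized_def by blast
  have "I \<inter> conj_ix ` I = {}" using I by (auto simp: polarized_def)
  then have "card (I \<union> conj_ix ` I) = 2 * card I"
    using polarized_finite[OF I] inj by (simp add: card_Un_disjoint card_image)
  moreover have "I \<union> conj_ix ` I \<subseteq> {1..2*k}" using I conj_ix_range[of _ k] unfolding polarized_def by blast
  then have "card (I \<union> conj_ix ` I) \<le> 2 * k" using card_mono[of "{1..2*k}"] by fastforce
  ultimately show ?thesis by simp
qed

lemma sum_gram_comb:
  "(\<Sum>a\<in>I. d a * gram m z a b) = (\<Sum>\<alpha>=1..m. (\<Sum>a\<in>I. d a * z a \<alpha>) * z b \<alpha>)"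
proof -
  have "(\<Sum>a\<in>I. d a * gram m z a b) = (\<Sum>a\<in>I. \<Sum>\<alpha>=1..m. d a * z a \<alpha> * z b \<alpha>)"
    by (simp add: gram_def sum_distrib_left mult.assoc)
  also have "\<dots> = (\<Sum>\<alpha>=1..m. \<Sum>a\<in>I. d a * z a \<alpha> * z b \<alpha>)" by (rule sum.swap)
  finally show ?thesis by (simp add: sum_distrib_right)
qed

text \<open>A combination orthogonal to its own constituents vanishes, so a relation between rows of the
  Gram matrix is a relation between the vectors.\<close>

lemma gram_kernel:
  assumes "\<And>b. b \<in> I \<Longrightarrow> (\<Sum>a\<in>I. d a * gram m z a b) = 0" "\<alpha> \<in> {1..m}"
  shows "(\<Sum>a\<in>I. d a * z a \<alpha>) = 0"
proof -
  define v where "v \<alpha> = (\<Sum>a\<in>I. d a * z a \<alpha>)" for \<alpha>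
  have "(\<Sum>\<alpha>=1..m. v \<alpha> * v \<alpha>) = (\<Sum>\<alpha>=1..m. \<Sum>b\<in>I. d b * (v \<alpha> * z b \<alpha>))"
    by (intro sum.cong refl) (simp add: v_def[of "_::nat"] sum_distrib_left mult.left_commute)
  also have "\<dots> = (\<Sum>b\<in>I. \<Sum>\<alpha>=1..m. d b * (v \<alpha> * z b \<alpha>))" by (rule sum.swap)
  also have "\<dots> = (\<Sum>b\<in>I. d b * (\<Sum>a\<in>I. d a * gram m z a b))"
    by (simp add: sum_gram_comb v_def sum_distrib_left)
  also have "\<dots> = 0" using assms(1) by simp
  finally have "\<forall>\<alpha>\<in>{1..m}. v \<alpha> = 0" by (subst (asm) sum_nonneg_eq_0_iff) auto
  then show ?thesis using assms(2) by (simp add: v_def)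
qed

lemma nonsing_card:
  assumes I: "finite I" and ns: "nonsing I (gram m z)"
  shows "card I \<le> m"
proof (rule ccontr)
  assume "\<not> card I \<le> m"
  then have "card {1..m} < card I" by simp
  from underdetermined_system[OF _ I this, of "\<lambda>\<alpha> a. z a \<alpha>"] obtain d where
    d: "\<exists>a\<in>I. d a \<noteq> 0" "\<forall>\<alpha>\<in>{1..m}. (\<Sum>a\<in>I. z a \<alpha> * d a) = 0" by auto
  have "(\<Sum>a\<in>I. d a * gram m z a b) = 0" for b
    unfolding sum_gram_comb using d(2) by (intro sum.neutral) (simp add: mult.commute)
  with ns d(1) show False by (auto simp: nonsing_def)
qed

text \<open>The right hand side becomes the column of an additional unknown \<open>None\<close>. Nonsingularity prevents
  this unknown from vanishing in a nontrivial solution.\<close>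

lemma nonsing_solve:
  assumes I: "finite I" and ns: "nonsing I g" and sym: "\<And>a b. g a b = g b a"
  shows "\<exists>c. \<forall>b\<in>I. (\<Sum>a\<in>I. c a * g a b) = y b"
proof -
  let ?S = "insert None (Some ` I)"
  define a where "a b j = (case j of None \<Rightarrow> - y b | Some i \<Rightarrow> g i b)" for b and j :: "nat option"
  have "card I < card ?S" using I by (subst card_insert_disjoint) (auto simp: card_image)
  from underdetermined_system[OF I _ this, of a] I obtain x where
    x: "\<exists>j\<in>?S. x j \<noteq> 0" "\<forall>b\<in>I. (\<Sum>j\<in>?S. a b j * x j) = 0" by auto
  have eq: "(\<Sum>i\<in>I. x (Some i) * g i b) = y b * x None" if "b \<in> I" for b
  proof -
    have "(\<Sum>j\<in>?S. a b j * x j) = - y b * x None + (\<Sum>i\<in>I. g i b * x (Some i))"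
      using I by (subst sum.insert) (auto simp: a_def sum.reindex)
    then show ?thesis using x(2) that by (simp add: mult.commute)
  qed
  have n0: "x None \<noteq> 0"
  proof
    assume 0: "x None = 0"
    then have "\<forall>b\<in>I. (\<Sum>i\<in>I. x (Some i) * g i b) = 0" using eq by simp
    then have "\<forall>i\<in>I. x (Some i) = 0"
      using ns[unfolded nonsing_def, rule_format, of "\<lambda>i. x (Some i)"] by blast
    with 0 x(1) show False by auto
  qed
  have "(\<Sum>i\<in>I. x (Some i) / x None * g i b) = y b" if "b \<in> I" for b
    using eq[OF that] n0 by (simp add: sum_divide_distrib[symmetric])
  then show ?thesis by (intro exI[of _ "\<lambda>i. x (Some i) / x None"]) blast
qed

text \<open>Let \<open>C\<close> be an inverse of the submatrix of \<open>g\<close>. If the entries of \<open>1 - g' C\<close> are small, all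
  entries of a kernel vector of \<open>g'\<close> would be smaller than the largest of them.\<close>

lemma nonsing_open:
  assumes I: "finite I" and ns: "nonsing I g" and sym: "\<And>a b. g a b = g b a"
  shows "\<exists>W. open W \<and> g \<in> W \<and> (\<forall>g'\<in>W. nonsing I g')"
proof -
  have "\<forall>b. \<exists>c. \<forall>a\<in>I. (\<Sum>e\<in>I. c e * g e a) = (if a = b then 1 else 0)"
  proof
    fix b show "\<exists>c. \<forall>a\<in>I. (\<Sum>e\<in>I. c e * g e a) = (if a = b then 1 else 0)"
      using nonsing_solve[OF I ns sym, of "\<lambda>a. if a = b then 1 else 0"] .
  qed
  then obtain C where C: "\<And>b a. a \<in> I \<Longrightarrow> (\<Sum>e\<in>I. C b e * g e a) = (if a = b then 1 else 0)"
    by metis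
  define r where "r = real (card I) + 1"
  have r: "r > 0" by (simp add: r_def)
  define E where "E g' a b = (if a = b then 1 else 0) - (\<Sum>e\<in>I. g' a e * C b e)"
    for g' :: "nat \<Rightarrow> nat \<Rightarrow> real" and a b
  let ?W = "\<Inter>a\<in>I. \<Inter>b\<in>I. {g'. \<bar>E g' a b\<bar> < 1 / r}"
  have "open ?W"
    unfolding E_def
    by (intro open_INT I ballI open_Collect_less continuous_intros continuous_on_coordinate)
  moreover have "E g a b = 0" if "a \<in> I" for a b
    using C[OF that, of b] by (simp add: E_def sym[of a] mult.commute)
  then have "g \<in> ?W" using r by simp
  moreover have "nonsing I g'" if W: "g' \<in> ?W" for g'
    unfolding nonsing_def
  proof (intro allI impI ballI)
    fix d a assume 0: "\<forall>b\<in>I. (\<Sum>a\<in>I. d a * g' a b) = 0" and a: "a \<in> I"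
    define M where "M = Max ((\<lambda>a. \<bar>d a\<bar>) ` I)"
    have "M \<in> (\<lambda>a. \<bar>d a\<bar>) ` I" unfolding M_def using I a by (intro Max_in) auto
    then obtain b where b: "b \<in> I" "M = \<bar>d b\<bar>" by blast
    have M: "\<bar>d a\<bar> \<le> M" if "a \<in> I" for a unfolding M_def using I that by (intro Max_ge) auto
    have "(\<Sum>a\<in>I. d a * (\<Sum>e\<in>I. g' a e * C b e)) = (\<Sum>a\<in>I. \<Sum>e\<in>I. C b e * (d a * g' a e))"
      by (simp add: sum_distrib_left algebra_simps)
    also have "\<dots> = (\<Sum>e\<in>I. \<Sum>a\<in>I. C b e * (d a * g' a e))" by (rule sum.swap)
    also have "\<dots> = (\<Sum>e\<in>I. C b e * (\<Sum>a\<in>I. d a * g' a e))" by (simp add: sum_distrib_left)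
    also have "\<dots> = 0" using 0 by simp
    finally have "(\<Sum>a\<in>I. d a * E g' a b) = (\<Sum>a\<in>I. if a = b then d a else 0)"
      by (simp add: E_def algebra_simps sum_subtractf) (auto intro!: sum.cong)
    also have "\<dots> = d b" using I b by simp
    finally have "M = \<bar>\<Sum>a\<in>I. d a * E g' a b\<bar>" using b by simp
    also have "\<dots> \<le> (\<Sum>a\<in>I. \<bar>d a * E g' a b\<bar>)" by (rule sum_abs)
    also have "\<dots> \<le> (\<Sum>a\<in>I. M * (1 / r))"
    proof (rule sum_mono)
      fix a assume "a \<in> I"
      then have "\<bar>E g' a b\<bar> \<le> 1 / r" using W b by fastforce
      then show "\<bar>d a * E g' a b\<bar> \<le> M * (1 / r)"
        unfolding abs_mult using M[OF \<open>a \<in> I\<close>] by (intro mult_mono) auto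
    qed
    also have "\<dots> = M * (r - 1) / r" by (simp add: r_def)
    finally have "M * r \<le> M * (r - 1)" using r by (simp add: field_simps)
    then have "M \<le> 0" by (simp add: algebra_simps)
    then show "d a = 0" using M[OF a] by simp
  qed
  ultimately show ?thesis by (intro exI[of _ ?W]) auto
qed

text \<open>A vector outside the set whose conjugate index also lies outside is in the span by maximality. For
  the conjugates of members of the set, take the part \<open>x\<close> of such a vector orthogonal to the
  span. Pairing the equation \<open>\<Sum> q\<^sub>l \<and> p\<^sub>l = 0\<close> with \<open>x\<close> leaves a relation between the
  members of the set, with the products of \<open>x\<close> with their conjugates as coefficients. So \<open>x\<close>
  is orthogonal to the conjugates, too, and vanishes.\<close>

lemma maximal_polarized_spanning:
  assumes z: "z \<in> zero_fibre k m" and I: "polarized k I" and ns: "nonsing I (gram m z)"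
    and max: "\<And>j. j \<in> {1..2*k} \<Longrightarrow> j \<notin> I \<Longrightarrow> conj_ix j \<notin> I \<Longrightarrow> \<not> nonsing (insert j I) (gram m z)"
    and i: "i \<in> {1..2*k}"
  shows "\<exists>c. \<forall>\<alpha>\<in>{1..m}. z i \<alpha> = (\<Sum>a\<in>I. c a * z a \<alpha>)"
proof -
  let ?g = "gram m z"
  have fI: "finite I" using I by (rule polarized_finite)
  have sub: "I \<subseteq> {1..2*k}" using I by (simp add: polarized_def)
  have outer: "\<exists>c. \<forall>\<alpha>\<in>{1..m}. z j \<alpha> = (\<Sum>a\<in>I. c a * z a \<alpha>)"
    if j: "j \<in> {1..2*k}" "j \<notin> I" "conj_ix j \<notin> I" for j
  proof -
    obtain d where d: "\<And>b. b \<in> insert j I \<Longrightarrow> (\<Sum>a\<in>insert j I. d a * ?g a b) = 0"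
        "\<exists>a\<in>insert j I. d a \<noteq> 0"
      using max[OF j] unfolding nonsing_def by blast
    have rel: "d j * z j \<alpha> + (\<Sum>a\<in>I. d a * z a \<alpha>) = 0" if "\<alpha> \<in> {1..m}" for \<alpha>
      using gram_kernel[OF d(1) that] fI j by simp
    have "d j \<noteq> 0"
    proof
      assume "d j = 0"
      then have "\<forall>b\<in>I. (\<Sum>a\<in>I. d a * ?g a b) = 0" using d(1) fI j by simp
      then have "\<forall>a\<in>I. d a = 0" using ns by (simp add: nonsing_def)
      with d(2) \<open>d j = 0\<close> show False by blast
    qed
    then have "z j \<alpha> = (\<Sum>a\<in>I. (- d a / d j) * z a \<alpha>)" if "\<alpha> \<in> {1..m}" for \<alpha>
      using rel[OF that] by (simp add: sum_divide_distrib[symmetric] sum_negf field_simps)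
    then show ?thesis by (intro exI[of _ "\<lambda>a. - d a / d j"]) blast
  qed
  obtain c where c: "\<And>b. b \<in> I \<Longrightarrow> (\<Sum>a\<in>I. c a * ?g a b) = ?g i b"
    using nonsing_solve[OF fI ns gram_commute, of "\<lambda>b. ?g i b"] by blast
  define x where "x \<alpha> = z i \<alpha> - (\<Sum>a\<in>I. c a * z a \<alpha>)" for \<alpha>
  define p where "p j = (\<Sum>\<alpha>=1..m. x \<alpha> * z j \<alpha>)" for j
  have pI: "p b = 0" if "b \<in> I" for b
  proof -
    have "p b = ?g i b - (\<Sum>a\<in>I. c a * ?g a b)"
      unfolding sum_gram_comb unfolding gram_def p_def x_def sum_subtractf[symmetric]
      by (rule sum.cong) (auto simp: algebra_simps)
    then show ?thesis using c[OF that] by simp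
  qed
  have p_span: "p j = 0" if "\<And>\<alpha>. \<alpha> \<in> {1..m} \<Longrightarrow> z j \<alpha> = (\<Sum>a\<in>I. e a * z a \<alpha>)" for e j
  proof -
    have "p j = (\<Sum>\<alpha>=1..m. \<Sum>a\<in>I. e a * (x \<alpha> * z a \<alpha>))"
      unfolding p_def by (rule sum.cong) (auto simp: that sum_distrib_left algebra_simps)
    also have "\<dots> = (\<Sum>a\<in>I. \<Sum>\<alpha>=1..m. e a * (x \<alpha> * z a \<alpha>))" by (rule sum.swap)
    also have "\<dots> = (\<Sum>a\<in>I. e a * p a)" by (simp add: p_def sum_distrib_left)
    finally show ?thesis using pI by simp
  qed
  have p_outer: "p j = 0" if "j \<in> {1..2*k}" "conj_ix j \<notin> I" for j
    using pI outer[OF that(1) _ that(2)] p_span by (cases "j \<in> I") blast+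
  have rel: "(\<Sum>a\<in>I. (conj_sign (conj_ix a) * p (conj_ix a)) * z a \<beta>) = 0" if "\<beta> \<in> {1..m}" for \<beta>
  proof -
    have "0 = (\<Sum>\<gamma>=1..m. \<Sum>\<delta>\<in>{\<beta>}. x \<gamma> * 1 * moment k \<gamma> \<delta> z)"
      by (simp add: zero_fibre_moment[OF z])
    also have "\<dots> = (\<Sum>l=1..k. p (2*l - 1) * z (2*l) \<beta> - z (2*l - 1) \<beta> * p (2*l))"
      unfolding moment_sum p_def by simp
    also have "\<dots> = (\<Sum>j=1..2*k. conj_sign j * p j * z (conj_ix j) \<beta>)"
      unfolding sum_conj_sign[of p "\<lambda>j. z j \<beta>"] by (simp only: mult.commute)
    also have "\<dots> = (\<Sum>j\<in>conj_ix ` I. conj_sign j * p j * z (conj_ix j) \<beta>)"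
    proof (rule sum.mono_neutral_right)
      show "conj_ix ` I \<subseteq> {1..2*k}" using sub conj_ix_range by blast
      show "\<forall>j\<in>{1..2*k} - conj_ix ` I. conj_sign j * p j * z (conj_ix j) \<beta> = 0"
      proof
        fix j assume j: "j \<in> {1..2*k} - conj_ix ` I"
        then have "conj_ix j \<notin> I" using conj_ix_conj_ix[of j k] by (metis DiffD1 DiffD2 imageI)
        then show "conj_sign j * p j * z (conj_ix j) \<beta> = 0" using p_outer j by simp
      qed
    qed simp
    also have "\<dots> = (\<Sum>a\<in>I. conj_sign (conj_ix a) * p (conj_ix a) * z (conj_ix (conj_ix a)) \<beta>)"
      using inj_on_subset[OF inj_on_conj_ix sub] by (simp add: sum.reindex)
    also have "\<dots> = (\<Sum>a\<in>I. (conj_sign (conj_ix a) * p (conj_ix a)) * z a \<beta>)"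
      using sub by (intro sum.cong refl) (auto simp: conj_ix_conj_ix[of _ k] subset_iff simp del: atLeastAtMost_iff)
    finally show ?thesis by simp
  qed
  have "\<forall>a\<in>I. conj_sign (conj_ix a) * p (conj_ix a) = 0"
  proof -
    have "\<forall>b\<in>I. (\<Sum>a\<in>I. (conj_sign (conj_ix a) * p (conj_ix a)) * ?g a b) = 0"
      unfolding sum_gram_comb using rel by simp
    then show ?thesis
      using ns[unfolded nonsing_def, rule_format, of "\<lambda>a. conj_sign (conj_ix a) * p (conj_ix a)"] by blast
  qed
  then have p_conj: "p (conj_ix a) = 0" if "a \<in> I" for a using that by (auto simp: conj_sign_def split: if_splits)
  have "p i = 0"
    using p_conj[of "conj_ix i"] p_outer[OF i] conj_ix_conj_ix[OF i] by (cases "conj_ix i \<in> I") auto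
  then have "(\<Sum>\<alpha>=1..m. x \<alpha> * x \<alpha>) = - (\<Sum>a\<in>I. c a * p a)"
  proof -
    have "(\<Sum>\<alpha>=1..m. x \<alpha> * x \<alpha>) = (\<Sum>\<alpha>=1..m. x \<alpha> * z i \<alpha> - (\<Sum>a\<in>I. c a * (x \<alpha> * z a \<alpha>)))"
    proof (rule sum.cong[OF refl])
      fix \<alpha>
      have "x \<alpha> * x \<alpha> = x \<alpha> * (z i \<alpha> - (\<Sum>a\<in>I. c a * z a \<alpha>))" by (simp only: x_def)
      then show "x \<alpha> * x \<alpha> = x \<alpha> * z i \<alpha> - (\<Sum>a\<in>I. c a * (x \<alpha> * z a \<alpha>))"
        by (simp add: right_diff_distrib sum_distrib_left mult.left_commute)
    qed
    also have "\<dots> = p i - (\<Sum>\<alpha>=1..m. \<Sum>a\<in>I. c a * (x \<alpha> * z a \<alpha>))"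
      by (simp add: sum_subtractf p_def)
    also have "(\<Sum>\<alpha>=1..m. \<Sum>a\<in>I. c a * (x \<alpha> * z a \<alpha>)) = (\<Sum>a\<in>I. \<Sum>\<alpha>=1..m. c a * (x \<alpha> * z a \<alpha>))"
      by (rule sum.swap)
    finally show ?thesis
      using \<open>p i = 0\<close> by (simp only: p_def sum_distrib_left)
  qed
  then have "(\<Sum>\<alpha>=1..m. x \<alpha> * x \<alpha>) = 0" using pI by simp
  then have "\<forall>\<alpha>\<in>{1..m}. x \<alpha> = 0" by (subst (asm) sum_nonneg_eq_0_iff) auto
  then show ?thesis by (intro exI[of _ c]) (simp add: x_def)
qed


definition spanning :: "nat \<Rightarrow> nat set \<Rightarrow> (nat \<Rightarrow> nat \<Rightarrow> real) \<Rightarrow> bool" where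
  "spanning k I g \<longleftrightarrow> (\<forall>i\<in>{1..2*k}. \<exists>c. \<forall>j. g i j = (\<Sum>a\<in>I. c a * g a j))"

lemma spanning_gram:
  assumes "\<And>i. i \<in> {1..2*k} \<Longrightarrow> \<exists>c. \<forall>\<alpha>\<in>{1..m}. z i \<alpha> = (\<Sum>a\<in>I. c a * z a \<alpha>)"
  shows "spanning k I (gram m z)"
  unfolding spanning_def
proof
  fix i assume "i \<in> {1..2*k}"
  then obtain c where c: "\<forall>\<alpha>\<in>{1..m}. z i \<alpha> = (\<Sum>a\<in>I. c a * z a \<alpha>)" using assms by blast
  have "gram m z i j = (\<Sum>a\<in>I. c a * gram m z a j)" for j
    unfolding sum_gram_comb unfolding gram_def by (rule sum.cong) (auto simp: c)
  then show "\<exists>c. \<forall>j. gram m z i j = (\<Sum>a\<in>I. c a * gram m z a j)" by blast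
qed

lemma gram_isotropic:
  assumes "z \<in> zero_fibre k m"
  shows "(\<Sum>i=1..2*k. conj_sign i * gram m z a i * gram m z b (conj_ix i)) = 0"
proof -
  have "(\<Sum>i=1..2*k. conj_sign i * gram m z a i * gram m z b (conj_ix i))
      = (\<Sum>\<gamma>=1..m. \<Sum>\<delta>=1..m. z a \<gamma> * z b \<delta> * moment k \<gamma> \<delta> z)"
    unfolding sum_conj_sign[of "gram m z a" "gram m z b"] moment_sum
    by (rule sum.cong) (simp_all add: gram_def mult.commute)
  then show ?thesis by (simp add: zero_fibre_moment[OF assms])
qed

text \<open>The columns in \<open>I\<close> determine the coefficients that express any row by the rows in \<open>I\<close>.\<close>

lemma independent_rows_determine:
  assumes ns: "nonsing I g"
    and sym: "\<And>i j. g i j = g j i" "\<And>i j. g' i j = g' j i"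
    and span: "spanning k I g" "spanning k I g'"
    and rows: "\<And>a j. a \<in> I \<Longrightarrow> j \<in> {1..2*k} \<Longrightarrow> g a j = g' a j"
    and I: "I \<subseteq> {1..2*k}" and ij: "i \<in> {1..2*k}" "j \<in> {1..2*k}"
  shows "g i j = g' i j"
proof -
  obtain c where c: "\<And>j. g i j = (\<Sum>a\<in>I. c a * g a j)" using span(1) ij(1) unfolding spanning_def by blast
  obtain c' where c': "\<And>j. g' i j = (\<Sum>a\<in>I. c' a * g' a j)" using span(2) ij(1) unfolding spanning_def by blast
  have "(\<Sum>a\<in>I. (c a - c' a) * g a b) = 0" if b: "b \<in> I" for b
  proof -
    have "b \<in> {1..2*k}" using b I by blast
    then have "(\<Sum>a\<in>I. (c a - c' a) * g a b) = (\<Sum>a\<in>I. c a * g a b) - (\<Sum>a\<in>I. c' a * g' a b)"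
      by (simp add: rows left_diff_distrib sum_subtractf)
    also have "\<dots> = g b i - g' b i" using c[of b] c'[of b] sym by simp
    finally show ?thesis using rows[OF b ij(1)] by simp
  qed
  then have "\<forall>a\<in>I. c a - c' a = 0"
    using ns[unfolded nonsing_def, rule_format, of "\<lambda>a. c a - c' a"] by blast
  then show ?thesis unfolding c c' using rows ij(2) by (intro sum.cong) auto
qed

text \<open>Local coordinates on the stratum of rank \<open>card I\<close>: with \<open>P = g\<^bsub>II\<^esub>\<close> and \<open>S\<close> the signed
  block of \<open>g\<close> with rows in \<open>I\<close> and conjugate columns, they are the upper triangles of the
  symmetric matrix \<open>P\<close> (tag \<open>0\<close>) and of \<open>S P\<close> (tag \<open>1\<close>), together with the remaining columns (tag
  \<open>2\<close>). Isotropy expresses the antisymmetric part of \<open>S P\<close> by the remaining columns.\<close>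

definition chart :: "nat set \<Rightarrow> (nat \<Rightarrow> nat \<Rightarrow> real) \<Rightarrow> nat \<times> nat \<times> nat \<Rightarrow> real" where
  "chart I g = (\<lambda>(t, a, b). if t = 1 then \<Sum>c\<in>I. conj_sign c * g a (conj_ix c) * g c b else g a b)"

definition chart_ix :: "nat \<Rightarrow> nat set \<Rightarrow> (nat \<times> nat \<times> nat) set" where
  "chart_ix k I = {0, 1} \<times> {(a, b) \<in> I \<times> I. a \<le> b} \<union> {2} \<times> I \<times> ({1..2*k} - I - conj_ix ` I)"

lemma chart_injective:
  assumes I: "polarized k I" and ns: "nonsing I g"
    and sym: "\<And>i j. g i j = g j i" "\<And>i j. g' i j = g' j i"
    and iso: "\<And>a b. (\<Sum>i=1..2*k. conj_sign i * g a i * g b (conj_ix i)) = 0"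
      "\<And>a b. (\<Sum>i=1..2*k. conj_sign i * g' a i * g' b (conj_ix i)) = 0"
    and span: "spanning k I g" "spanning k I g'"
    and eq: "\<And>p. p \<in> chart_ix k I \<Longrightarrow> chart I g p = chart I g' p"
    and ij: "i \<in> {1..2*k}" "j \<in> {1..2*k}"
  shows "g i j = g' i j"
proof -
  have fI: "finite I" and sub: "I \<subseteq> {1..2*k}" and disj: "I \<inter> conj_ix ` I = {}"
    using I polarized_finite by (auto simp: polarized_def)
  have csub: "conj_ix ` I \<subseteq> {1..2*k}" using sub conj_ix_range by blast
  let ?R = "{1..2*k} - I - conj_ix ` I"
  define T where "T g a b = (\<Sum>c\<in>I. conj_sign c * g a (conj_ix c) * g c b)"
    for g :: "nat \<Rightarrow> nat \<Rightarrow> real" and a b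
  define \<rho> where "\<rho> g a b = (\<Sum>i\<in>?R. conj_sign i * g a i * g b (conj_ix i))"
    for g :: "nat \<Rightarrow> nat \<Rightarrow> real" and a b
  have relation: "T h a b = T h b a + \<rho> h a b"
    if h: "\<And>i j. h i j = h j i" "\<And>a b. (\<Sum>i=1..2*k. conj_sign i * h a i * h b (conj_ix i)) = 0"
    for h :: "nat \<Rightarrow> nat \<Rightarrow> real" and a b
  proof -
    let ?f = "\<lambda>i. conj_sign i * h a i * h b (conj_ix i)"
    have "(\<Sum>i\<in>I. ?f i) = T h b a"
      unfolding T_def by (rule sum.cong) (auto simp: h(1)[of a])
    moreover have "(\<Sum>i\<in>conj_ix ` I. ?f i) = - T h a b"
    proof -
      have "(\<Sum>i\<in>conj_ix ` I. ?f i) = (\<Sum>c\<in>I. ?f (conj_ix c))"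
        using inj_on_subset[OF inj_on_conj_ix sub] by (simp add: sum.reindex)
      also have "\<dots> = (\<Sum>c\<in>I. - (conj_sign c * h a (conj_ix c) * h c b))"
      proof (rule sum.cong[OF refl])
        fix c assume "c \<in> I"
        then have "c \<in> {1..2*k}" using sub by blast
        then show "?f (conj_ix c) = - (conj_sign c * h a (conj_ix c) * h c b)"
          by (simp only: conj_ix_conj_ix conj_sign_conj_ix h(1)[of b] mult_minus_left)
      qed
      finally show ?thesis by (simp add: T_def sum_negf)
    qed
    moreover have "(\<Sum>i=1..2*k. ?f i) = (\<Sum>i\<in>I. ?f i) + (\<Sum>i\<in>conj_ix ` I. ?f i) + \<rho> h a b"
    proof -
      have "(\<Sum>i=1..2*k. ?f i) = (\<Sum>i\<in>{1..2*k} - I. ?f i) + (\<Sum>i\<in>I. ?f i)"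
        using sub by (intro sum.subset_diff) auto
      also have "(\<Sum>i\<in>{1..2*k} - I. ?f i) = \<rho> h a b + (\<Sum>i\<in>conj_ix ` I. ?f i)"
        unfolding \<rho>_def using csub disj by (intro sum.subset_diff) auto
      finally show ?thesis by simp
    qed
    ultimately show ?thesis using h(2)[of a b] by simp
  qed
  have P: "g a b = g' a b" if "a \<in> I" "b \<in> I" for a b
  proof -
    have "g a b = g' a b" if "a \<in> I" "b \<in> I" "a \<le> b" for a b
      using eq[of "(0, a, b)"] that by (simp add: chart_def chart_ix_def)
    then show ?thesis using that sym by (metis nat_le_linear)
  qed
  have R: "g a j = g' a j" if "a \<in> I" "j \<in> ?R" for a j
    using eq[of "(2, a, j)"] that by (simp add: chart_def chart_ix_def)
  have "\<rho> g a b = \<rho> g' a b" if ab: "a \<in> I" "b \<in> I" for a b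
    unfolding \<rho>_def
  proof (rule sum.cong[OF refl])
    fix i assume i: "i \<in> ?R"
    then have i': "i \<in> {1..2*k}" by blast
    have "conj_ix i \<in> ?R"
      using i conj_ix_range[OF i'] conj_ix_conj_ix[OF i'] sub conj_ix_conj_ix[of _ k]
      by (auto simp: image_iff simp del: atLeastAtMost_iff) (metis subsetD)
    with i ab R show "conj_sign i * g a i * g b (conj_ix i) = conj_sign i * g' a i * g' b (conj_ix i)"
      by simp
  qed
  moreover have upper: "T g a b = T g' a b" if "a \<in> I" "b \<in> I" "a \<le> b" for a b
    using eq[of "(1, a, b)"] that by (simp add: chart_def chart_ix_def T_def)
  ultimately have T: "T g a b = T g' a b" if "a \<in> I" "b \<in> I" for a b
    using relation[OF sym(1) iso(1), of a b] relation[OF sym(2) iso(2), of a b] that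
    by (cases "a \<le> b") auto
  have S: "g a (conj_ix c) = g' a (conj_ix c)" if a: "a \<in> I" and c: "c \<in> I" for a c
  proof -
    have "\<forall>b\<in>I. (\<Sum>c\<in>I. (conj_sign c * (g a (conj_ix c) - g' a (conj_ix c))) * g c b) = 0"
    proof
      fix b assume b: "b \<in> I"
      have "(\<Sum>c\<in>I. (conj_sign c * (g a (conj_ix c) - g' a (conj_ix c))) * g c b) = T g a b - T g' a b"
        unfolding T_def sum_subtractf[symmetric]
        by (rule sum.cong) (auto simp: P[OF _ b] algebra_simps)
      then show "(\<Sum>c\<in>I. (conj_sign c * (g a (conj_ix c) - g' a (conj_ix c))) * g c b) = 0"
        using T[OF a b] by simp
    qed
    then have "conj_sign c * (g a (conj_ix c) - g' a (conj_ix c)) = 0"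
      using ns[unfolded nonsing_def, rule_format,
          of "\<lambda>c. conj_sign c * (g a (conj_ix c) - g' a (conj_ix c))"] c by blast
    then show ?thesis by (simp add: conj_sign_def split: if_splits)
  qed
  have "g a j = g' a j" if "a \<in> I" "j \<in> {1..2*k}" for a j
    using P R S that by blast
  then show ?thesis
    using independent_rows_determine[OF ns sym span _ sub ij] by blast
qed

lemma card_upper_triangle:
  fixes I :: "nat set"
  assumes "finite I"
  shows "2 * card {(a, b) \<in> I \<times> I. a \<le> b} = card I * (card I + 1)"
proof -
  let ?T = "{(a, b) \<in> I \<times> I. a \<le> b}" and ?T' = "{(a, b) \<in> I \<times> I. b \<le> a}"
  have fin: "finite ?T" "finite ?T'"
    using assms by (auto intro: finite_subset[of _ "I \<times> I"])
  have "?T' = prod.swap ` ?T" by auto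
  then have "card ?T' = card ?T" by (simp add: card_image)
  moreover have "?T \<union> ?T' = I \<times> I" "?T \<inter> ?T' = (\<lambda>a. (a, a)) ` I" by auto
  moreover have "card ((\<lambda>a. (a, a)) ` I) = card I" by (intro card_image inj_onI) auto
  ultimately show ?thesis using card_Un_Int[OF fin] by (simp add: card_cartesian_product algebra_simps)
qed

text \<open>The dimension of the stratum of Gram matrices of rank \<open>r\<close>, as \<open>card_chart_ix\<close> and
  \<open>card_param_ix\<close> compute it.\<close>

definition stratum_dim :: "nat \<Rightarrow> nat \<Rightarrow> nat" where
  "stratum_dim k r = r * (2*k + 1 - r)"

lemma card_chart_ix:
  assumes I: "polarized k I"
  shows "finite (chart_ix k I)" "card (chart_ix k I) = stratum_dim k (card I)"
proof -
  have fI: "finite I" and sub: "I \<subseteq> {1..2*k}" and disj: "I \<inter> conj_ix ` I = {}"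
    using I polarized_finite by (auto simp: polarized_def)
  have csub: "conj_ix ` I \<subseteq> {1..2*k}" using sub conj_ix_range by blast
  let ?T = "{(a, b) \<in> I \<times> I. a \<le> b}" and ?R = "{1..2*k} - I - conj_ix ` I"
  have fT: "finite ?T" using fI by (auto intro: finite_subset[of _ "I \<times> I"])
  show "finite (chart_ix k I)" unfolding chart_ix_def using fT fI by auto
  have cR: "card ?R = 2*k - 2 * card I"
  proof -
    have "card ({1..2*k} - I) = 2*k - card I" using fI sub by (simp add: card_Diff_subset)
    moreover have "card (conj_ix ` I) = card I"
      using inj_on_subset[OF inj_on_conj_ix sub] by (rule card_image)
    moreover have "conj_ix ` I \<subseteq> {1..2*k} - I" using csub disj by blast
    ultimately show ?thesis using fI by (simp add: card_Diff_subset)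
  qed
  have "card (chart_ix k I) = card ({0::nat, 1} \<times> ?T) + card ({2::nat} \<times> I \<times> ?R)"
    unfolding chart_ix_def using fT fI by (intro card_Un_disjoint) auto
  also have "\<dots> = card I * (card I + 1) + card I * (2*k - 2 * card I)"
    unfolding card_cartesian_product cR card_upper_triangle[OF fI, symmetric] by simp
  also have "\<dots> = card I * (card I + 1 + (2*k - 2 * card I))" by (rule add_mult_distrib2[symmetric])
  also have "card I + 1 + (2*k - 2 * card I) = 2*k + 1 - card I" using polarized_card[OF I] by simp
  also have "card I * \<dots> = stratum_dim k (card I)" by (simp only: stratum_dim_def)
  finally show "card (chart_ix k I) = stratum_dim k (card I)" .
qed

lemma stratum_dim_mono:
  assumes "r < s" "s \<le> k"
  shows "stratum_dim k r < stratum_dim k s"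
proof -
  have "int (stratum_dim k t) = int t * (2 * int k + 1 - int t)" if "t \<le> k" for t
    using that by (simp add: stratum_dim_def of_nat_diff)
  then have "int (stratum_dim k s) = int s * (2 * int k + 1 - int s)"
    "int (stratum_dim k r) = int r * (2 * int k + 1 - int r)" using assms by simp_all
  then have "int (stratum_dim k s) - int (stratum_dim k r) = (int s - int r) * (2 * int k + 1 - int s - int r)"
    by (simp only:) (simp add: algebra_simps)
  also have "\<dots> > 0" using assms by (intro mult_pos_pos) auto
  finally show ?thesis by simp
qed

text \<open>A set of maximal size among all polarized sets of independent vectors that occur over the image
  stays independent near the point where it occurs. It is maximal there as well, so \<open>chart\<close>
  is injective nearby and invariance of domain applies.\<close>

theorem gram_zero_fibre_dim_le:
  fixes \<Phi> :: "(nat \<Rightarrow> real) \<Rightarrow> nat \<Rightarrow> nat \<Rightarrow> real"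
  assumes mk: "m \<le> k"
    and cont: "continuous_on (topspace (Euclidean_space D)) \<Phi>"
    and inj: "inj_on \<Phi> (topspace (Euclidean_space D))"
    and img: "\<Phi> ` topspace (Euclidean_space D) \<subseteq> gram m ` zero_fibre k m"
  shows "D \<le> stratum_dim k m"
proof (rule ccontr)
  assume D: "\<not> D \<le> stratum_dim k m"
  let ?E = "topspace (Euclidean_space D)"
  have zE: "(\<lambda>_. 0) \<in> ?E" by (simp add: topspace_Euclidean_space)
  define good where "good u I \<longleftrightarrow> polarized k I \<and> nonsing I (\<Phi> u)" for u I
  define S where "S = {card I |u I. u \<in> ?E \<and> good u I}"
  have card_le: "card I \<le> m" if "u \<in> ?E" "good u I" for u I
  proof -
    obtain z where "\<Phi> u = gram m z" using img \<open>u \<in> ?E\<close> by blast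
    then show ?thesis
      using that nonsing_card[of I m z] polarized_finite by (auto simp: good_def)
  qed
  have "good (\<lambda>_. 0) {}" by (simp add: good_def polarized_def nonsing_def)
  then have "S \<noteq> {}" using zE unfolding S_def by blast
  moreover have "finite S" by (rule finite_subset[of _ "{..m}"]) (auto simp: S_def card_le)
  ultimately have "Max S \<in> S" by (intro Max_in)
  then obtain u0 I where u0: "u0 \<in> ?E" "good u0 I" "card I = Max S" unfolding S_def by force
  have max: "card J \<le> card I" if "u \<in> ?E" "good u J" for u J
    unfolding u0(3) using \<open>finite S\<close> that by (intro Max_ge) (auto simp: S_def)
  have I: "polarized k I" "nonsing I (\<Phi> u0)" using u0(2) by (auto simp: good_def)
  have fI: "finite I" using I(1) by (rule polarized_finite)
  have sym: "\<Phi> u i j = \<Phi> u j i" if "u \<in> ?E" for u i j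
  proof -
    obtain z where "\<Phi> u = gram m z" using img \<open>u \<in> ?E\<close> by blast
    then show ?thesis by (simp add: gram_commute)
  qed
  obtain W where W: "open W" "\<Phi> u0 \<in> W" "\<And>g. g \<in> W \<Longrightarrow> nonsing I g"
    using nonsing_open[OF fI I(2) sym[OF u0(1)]] by blast
  define U where "U = {u \<in> ?E. \<Phi> u \<in> W}"
  have "openin (top_of_set ?E) (?E \<inter> \<Phi> -` W)"
    using cont W(1) by (rule continuous_openin_preimage_gen)
  moreover have "Euclidean_space D = top_of_set ?E"
    by (simp add: Euclidean_space_def euclidean_product_topology)
  moreover have "?E \<inter> \<Phi> -` W = U" by (auto simp: U_def)
  ultimately have U: "openin (Euclidean_space D) U" by simp
  have UE: "U \<subseteq> ?E" by (auto simp: U_def)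
  have ns: "nonsing I (\<Phi> u)" if "u \<in> U" for u using that W(3) by (auto simp: U_def)
  have props: "spanning k I (\<Phi> u)"
      "(\<Sum>i=1..2*k. conj_sign i * \<Phi> u a i * \<Phi> u b (conj_ix i)) = 0"
      "i \<notin> {1..2*k} \<or> j \<notin> {1..2*k} \<Longrightarrow> \<Phi> u i j = 0"
    if u: "u \<in> U" for u a b i j
  proof -
    have uE: "u \<in> ?E" using u UE by blast
    then obtain z where z: "z \<in> zero_fibre k m" "\<Phi> u = gram m z" using img by blast
    show "(\<Sum>i=1..2*k. conj_sign i * \<Phi> u a i * \<Phi> u b (conj_ix i)) = 0"
      unfolding z(2) by (rule gram_isotropic[OF z(1)])
    show "i \<notin> {1..2*k} \<or> j \<notin> {1..2*k} \<Longrightarrow> \<Phi> u i j = 0"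
      using zero_fibre_phase_space[OF z(1)] unfolding z(2) gram_def phase_space_def
      by (intro sum.neutral) auto
    have "\<not> nonsing (insert j I) (gram m z)"
      if j: "j \<in> {1..2*k}" "j \<notin> I" "conj_ix j \<notin> I" for j
    proof
      assume "nonsing (insert j I) (gram m z)"
      moreover have "polarized k (insert j I)"
        unfolding polarized_def
      proof (intro conjI ballI)
        show "insert j I \<subseteq> {1..2*k}" using j I(1) by (auto simp: polarized_def)
        fix a assume a: "a \<in> insert j I"
        have "conj_ix a \<noteq> j" if "a \<in> I"
          using that j(3) conj_ix_conj_ix[of a k] I(1) by (metis polarized_def subsetD)
        moreover have "conj_ix j \<noteq> j" using j(1) by (auto simp: conj_ix_def)
        ultimately show "conj_ix a \<notin> insert j I"
          using a j(3) I(1) by (auto simp: polarized_def)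
      qed
      ultimately have "good u (insert j I)" using z(2) by (simp add: good_def)
      from max[OF uE this] show False using fI j by simp
    qed
    then show "spanning k I (\<Phi> u)"
      unfolding z(2) using maximal_polarized_spanning[OF z(1) I(1)] ns[OF u] z(2)
      by (intro spanning_gram) auto
  qed
  have "stratum_dim k (card I) \<le> stratum_dim k m"
    using stratum_dim_mono[of "card I" m k] card_le[OF u0(1,2)] mk by (cases "card I = m") auto
  then have "card (chart_ix k I) < D" using card_chart_ix[OF I(1)] D by simp
  have "U \<noteq> {}" using u0(1) W(2) by (auto simp: U_def)
  show False
  proof (rule no_injection_to_fewer_coordinates[OF U \<open>U \<noteq> {}\<close> card_chart_ix(1)[OF I(1)]
        \<open>card (chart_ix k I) < D\<close>])
    have c: "continuous_on U (\<lambda>u. \<Phi> u i j)" for i j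
      by (rule continuous_on_product_then_coordinatewise[OF
            continuous_on_product_then_coordinatewise[OF continuous_on_subset[OF cont UE]]])
    show "continuous_on U (\<lambda>u. chart I (\<Phi> u) p)" for p
    proof -
      obtain t a b where p: "p = (t, a, b)" by (cases p)
      show ?thesis
        by (cases "t = 1") (auto simp: p chart_def intro!: continuous_intros c)
    qed
    fix u v assume uv: "u \<in> U" "v \<in> U"
      and eq: "\<And>p. p \<in> chart_ix k I \<Longrightarrow> chart I (\<Phi> u) p = chart I (\<Phi> v) p"
    have "\<Phi> u i j = \<Phi> v i j" for i j
    proof (cases "i \<in> {1..2*k} \<and> j \<in> {1..2*k}")
      case True
      show ?thesis
        by (rule chart_injective[OF I(1) ns[OF uv(1)] sym sym props(2)[OF uv(1)] props(2)[OF uv(2)]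
              props(1)[OF uv(1)] props(1)[OF uv(2)] eq])
          (use uv UE True in auto)
    next
      case False
      then show ?thesis using props(3)[OF uv(1), of i j] props(3)[OF uv(2), of i j] by auto
    qed
    then have "\<Phi> u = \<Phi> v" by (intro ext)
    then show "u = v" using inj uv UE by (meson inj_onD subsetD)
  qed
qed


section \<open>A parametrization of the open stratum\<close>

text \<open>Substitution in the order given by \<open>r\<close>, which covers lower and upper triangular matrices.\<close>

lemma triangular_injective:
  fixes M :: "nat \<Rightarrow> nat \<Rightarrow> real" and r :: "nat \<Rightarrow> nat"
  assumes S: "finite S" and diag: "\<And>a. a \<in> S \<Longrightarrow> M a a \<noteq> 0"
    and tri: "\<And>a b. a \<in> S \<Longrightarrow> b \<in> S \<Longrightarrow> M a b \<noteq> 0 \<Longrightarrow> b = a \<or> r b < r a"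
    and eq: "\<And>a. a \<in> S \<Longrightarrow> (\<Sum>b\<in>S. M a b * v b) = (\<Sum>b\<in>S. M a b * w b)"
  shows "a \<in> S \<Longrightarrow> v a = w a"
proof (induction "r a" arbitrary: a rule: less_induct)
  case less
  have split: "(\<Sum>b\<in>S. M a b * v b) = M a a * v a + (\<Sum>b\<in>S - {a}. M a b * v b)" for v
    using S less.prems by (rule sum.remove)
  have "(\<Sum>b\<in>S - {a}. M a b * v b) = (\<Sum>b\<in>S - {a}. M a b * w b)"
  proof (rule sum.cong[OF refl])
    fix b assume "b \<in> S - {a}"
    then show "M a b * v b = M a b * w b"
      using tri[of a b] less.prems less.hyps[of b] by (cases "M a b = 0") auto
  qed
  with eq[OF less.prems] diag[OF less.prems] show ?case by (simp add: split)
qed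

text \<open>Uniqueness of the Cholesky factor: given the rows above, row \<open>c\<close> of the factor can be read off
  from row \<open>c\<close> of the product.\<close>

lemma cholesky_unique:
  fixes A B :: "nat \<Rightarrow> nat \<Rightarrow> real"
  assumes A: "\<And>a. a \<in> {1..n} \<Longrightarrow> A a a > 0" "\<And>a b. b < a \<Longrightarrow> A a b = 0"
    and B: "\<And>a. a \<in> {1..n} \<Longrightarrow> B a a > 0" "\<And>a b. b < a \<Longrightarrow> B a b = 0"
    and eq: "\<And>a b. a \<in> {1..n} \<Longrightarrow> b \<in> {1..n} \<Longrightarrow>
      (\<Sum>\<gamma>=1..n. A \<gamma> a * A \<gamma> b) = (\<Sum>\<gamma>=1..n. B \<gamma> a * B \<gamma> b)"
  shows "c \<in> {1..n} \<Longrightarrow> b \<in> {1..n} \<Longrightarrow> A c b = B c b"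
proof (induction c arbitrary: b rule: less_induct)
  case (less c)
  have split: "(\<Sum>\<gamma>=1..n. M \<gamma> c * M \<gamma> b) = M c c * M c b + (\<Sum>\<gamma>\<in>{1..<c}. M \<gamma> c * M \<gamma> b)"
    if "\<And>a b. b < a \<Longrightarrow> M a b = 0" for M :: "nat \<Rightarrow> nat \<Rightarrow> real" and b
  proof -
    have "(\<Sum>\<gamma>=1..n. M \<gamma> c * M \<gamma> b) = (\<Sum>\<gamma>\<in>insert c {1..<c}. M \<gamma> c * M \<gamma> b)"
      using less.prems(1) that by (intro sum.mono_neutral_right) (auto simp: not_less_iff_gr_or_eq)
    then show ?thesis by simp
  qed
  have "(\<Sum>\<gamma>\<in>{1..<c}. A \<gamma> c * A \<gamma> b) = (\<Sum>\<gamma>\<in>{1..<c}. B \<gamma> c * B \<gamma> b)" if "b \<in> {1..n}" for b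
    using less.IH less.prems(1) that by (intro sum.cong) auto
  then have prod: "A c c * A c b = B c c * B c b" if "b \<in> {1..n}" for b
    using eq[OF less.prems(1) that] that split[of A b] split[of B b] A(2) B(2) by simp
  have "A c c * A c c = B c c * B c c" using prod less.prems(1) by blast
  then have "A c c = B c c"
    using A(1)[OF less.prems(1)] B(1)[OF less.prems(1)] by (simp add: square_eq_iff)
  then show ?case using prod[OF less.prems(2)] A(1)[OF less.prems(1)] by simp
qed

text \<open>The rows of \<open>frame\<close> form the matrix \<open>(1 | C | R)\<close> in the coordinates
  \<open>(q\<^sub>1, \<dots>, q\<^sub>n | p\<^sub>1, \<dots>, p\<^sub>n | the others)\<close>. For given \<open>R\<close>, they are isotropic iff
  the antisymmetric part of \<open>C\<close> takes a prescribed value, so the upper triangle of \<open>C\<close> is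
  free. Multiplying from the left by an upper triangular matrix with positive diagonal gives each
  orbit at most once.\<close>

definition upper_factor :: "(nat \<times> nat \<times> nat \<Rightarrow> real) \<Rightarrow> nat \<Rightarrow> nat \<Rightarrow> real" where
  "upper_factor x a b = (if a < b then x (0, a, b) else if a = b then exp (x (0, a, a)) else 0)"

definition rest_form :: "nat \<Rightarrow> nat \<Rightarrow> (nat \<times> nat \<times> nat \<Rightarrow> real) \<Rightarrow> nat \<Rightarrow> nat \<Rightarrow> real" where
  "rest_form k n x a b
    = (\<Sum>l=n+1..k. x (2, a, 2*l - 1) * x (2, b, 2*l) - x (2, b, 2*l - 1) * x (2, a, 2*l))"

definition conj_block :: "nat \<Rightarrow> nat \<Rightarrow> (nat \<times> nat \<times> nat \<Rightarrow> real) \<Rightarrow> nat \<Rightarrow> nat \<Rightarrow> real" where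
  "conj_block k n x a b = (if a \<le> b then x (1, a, b) else x (1, b, a) + rest_form k n x a b)"

definition frame :: "nat \<Rightarrow> nat \<Rightarrow> (nat \<times> nat \<times> nat \<Rightarrow> real) \<Rightarrow> point" where
  "frame k n x i b =
    (if b \<notin> {1..n} \<or> i \<notin> {1..2*k} then 0
     else if i > 2*n then x (2, b, i)
     else if odd i then if i = 2*b - 1 then 1 else 0
     else conj_block k n x b (i div 2))"

definition param :: "nat \<Rightarrow> nat \<Rightarrow> (nat \<times> nat \<times> nat \<Rightarrow> real) \<Rightarrow> point" where
  "param k n x = act n (upper_factor x) (frame k n x)"

definition param_ix :: "nat \<Rightarrow> nat \<Rightarrow> (nat \<times> nat \<times> nat) set" where
  "param_ix k n = {0, 1} \<times> {(a, b) \<in> {1..n} \<times> {1..n}. a \<le> b} \<union> {2} \<times> {1..n} \<times> {2*n+1..2*k}"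

lemma rest_form_antisym: "rest_form k n x a b = - rest_form k n x b a"
  by (simp add: rest_form_def sum_negf[symmetric] algebra_simps)

lemma frame_q:
  assumes "n \<le> k" "l \<in> {1..n}" "b \<in> {1..n}"
  shows "frame k n x (2*l - 1) b = (if l = b then 1 else 0)"
proof -
  have "2*l - 1 \<in> {1..2*k}" "\<not> 2*l - 1 > 2*n" "odd (2*l - 1)" using assms by auto
  moreover have "2*l - 1 = 2*b - 1 \<longleftrightarrow> l = b" using assms(2,3) by auto
  ultimately show ?thesis unfolding frame_def using assms(3) by (simp only: if_False not_not simp_thms if_True)
qed

lemma frame_p:
  assumes "n \<le> k" "l \<in> {1..n}" "b \<in> {1..n}"
  shows "frame k n x (2*l) b = conj_block k n x b l"
proof -
  have "2*l \<in> {1..2*k}" "\<not> 2*l > 2*n" "\<not> odd (2*l)" "2*l div 2 = l" using assms by auto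
  then show ?thesis unfolding frame_def using assms(3) by (simp only: if_False not_not simp_thms if_True)
qed

lemma frame_rest:
  assumes "b \<in> {1..n}" "j \<in> {2*n+1..2*k}"
  shows "frame k n x j b = x (2, b, j)"
proof -
  have "j \<in> {1..2*k}" "j > 2*n" using assms by auto
  then show ?thesis unfolding frame_def using assms(1) by (simp only: if_False not_not simp_thms if_True)
qed

lemma frame_zero_fibre:
  assumes nk: "n \<le> k"
  shows "frame k n x \<in> zero_fibre k n"
  unfolding zero_fibre_def
proof (intro CollectI conjI allI impI)
  let ?V = "frame k n x"
  show "?V \<in> phase_space k n" by (auto simp: phase_space_def frame_def)
  fix a b assume "1 \<le> a \<and> a < b \<and> b \<le> n"
  then have ab: "a \<in> {1..n}" "b \<in> {1..n}" "a < b" by auto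
  let ?f = "\<lambda>l. ?V (2*l - 1) a * ?V (2*l) b - ?V (2*l - 1) b * ?V (2*l) a"
  have "moment k a b ?V = (\<Sum>l=1..k. ?f l)" by (simp add: moment_def q_coord_def p_coord_def)
  also have "{1..k} = {1..n} \<union> {n+1..k}" using nk by auto
  also have "sum ?f ({1..n} \<union> {n+1..k}) = (\<Sum>l=1..n. ?f l) + (\<Sum>l=n+1..k. ?f l)"
    by (rule sum.union_disjoint) auto
  also have "(\<Sum>l=1..n. ?f l) = (\<Sum>l=1..n. (if l = a then conj_block k n x b l else 0)
      - (if l = b then conj_block k n x a l else 0))"
  proof (rule sum.cong[OF refl])
    fix l assume l: "l \<in> {1..n}"
    then show "?f l = (if l = a then conj_block k n x b l else 0)
      - (if l = b then conj_block k n x a l else 0)"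
      by (simp only: frame_q[OF nk l] frame_p[OF nk l] ab) simp
  qed
  also have "\<dots> = conj_block k n x b a - conj_block k n x a b" using ab by (simp add: sum_subtractf)
  also have "(\<Sum>l=n+1..k. ?f l) = rest_form k n x a b"
    unfolding rest_form_def
  proof (rule sum.cong[OF refl])
    fix l assume "l \<in> {n+1..k}"
    then have l: "2*l - 1 \<in> {2*n+1..2*k}" "2*l \<in> {2*n+1..2*k}" by auto
    show "?f l = x (2, a, 2*l - 1) * x (2, b, 2*l) - x (2, b, 2*l - 1) * x (2, a, 2*l)"
      by (simp only: frame_rest[OF ab(1)] frame_rest[OF ab(2)] l)
  qed
  finally show "moment k a b ?V = 0"
    using ab rest_form_antisym[of k n x a b] by (simp add: conj_block_def)
qed

lemma param_zero_fibre: "n \<le> k \<Longrightarrow> param k n x \<in> zero_fibre k n"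
  unfolding param_def by (intro act_zero_fibre frame_zero_fibre)

lemma continuous_on_param:
  assumes x: "\<And>p. continuous_on S (\<lambda>u. x u p)"
  shows "continuous_on S (\<lambda>u. param k n (x u))"
proof -
  have ite: "continuous_on S (\<lambda>u. if P then f u else g u)"
    if "continuous_on S f" "continuous_on S g" for P and f g :: "'a \<Rightarrow> real"
    using that by (cases P) simp_all
  have U: "continuous_on S (\<lambda>u. upper_factor (x u) a b)" for a b
    unfolding upper_factor_def by (intro ite continuous_intros x)
  have C: "continuous_on S (\<lambda>u. conj_block k n (x u) a b)" for a b
    unfolding conj_block_def rest_form_def by (intro ite continuous_intros x)
  have F: "continuous_on S (\<lambda>u. frame k n (x u) i b)" for i b
    unfolding frame_def by (intro ite continuous_intros x C)
  have "continuous_on S (\<lambda>u. param k n (x u) i \<alpha>)" for i \<alpha>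
    unfolding param_def act_def by (intro ite continuous_intros U F)
  then show ?thesis by (intro continuous_on_coordinatewise_then_product)
qed

lemma upper_factor_eq_iff:
  "(\<forall>a\<in>{1..n}. \<forall>b\<in>{1..n}. upper_factor x a b = upper_factor x' a b) \<longleftrightarrow>
    (\<forall>a\<in>{1..n}. \<forall>b\<in>{1..n}. a \<le> b \<longrightarrow> x (0, a, b) = x' (0, a, b))"
  by (force simp: upper_factor_def split: if_splits)

text \<open>The products of the vectors \<open>q\<^sub>1, \<dots>, q\<^sub>n\<close> determine the triangular factor, and their products
  with the other vectors then determine the frame.\<close>

lemma param_injective:
  assumes nk: "n \<le> k" and g: "gram n (param k n x) = gram n (param k n x')"
    and p: "p \<in> param_ix k n"
  shows "x p = x' p"
proof -
  let ?A = "upper_factor x" and ?A' = "upper_factor x'"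
  let ?W = "param k n x" and ?W' = "param k n x'"
  have q: "param k n y (2*a - 1) \<alpha> = upper_factor y \<alpha> a" if "a \<in> {1..n}" "\<alpha> \<in> {1..n}" for y a \<alpha>
  proof -
    have "param k n y (2*a - 1) \<alpha> = (\<Sum>b=1..n. upper_factor y \<alpha> b * (if b = a then 1 else 0))"
      unfolding param_def act_apply[OF that(2)]
      by (rule sum.cong[OF refl]) (simp only: frame_q[OF nk that(1)] eq_commute[of a])
    also have "\<dots> = (\<Sum>b=1..n. if b = a then upper_factor y \<alpha> b else 0)"
      by (rule sum.cong) auto
    finally show ?thesis using that by simp
  qed
  have A: "?A c b = ?A' c b" if "c \<in> {1..n}" "b \<in> {1..n}" for c b
  proof (rule cholesky_unique[of n ?A ?A', OF _ _ _ _ _ that])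
    fix a b assume ab: "a \<in> {1..n}" "b \<in> {1..n}"
    have "gram n (param k n y) (2*a - 1) (2*b - 1) = (\<Sum>\<gamma>=1..n. upper_factor y \<gamma> a * upper_factor y \<gamma> b)" for y
      unfolding gram_def using q ab by (intro sum.cong) auto
    then show "(\<Sum>\<gamma>=1..n. ?A \<gamma> a * ?A \<gamma> b) = (\<Sum>\<gamma>=1..n. ?A' \<gamma> a * ?A' \<gamma> b)"
      using g by metis
  qed (auto simp: upper_factor_def)
  have W: "?W i \<alpha> = ?W' i \<alpha>" if "\<alpha> \<in> {1..n}" for i \<alpha>
  proof (rule triangular_injective[of "{1..n}" "\<lambda>a b. ?A b a" id, OF _ _ _ _ that])
    fix a assume a: "a \<in> {1..n}"
    have "gram n ?W (2*a - 1) i = (\<Sum>\<alpha>=1..n. ?A \<alpha> a * ?W i \<alpha>)"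
      unfolding gram_def using q a by (intro sum.cong) auto
    moreover have "gram n ?W' (2*a - 1) i = (\<Sum>\<alpha>=1..n. ?A \<alpha> a * ?W' i \<alpha>)"
      unfolding gram_def using q a A by (intro sum.cong) auto
    ultimately show "(\<Sum>b=1..n. ?A b a * ?W i b) = (\<Sum>b=1..n. ?A b a * ?W' i b)" using g by simp
  qed (auto simp: upper_factor_def split: if_splits)
  have V: "frame k n x i b = frame k n x' i b" if "b \<in> {1..n}" for i b
  proof (rule triangular_injective[of "{1..n}" ?A "\<lambda>a. n - a", OF _ _ _ _ that])
    fix a assume a: "a \<in> {1..n}"
    have "(\<Sum>b=1..n. ?A a b * frame k n x i b) = ?W i a" by (simp add: param_def act_apply[OF a])
    also have "\<dots> = ?W' i a" using W[OF a] .
    also have "\<dots> = (\<Sum>b=1..n. ?A a b * frame k n x' i b)"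
      unfolding param_def act_apply[OF a] using A a by (intro sum.cong) auto
    finally show "(\<Sum>b=1..n. ?A a b * frame k n x i b) = (\<Sum>b=1..n. ?A a b * frame k n x' i b)" .
  qed (auto simp: upper_factor_def split: if_splits)
  consider a b where "p = (0, a, b)" "a \<in> {1..n}" "b \<in> {1..n}" "a \<le> b"
    | a b where "p = (1, a, b)" "a \<in> {1..n}" "b \<in> {1..n}" "a \<le> b"
    | a j where "p = (2, a, j)" "a \<in> {1..n}" "j \<in> {2*n+1..2*k}"
    using p by (auto simp: param_ix_def)
  then show ?thesis
  proof cases
    case 1
    then show ?thesis using upper_factor_eq_iff[of n x x'] A by blast
  next
    case 2
    have "frame k n y (2*b) a = y (1, a, b)" for y
      unfolding frame_p[OF nk 2(3,2)] using 2(4) by (simp add: conj_block_def)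
    then show ?thesis using V[OF 2(2), of "2*b"] 2(1) by simp
  next
    case 3
    have "frame k n y j a = y (2, a, j)" for y
      using 3 by (intro frame_rest)
    then show ?thesis using V[OF 3(2), of j] 3(1) by simp
  qed
qed

lemma card_param_ix:
  assumes "n \<le> k"
  shows "finite (param_ix k n)" "card (param_ix k n) = stratum_dim k n"
proof -
  let ?T = "{(a, b) \<in> {1..n} \<times> {1..n}. a \<le> b}"
  have fT: "finite ?T" by (auto intro: finite_subset[of _ "{1..n} \<times> {1..n}"])
  have un: "finite ({0::nat, 1} \<times> A \<union> {2} \<times> B) \<and> card ({0::nat, 1} \<times> A \<union> {2} \<times> B) = 2 * card A + card B"
    if "finite A" "finite B" for A B :: "(nat \<times> nat) set"
  proof -
    have fin: "finite ({0::nat, 1} \<times> A)" "finite ({2::nat} \<times> B)"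
      by (intro finite_cartesian_product finite.intros that)+
    have "card ({0::nat, 1} \<times> A \<union> {2} \<times> B) = card ({0::nat, 1} \<times> A) + card ({2::nat} \<times> B)"
      using fin by (rule card_Un_disjoint) fastforce
    also have "card ({0::nat, 1} \<times> A) = card {0::nat, 1} * card A" by (rule card_cartesian_product)
    also have "card ({2::nat} \<times> B) = card {2::nat} * card B" by (rule card_cartesian_product)
    finally show ?thesis using fin by simp
  qed
  have fR: "finite ({1..n} \<times> {2*n+1..2*k})" by (rule finite_cartesian_product; rule finite_atLeastAtMost)
  show "finite (param_ix k n)" unfolding param_ix_def using un[OF fT fR] by (rule conjunct1)
  have "card (param_ix k n) = 2 * card ?T + card ({1..n} \<times> {2*n+1..2*k})"
    unfolding param_ix_def using un[OF fT fR] by (rule conjunct2)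
  also have "card ({1..n} \<times> {2*n+1..2*k}) = n * (2*k - 2*n)" by (simp add: card_cartesian_product)
  also have "2 * card ?T = n * (n + 1)" using card_upper_triangle[of "{1..n}"] by (simp only: finite_atLeastAtMost card_atLeastAtMost diff_Suc_1)
  also have "n * (n + 1) + n * (2*k - 2*n) = n * (n + 1 + (2*k - 2*n))"
    by (rule add_mult_distrib2[symmetric])
  also have "n + 1 + (2*k - 2*n) = 2*k + 1 - n" using assms by simp
  also have "n * \<dots> = stratum_dim k n" by (simp only: stratum_dim_def)
  finally show "card (param_ix k n) = stratum_dim k n" .
qed

text \<open>A homeomorphism would carry the parametrized stratum of dimension \<open>stratum_dim k n\<close> injectively
  into a space of Gram matrices of dimension at most \<open>stratum_dim k m\<close>.\<close>

theorem symplectic_quotients_not_homeomorphic: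
  assumes mn: "m < n" "n \<le> k"
  shows "\<not> symplectic_quotient k m homeomorphic_space symplectic_quotient k n"
proof
  assume "symplectic_quotient k m homeomorphic_space symplectic_quotient k n"
  then obtain h where h: "homeomorphic_map (symplectic_quotient k n) (symplectic_quotient k m) h"
    by (metis homeomorphic_space homeomorphic_space_sym)
  define D where "D = stratum_dim k n"
  let ?E = "topspace (Euclidean_space D)" and ?X = "gram m ` zero_fibre k m"
  obtain e where e: "bij_betw e (param_ix k n) {0..<D}"
    using card_param_ix[OF mn(2)] unfolding D_def by (metis ex_bij_betw_finite_nat)
  define \<Psi> where "\<Psi> u = param k n (\<lambda>p. u (e p))" for u :: "nat \<Rightarrow> real"
  define \<Phi> where "\<Phi> = orbit_gram m \<circ> h \<circ> orbit n \<circ> \<Psi>"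
  have Euc: "top_of_set ?E = Euclidean_space D"
    by (simp add: Euclidean_space_def euclidean_product_topology)
  have "continuous_on ?E \<Psi>"
    unfolding \<Psi>_def
    by (intro continuous_on_param continuous_on_subset[OF continuous_on_product_coordinates subset_UNIV])
  then have "continuous_map (top_of_set ?E) (top_of_set (zero_fibre k n)) \<Psi>"
    using param_zero_fibre[OF mn(2)] by (auto simp: \<Psi>_def)
  moreover have "continuous_map (top_of_set (zero_fibre k n)) (top_of_set ?X) (orbit_gram m \<circ> h \<circ> orbit n)"
    using quotient_imp_continuous_map[OF quotient_map_orbit] homeomorphic_imp_continuous_map[OF h]
      homeomorphic_imp_continuous_map[OF homeomorphic_map_orbit_gram[of k m]]
    by (metis continuous_map_compose comp_assoc)
  ultimately have "continuous_map (top_of_set ?E) (top_of_set ?X) \<Phi>"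
    unfolding \<Phi>_def by (rule continuous_map_compose)
  then have "continuous_on ?E \<Phi>" "\<Phi> ` ?E \<subseteq> ?X" by auto
  moreover have "inj_on \<Phi> ?E"
  proof (rule inj_onI)
    fix u v assume uv: "u \<in> ?E" "v \<in> ?E" "\<Phi> u = \<Phi> v"
    have Z: "\<Psi> w \<in> zero_fibre k n" for w unfolding \<Psi>_def by (rule param_zero_fibre[OF mn(2)])
    have "inj_on (orbit_gram m \<circ> h) (topspace (symplectic_quotient k n))"
      using homeomorphic_map_compose[OF h homeomorphic_map_orbit_gram] by (rule homeomorphic_imp_injective_map)
    then have "orbit n (\<Psi> u) = orbit n (\<Psi> v)"
      using uv(3) Z by (intro inj_onD[of "orbit_gram m \<circ> h"]) (auto simp: \<Phi>_def)
    then have "gram n (\<Psi> u) = gram n (\<Psi> v)"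
      using orbit_eq_iff zero_fibre_phase_space[OF Z] by blast
    then have eq: "u (e p) = v (e p)" if "p \<in> param_ix k n" for p
      unfolding \<Psi>_def using param_injective[OF mn(2) _ that] by blast
    show "u = v"
    proof
      fix i show "u i = v i"
      proof (cases "i < D")
        case True
        then have "i \<in> e ` param_ix k n" using bij_betw_imp_surj_on[OF e] by simp
        then show ?thesis using eq by blast
      next
        case False
        then show ?thesis using uv by (simp add: topspace_Euclidean_space)
      qed
    qed
  qed
  ultimately have "D \<le> stratum_dim k m" using mn by (intro gram_zero_fibre_dim_le) auto
  then show False using stratum_dim_mono[OF mn] by (simp add: D_def)
qed

theorem corollary3p8:
  fixes k :: nat
  assumes "k \<ge> 1"
  shows "(\<forall>m n. m \<ge> k \<and> n \<ge> k \<longrightarrow> graded_regularly_symplectomorphic k n k m) \<and>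
         (\<forall>m n. 1 \<le> m \<and> m < n \<and> n \<le> k \<longrightarrow>
            \<not> symplectic_quotient k m homeomorphic_space symplectic_quotient k n)"
  using gram_image_zero_fibre gram_equivalence_symplectomorphism symplectic_quotients_not_homeomorphic
  by metis

end
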